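(* Let $M$ be a compact Riemannian manifold without boundary, with normalized Riemannian volume $\pi$, and let $f_\omega:M\to M$, $\omega\in\Omega_0$, generate a random dynamical system with i.i.d. increments such that: (R) $\Omega_0$ is a smooth complete Riemannian manifold, $\mathbb P_0$ is absolutely continuous with respect to the Riemannian volume of $\Omega_0$, and $(\omega,x)\mapsto f_\omega(x)$ is a $C^2$ map $\Omega_0\times M\to M$; (B) there is $C_0>0$ such that for $\mathbb P_0$-a.e. $\omega$ and all $x\in M$, $|D_xf_\omega|\le C_0$ and $|(D_xf_\omega)^{-1}|^{-1}\ge C_0^{-1}$, and $\|f_\omega\|_{C^2}$ is $\mathbb P_0$-essentially bounded; (U') $(f_\omega)_*\pi=\pi$ for $\mathbb P_0$-a.e. $\omega$; (1) the one-point kernel $P$ is uniformly geometrically ergodic with unique stationary measure $\pi$; (2) the top Lyapunov exponent $\lambda_1=\lim_{n\to\infty}\frac1n\log|D_xf^n_{\underline\omega}|$ (constant for $\mathbb P\times\pi$-a.e. $(\underline\omega,x)$) satisfies $\lambda_1>0$; (3) the projective kernel $\widehat P$ is uniformly geometrically ergodic with a unique stationary measure; (4) the two-point kernel $P^{(2)}$ is $V$-uniformly geometrically ergodic for some $V:M^{(2)}\to[1,\infty)$ of the form $V(x,y)=d(x,y)^{-p}\psi(x,y)$, where $p\in(0,1)$ and $\psi:M^{(2)}\to(0,\infty)$ is continuous, bounded from above, and bounded from below by a positive constant on a neighborhood of the diagonal $\Delta$. Then for any $q,s>0$ there exist a function $D:\Omega\to[1,\infty)$ with $\mathbb E|D|^q<\infty$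 and a constant $\alpha>0$ such that for all $\varphi,\psi\in H^s(M)$ with $\int\varphi\,d\pi=\int\psi\,d\pi=0$, for $\mathbb P$-almost every $\underline\omega$ and all $n\in\mathbb N$, $$\left|\int_M\varphi(x)\,\psi\circ f^n_{\underline\omega}(x)\,d\pi(x)\right|\le D(\underline\omega)\,e^{-\alpha n}\,\|\varphi\|_{H^s}\|\psi\|_{H^s}.$$
   Context: $(\Omega_0,\mathcal F_0,\mathbb P_0)$ is a probability space, $(\Omega,\mathcal F,\mathbb P)=(\Omega_0,\mathcal F_0,\mathbb P_0)^{\mathbb N}$ with elements $\underline\omega=(\omega_1,\omega_2,\dots)$, and $f^n_{\underline\omega}=f_{\omega_n}\circ\cdots\circ f_{\omega_1}$. Let $\Delta=\{(x,x):x\in M\}$, $M^{(2)}=M\times M\setminus\Delta$, let $SM$ be the unit tangent bundle, and $d$ the Riemannian distance. The kernels are: $P(x,K)=\mathbb P_0(f_\omega(x)\in K)$ on $M$; $\widehat P((x,v),K)=\mathbb P_0(\widehat f_\omega(x,v)\in K)$ on $SM$, with $\widehat f_\omega(x,v)=(f_\omega(x),D_xf_\omega v/|D_xf_\omega v|)$; and $P^{(2)}((x,y),K)=\mathbb P_0((f_\omega(x),f_\omega(y))\in K)$ on $M^{(2)}$ (it is understood that this is a Markov kernel on $M^{(2)}$). For a Markov kernel $Q$ on a space $X$ and $V:X\to[1,\infty)$, let $\|\varphi\|_V=\sup_x|\varphi(x)|/V(x)$. $Q$ is $V$-uniformly geometrically ergodic if it has a unique stationary probability measure $\mu$ and there are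 $C>0$, $\gamma\in(0,1)$ with $|Q^n\varphi(x)-\int\varphi\,d\mu|\le C\,V(x)\|\varphi\|_V\gamma^n$ for all $x\in X$, $n\ge1$ and all measurable $\varphi$ with $\|\varphi\|_V<\infty$. It is uniformly geometrically ergodic if this holds with $V\equiv1$. *)

theory Defs
  imports "HOL-Probability.Probability"
begin

section \<open>Smooth manifolds\<close>

text \<open>
  The underlying set of a manifold is a whole type \<open>'m\<close> (Hausdorff and second countable by its type
  classes); a smooth structure on it is given by an atlas.  A chart is a pair \<open>(U, \<kappa>)\<close> of its domain
  and its coordinate map; the values of \<open>\<kappa>\<close> outside \<open>U\<close> are irrelevant.  The images of charts are
  open in the whole model space, so there is no boundary.
\<close>

type_synonym ('m, 'b) chart = "'m set \<times> ('m \<Rightarrow> 'b)"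

definition chart_inv :: "('m, 'b) chart \<Rightarrow> 'b \<Rightarrow> 'm" where
  "chart_inv c = inv_into (fst c) (snd c)"

primrec Ck_on :: "nat \<Rightarrow> 'a::real_normed_vector set \<Rightarrow> ('a \<Rightarrow> 'b::real_normed_vector) \<Rightarrow> bool" where
  "Ck_on 0 S F \<longleftrightarrow> continuous_on S F"
| "Ck_on (Suc k) S F \<longleftrightarrow>
     (\<forall>y\<in>S. F differentiable (at y)) \<and> (\<forall>v. Ck_on k S (\<lambda>y. frechet_derivative F (at y) v))"

definition smooth_on :: "'a::real_normed_vector set \<Rightarrow> ('a \<Rightarrow> 'b::real_normed_vector) \<Rightarrow> bool" where
  "smooth_on S F \<longleftrightarrow> (\<forall>k. Ck_on k S F)"

definition smooth_manifold ::
  "('m::{second_countable_topology,t2_space}, 'b::euclidean_space) chart set \<Rightarrow> bool" where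
  "smooth_manifold A \<longleftrightarrow>
     (\<Union>c\<in>A. fst c) = UNIV \<and>
     (\<forall>c\<in>A. open (fst c) \<and> open (snd c ` fst c) \<and>
        homeomorphism (fst c) (snd c ` fst c) (snd c) (chart_inv c)) \<and>
     (\<forall>c\<in>A. \<forall>c'\<in>A. smooth_on (snd c ` (fst c \<inter> fst c')) (snd c' \<circ> chart_inv c))"

definition prod_atlas ::
  "('m, 'b) chart set \<Rightarrow> ('n, 'c) chart set \<Rightarrow> ('m \<times> 'n, 'b \<times> 'c) chart set" where
  "prod_atlas A B = (\<lambda>(c, c'). (fst c \<times> fst c', map_prod (snd c) (snd c'))) ` (A \<times> B)"

definition Ck_map ::
  "nat \<Rightarrow> ('m::topological_space, 'b::euclidean_space) chart set \<Rightarrow>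
   ('n::topological_space, 'c::euclidean_space) chart set \<Rightarrow> ('m \<Rightarrow> 'n) \<Rightarrow> bool" where
  "Ck_map k A B f \<longleftrightarrow> continuous_on UNIV f \<and>
     (\<forall>c\<in>A. \<forall>c'\<in>B. Ck_on k (snd c ` (fst c \<inter> f -` fst c')) (snd c' \<circ> f \<circ> chart_inv c))"

definition smooth_function ::
  "('m::topological_space, 'b::euclidean_space) chart set \<Rightarrow> ('m \<Rightarrow> real) \<Rightarrow> bool" where
  "smooth_function A h \<longleftrightarrow> (\<forall>k. Ck_map k A {(UNIV, id)} h)"


section \<open>Tangent vectors\<close>

text \<open>
  A tangent vector at \<open>x\<close> is the family of its coordinate vectors in all charts around \<open>x\<close>; these
  transform by the Jacobians of the chart changes.
\<close>

type_synonym ('m, 'b) tvec = "('m, 'b) chart \<Rightarrow> 'b"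

definition charts_at :: "('m, 'b) chart set \<Rightarrow> 'm \<Rightarrow> ('m, 'b) chart set" where
  "charts_at A x = {c \<in> A. x \<in> fst c}"

definition tangent_space ::
  "('m, 'b::real_normed_vector) chart set \<Rightarrow> 'm \<Rightarrow> ('m, 'b) tvec set" where
  "tangent_space A x = {\<xi> \<in> extensional (charts_at A x).
     \<forall>c\<in>charts_at A x. \<forall>c'\<in>charts_at A x.
       \<xi> c' = frechet_derivative (snd c' \<circ> chart_inv c) (at (snd c x)) (\<xi> c)}"

text \<open>The tangent vector at \<open>x\<close> whose coordinate vector in the chart \<open>c\<close> is \<open>u\<close>.\<close>

definition coord_vec ::
  "('m, 'b::real_normed_vector) chart set \<Rightarrow> ('m, 'b) chart \<Rightarrow> 'm \<Rightarrow> 'b \<Rightarrow> ('m, 'b) tvec" where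
  "coord_vec A c x u =
     (\<lambda>c'\<in>charts_at A x. frechet_derivative (snd c' \<circ> chart_inv c) (at (snd c x)) u)"

definition tscale ::
  "('m, 'b::real_normed_vector) chart set \<Rightarrow> 'm \<Rightarrow> real \<Rightarrow> ('m, 'b) tvec \<Rightarrow> ('m, 'b) tvec" where
  "tscale A x r \<xi> = (\<lambda>c\<in>charts_at A x. r *\<^sub>R \<xi> c)"

text \<open>
  The differential \<open>D\<^sub>xf\<close>.  For differentiable \<open>f\<close> the result does not depend on the chosen chart
  around \<open>x\<close>, by the chain rule.
\<close>

definition tangent_map ::
  "('m, 'b::real_normed_vector) chart set \<Rightarrow> ('m \<Rightarrow> 'm) \<Rightarrow> 'm \<Rightarrow> ('m, 'b) tvec \<Rightarrow> ('m, 'b) tvec" where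
  "tangent_map A f x \<xi> =
     (let c = (SOME c. c \<in> charts_at A x)
      in (\<lambda>c'\<in>charts_at A (f x).
           frechet_derivative (snd c' \<circ> f \<circ> chart_inv c) (at (snd c x)) (\<xi> c)))"

definition tangent_bundle ::
  "('m, 'b::real_normed_vector) chart set \<Rightarrow> ('m \<times> ('m, 'b) tvec) set" where
  "tangent_bundle A = Sigma UNIV (tangent_space A)"

definition tangent_open ::
  "('m, 'b::real_normed_vector) chart set \<Rightarrow> ('m \<times> ('m, 'b) tvec) set \<Rightarrow> bool" where
  "tangent_open A W \<longleftrightarrow> W \<subseteq> tangent_bundle A \<and>
     (\<forall>c\<in>A. open ((\<lambda>(x, \<xi>). (snd c x, \<xi> c)) ` (W \<inter> {(x, \<xi>). x \<in> fst c})))"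

definition tangent_borel ::
  "('m, 'b::real_normed_vector) chart set \<Rightarrow> ('m \<times> ('m, 'b) tvec) measure" where
  "tangent_borel A = sigma (tangent_bundle A) {W. tangent_open A W}"


section \<open>Riemannian metrics\<close>

type_synonym ('m, 'b) metric = "'m \<Rightarrow> ('m, 'b) tvec \<Rightarrow> ('m, 'b) tvec \<Rightarrow> real"

definition metric_coeff ::
  "('m, 'b::real_normed_vector) chart set \<Rightarrow> ('m, 'b) metric \<Rightarrow> ('m, 'b) chart \<Rightarrow> 'm \<Rightarrow> 'b \<Rightarrow> 'b \<Rightarrow> real"
  where "metric_coeff A g c x u v = g x (coord_vec A c x u) (coord_vec A c x v)"

definition riemannian_manifold ::
  "('m::{second_countable_topology,t2_space}, 'b::euclidean_space) chart set \<Rightarrow>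
   ('m, 'b) metric \<Rightarrow> bool" where
  "riemannian_manifold A g \<longleftrightarrow> smooth_manifold A \<and>
     (\<forall>c\<in>A.
        (\<forall>x\<in>fst c. bilinear (metric_coeff A g c x) \<and>
           (\<forall>u v. metric_coeff A g c x u v = metric_coeff A g c x v u) \<and>
           (\<forall>u. u \<noteq> 0 \<longrightarrow> metric_coeff A g c x u u > 0)) \<and>
        (\<forall>u v. smooth_on (snd c ` fst c) (\<lambda>y. metric_coeff A g c (chart_inv c y) u v)))"

definition tnorm :: "('m, 'b) metric \<Rightarrow> 'm \<Rightarrow> ('m, 'b) tvec \<Rightarrow> real" where
  "tnorm g x \<xi> = sqrt (g x \<xi> \<xi>)"

definition tangent_onorm ::
  "('m, 'b::real_normed_vector) chart set \<Rightarrow> ('m, 'b) metric \<Rightarrow> 'm \<Rightarrow> 'm \<Rightarrow>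
   (('m, 'b) tvec \<Rightarrow> ('m, 'b) tvec) \<Rightarrow> real" where
  "tangent_onorm A g x y L = (SUP \<xi>\<in>{\<xi> \<in> tangent_space A x. tnorm g x \<xi> = 1}. tnorm g y (L \<xi>))"

definition unit_tangent_borel ::
  "('m, 'b::real_normed_vector) chart set \<Rightarrow> ('m, 'b) metric \<Rightarrow> ('m \<times> ('m, 'b) tvec) measure" where
  "unit_tangent_borel A g =
     restrict_space (tangent_borel A) {(x, \<xi>). \<xi> \<in> tangent_space A x \<and> tnorm g x \<xi> = 1}"

text \<open>The Riemannian volume is the Borel measure with density \<open>sqrt (det g)\<close> in every chart.\<close>

definition is_riemannian_volume ::
  "('m::topological_space, real ^ 'n) chart set \<Rightarrow> ('m, real ^ 'n) metric \<Rightarrow> 'm measure \<Rightarrow> bool" where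
  "is_riemannian_volume A g vol \<longleftrightarrow> sets vol = sets borel \<and>
     (\<forall>c\<in>A. \<forall>E\<in>sets borel. E \<subseteq> fst c \<longrightarrow>
        emeasure vol E =
          (\<integral>\<^sup>+ y\<in>snd c ` E. ennreal (sqrt (det
             (\<chi> i j. metric_coeff A g c (chart_inv c y) (axis i 1) (axis j 1)))) \<partial>lborel))"

definition piecewise_C1_curve ::
  "('m::topological_space, 'b::real_normed_vector) chart set \<Rightarrow> (real \<Rightarrow> 'm) \<Rightarrow> bool" where
  "piecewise_C1_curve A \<gamma> \<longleftrightarrow> continuous_on {0..1} \<gamma> \<and>
     (\<exists>S. finite S \<and>
       (\<forall>c\<in>A. (snd c \<circ> \<gamma>) C1_differentiable_on ({t \<in> {0..1}. \<gamma> t \<in> fst c} - S)))"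

definition velocity ::
  "('m, 'b::real_normed_vector) chart set \<Rightarrow> (real \<Rightarrow> 'm) \<Rightarrow> real \<Rightarrow> ('m, 'b) tvec" where
  "velocity A \<gamma> t = (\<lambda>c\<in>charts_at A (\<gamma> t). vector_derivative (snd c \<circ> \<gamma>) (at t))"

definition curve_length ::
  "('m, 'b::real_normed_vector) chart set \<Rightarrow> ('m, 'b) metric \<Rightarrow> (real \<Rightarrow> 'm) \<Rightarrow> ennreal" where
  "curve_length A g \<gamma> = (\<integral>\<^sup>+ t\<in>{0..1}. ennreal (tnorm g (\<gamma> t) (velocity A \<gamma> t)) \<partial>lborel)"

text \<open>The distance between points in different connected components is \<open>\<infinity>\<close>.\<close>

definition riemannian_edist ::
  "('m::topological_space, 'b::real_normed_vector) chart set \<Rightarrow> ('m, 'b) metric \<Rightarrow> 'm \<Rightarrow> 'm \<Rightarrow> ennreal"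
  where "riemannian_edist A g x y =
     (INF \<gamma>\<in>{\<gamma>. piecewise_C1_curve A \<gamma> \<and> \<gamma> 0 = x \<and> \<gamma> 1 = y}. curve_length A g \<gamma>)"

definition riemannian_dist ::
  "('m::topological_space, 'b::real_normed_vector) chart set \<Rightarrow> ('m, 'b) metric \<Rightarrow> 'm \<Rightarrow> 'm \<Rightarrow> real"
  where "riemannian_dist A g x y = enn2real (riemannian_edist A g x y)"

text \<open>The limit is taken in the manifold topology, which is the one induced by the distance.\<close>

definition complete_riemannian ::
  "('m::topological_space, 'b::real_normed_vector) chart set \<Rightarrow> ('m, 'b) metric \<Rightarrow> bool" where
  "complete_riemannian A g \<longleftrightarrow>
     (\<forall>X :: nat \<Rightarrow> 'm.
        (\<forall>e>0. \<exists>N. \<forall>m\<ge>N. \<forall>n\<ge>N. riemannian_edist A g (X m) (X n) < e) \<longrightarrow> (\<exists>l. X \<longlonglongrightarrow> l))"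


section \<open>\<open>C\<^sup>2\<close> norms and Sobolev spaces on a compact manifold\<close>

text \<open>
  Both norms are computed in charts, by means of a finite smooth partition of unity whose members
  are supported in chart domains.  Another choice gives an equivalent Sobolev norm, and the same
  families of maps with bounded \<open>C\<^sup>2\<close> norm.
\<close>

definition chart_partition ::
  "('m::topological_space, 'b::euclidean_space) chart set \<Rightarrow> (('m, 'b) chart \<times> ('m \<Rightarrow> real)) set \<Rightarrow> bool"
  where "chart_partition A PU \<longleftrightarrow> finite PU \<and>
     (\<forall>(c, \<rho>)\<in>PU. c \<in> A \<and> smooth_function A \<rho> \<and> (\<forall>x. 0 \<le> \<rho> x) \<and>
        closure {x. \<rho> x \<noteq> 0} \<subseteq> fst c) \<and>
     (\<forall>x. (\<Sum>(c, \<rho>)\<in>PU. \<rho> x) = 1)"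

definition jet2_norm ::
  "('a::real_normed_vector \<Rightarrow> 'b::real_normed_vector) \<Rightarrow> 'a \<Rightarrow> ennreal" where
  "jet2_norm F y = ennreal (norm (F y))
     + (SUP u\<in>sphere 0 1. ennreal (norm (frechet_derivative F (at y) u)))
     + (SUP u\<in>sphere 0 1. SUP v\<in>sphere 0 1.
          ennreal (norm (frechet_derivative (\<lambda>z. frechet_derivative F (at z) u) (at y) v)))"

definition C2_norm ::
  "(('m::topological_space, 'b::real_normed_vector) chart \<times> ('m \<Rightarrow> real)) set \<Rightarrow> ('m \<Rightarrow> 'm) \<Rightarrow> ennreal"
  where "C2_norm PU f =
     (SUP (c, \<rho>)\<in>PU. SUP (c', \<rho>')\<in>PU.
        SUP x\<in>closure {x. \<rho> x \<noteq> 0} \<inter> f -` closure {x. \<rho>' x \<noteq> 0}.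
          jet2_norm (snd c' \<circ> f \<circ> chart_inv c) (snd c x))"

definition fourier :: "('b::euclidean_space \<Rightarrow> real) \<Rightarrow> 'b \<Rightarrow> complex" where
  "fourier u \<xi> =
     of_real ((2 * pi) powr (- real DIM('b) / 2)) *
     (LINT y|lborel. cis (- (\<xi> \<bullet> y)) * of_real (u y))"

definition local_part ::
  "('m, 'b) chart \<Rightarrow> ('m \<Rightarrow> real) \<Rightarrow> ('m \<Rightarrow> real) \<Rightarrow> 'b \<Rightarrow> real" where
  "local_part c \<rho> \<phi> y =
     (if y \<in> snd c ` fst c then \<rho> (chart_inv c y) * \<phi> (chart_inv c y) else 0)"

text \<open>
  \<open>H\<^sup>s(M)\<close> for \<open>s \<ge> 0\<close>, as the set of Borel representatives: the localised pieces have square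
  integrable Fourier transform with weight \<open>(1 + |\<xi>|\<^sup>2)\<^sup>s\<close>.  The pieces are square integrable with
  compact support, so their Fourier transforms are given by absolutely convergent integrals.
\<close>

definition sobolev_space ::
  "(('m::topological_space, 'b::euclidean_space) chart \<times> ('m \<Rightarrow> real)) set \<Rightarrow> 'm measure \<Rightarrow> real \<Rightarrow>
   ('m \<Rightarrow> real) set" where
  "sobolev_space PU \<mu> s = {\<phi> \<in> borel_measurable borel. integrable \<mu> (\<lambda>x. (\<phi> x)\<^sup>2) \<and>
     (\<forall>(c, \<rho>)\<in>PU. integrable lborel
        (\<lambda>\<xi>. (1 + (norm \<xi>)\<^sup>2) powr s * (norm (fourier (local_part c \<rho> \<phi>) \<xi>))\<^sup>2))}"

definition sobolev_norm ::
  "(('m, 'b::euclidean_space) chart \<times> ('m \<Rightarrow> real)) set \<Rightarrow> real \<Rightarrow> ('m \<Rightarrow> real) \<Rightarrow> real" where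
  "sobolev_norm PU s \<phi> = sqrt (\<Sum>(c, \<rho>)\<in>PU.
     (LINT \<xi>|lborel. (1 + (norm \<xi>)\<^sup>2) powr s * (norm (fourier (local_part c \<rho> \<phi>) \<xi>))\<^sup>2))"


section \<open>Markov kernels and geometric ergodicity\<close>

primrec kernel_pow :: "'x measure \<Rightarrow> ('x \<Rightarrow> 'x measure) \<Rightarrow> nat \<Rightarrow> 'x \<Rightarrow> 'x measure" where
  "kernel_pow X Q 0 x = return X x"
| "kernel_pow X Q (Suc n) x = bind (kernel_pow X Q n x) Q"

definition markov_kernel :: "'x measure \<Rightarrow> ('x \<Rightarrow> 'x measure) \<Rightarrow> bool" where
  "markov_kernel X Q \<longleftrightarrow> Q \<in> X \<rightarrow>\<^sub>M prob_algebra X"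

definition stationary :: "'x measure \<Rightarrow> ('x \<Rightarrow> 'x measure) \<Rightarrow> 'x measure \<Rightarrow> bool" where
  "stationary X Q \<mu> \<longleftrightarrow> sets \<mu> = sets X \<and> prob_space \<mu> \<and> bind \<mu> Q = \<mu>"

definition weighted_norm :: "'x measure \<Rightarrow> ('x \<Rightarrow> real) \<Rightarrow> ('x \<Rightarrow> real) \<Rightarrow> real" where
  "weighted_norm X V \<phi> = (SUP x\<in>space X. \<bar>\<phi> x\<bar> / V x)"

text \<open>
  \<open>\<mu>\<close> is the unique stationary probability measure.  Integrability of the test functions is part of
  the estimate: \<open>Q\<^sup>n\<phi>(x)\<close> and \<open>\<integral>\<phi> d\<mu>\<close> have to be meaningful also for unbounded \<open>V\<close>.
\<close>

definition geometrically_ergodic ::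
  "'x measure \<Rightarrow> ('x \<Rightarrow> real) \<Rightarrow> ('x \<Rightarrow> 'x measure) \<Rightarrow> 'x measure \<Rightarrow> bool" where
  "geometrically_ergodic X V Q \<mu> \<longleftrightarrow>
     markov_kernel X Q \<and> (\<forall>x\<in>space X. 1 \<le> V x) \<and>
     stationary X Q \<mu> \<and> (\<forall>\<nu>. stationary X Q \<nu> \<longrightarrow> \<nu> = \<mu>) \<and>
     (\<exists>C>0. \<exists>\<gamma>. 0 < \<gamma> \<and> \<gamma> < 1 \<and>
       (\<forall>\<phi>\<in>borel_measurable X. bdd_above ((\<lambda>x. \<bar>\<phi> x\<bar> / V x) ` space X) \<longrightarrow>
          integrable \<mu> \<phi> \<and>
          (\<forall>x\<in>space X. \<forall>n\<ge>1. integrable (kernel_pow X Q n x) \<phi> \<and>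
             \<bar>(LINT y|kernel_pow X Q n x. \<phi> y) - (LINT y|\<mu>. \<phi> y)\<bar>
               \<le> C * V x * weighted_norm X V \<phi> * \<gamma> ^ n)))"

definition uniformly_geometrically_ergodic ::
  "'x measure \<Rightarrow> ('x \<Rightarrow> 'x measure) \<Rightarrow> 'x measure \<Rightarrow> bool" where
  "uniformly_geometrically_ergodic X Q \<mu> \<longleftrightarrow> geometrically_ergodic X (\<lambda>_. 1) Q \<mu>"


section \<open>Random dynamical systems with i.i.d. increments\<close>

text \<open>
  The noise sequence \<open>(\<omega>\<^sub>1, \<omega>\<^sub>2, \<dots>)\<close> is indexed from \<open>0\<close>: the map applied at step \<open>n + 1\<close> is \<open>f (\<omega> n)\<close>.
\<close>

primrec rds :: "('w \<Rightarrow> 'm \<Rightarrow> 'm) \<Rightarrow> nat \<Rightarrow> (nat \<Rightarrow> 'w) \<Rightarrow> 'm \<Rightarrow> 'm" where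
  "rds f 0 \<omega> = id"
| "rds f (Suc n) \<omega> = f (\<omega> n) \<circ> rds f n \<omega>"

definition noise :: "'w measure \<Rightarrow> (nat \<Rightarrow> 'w) measure" where
  "noise P0 = (\<Pi>\<^sub>M i\<in>UNIV. P0)"

definition one_point_kernel ::
  "'w measure \<Rightarrow> ('w \<Rightarrow> 'm \<Rightarrow> 'm::topological_space) \<Rightarrow> 'm \<Rightarrow> 'm measure" where
  "one_point_kernel P0 f x = distr P0 borel (\<lambda>\<omega>. f \<omega> x)"

definition projective_map ::
  "('m, 'b::real_normed_vector) chart set \<Rightarrow> ('m, 'b) metric \<Rightarrow> ('m \<Rightarrow> 'm) \<Rightarrow>
   'm \<times> ('m, 'b) tvec \<Rightarrow> 'm \<times> ('m, 'b) tvec" where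
  "projective_map A g f = (\<lambda>(x, \<xi>).
     (f x, tscale A (f x) (1 / tnorm g (f x) (tangent_map A f x \<xi>)) (tangent_map A f x \<xi>)))"

definition projective_kernel ::
  "('m, 'b::real_normed_vector) chart set \<Rightarrow> ('m, 'b) metric \<Rightarrow> 'w measure \<Rightarrow> ('w \<Rightarrow> 'm \<Rightarrow> 'm) \<Rightarrow>
   'm \<times> ('m, 'b) tvec \<Rightarrow> ('m \<times> ('m, 'b) tvec) measure" where
  "projective_kernel A g P0 f p =
     distr P0 (unit_tangent_borel A g) (\<lambda>\<omega>. projective_map A g (f \<omega>) p)"

definition off_diagonal :: "('m \<times> 'm) set" where
  "off_diagonal = {(x, y). x \<noteq> y}"

definition off_diagonal_borel :: "('m::topological_space \<times> 'm) measure" where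
  "off_diagonal_borel = restrict_space borel off_diagonal"

definition two_point_kernel ::
  "'w measure \<Rightarrow> ('w \<Rightarrow> 'm \<Rightarrow> 'm::topological_space) \<Rightarrow> 'm \<times> 'm \<Rightarrow> ('m \<times> 'm) measure" where
  "two_point_kernel P0 f = (\<lambda>(x, y). distr P0 off_diagonal_borel (\<lambda>\<omega>. (f \<omega> x, f \<omega> y)))"

end

theory Submission
  imports Defs
begin

text \<open>
  The product \<open>\<pi> \<otimes> \<pi>\<close> is stationary for the two-point process, hence it is its unique stationary measure.
  Geometric ergodicity of the two-point process therefore makes the second moments of the correlations
  \<open>\<integral> \<phi> (\<psi> \<circ> f\<^sup>n) d\<pi>\<close> of bounded mean-zero observables decay exponentially; \<open>V\<close> does
  no harm, because the integrals against \<open>\<pi> \<otimes> \<pi>\<close> of test functions below \<open>V\<close> are bounded.  At time \<open>n\<close> an observable in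
  \<open>H\<^sup>s\<close> is replaced by its averages over cubes, in charts, of a side length that decreases exponentially
  but slowly in \<open>n\<close>.  The \<open>L\<^sup>2\<close> error is exponentially small, by the Plancherel inequality applied to
  translation differences, and only a slowly growing number of correlations of indicator functions
  remains.  As these are bounded by 1, every moment decays at the rate of the second one, and \<open>D\<close> is the
  \<open>\<ell>\<^sup>r\<close> norm over time of their sums, weighted by a small exponential.
\<close>

section \<open>L1 continuity of translations and the Plancherel inequality\<close>

text \<open>The observables form an uncountable family, while \<open>D\<close> must not depend on
  them. Hence all randomness is confined to correlations of indicators of sets that depend on the
  time only; an observable enters through deterministic coefficients and errors, and one null set
  serves all observables. Indicators are also bounded, hence admissible test functions for
  \<open>V\<close>, which Sobolev functions need not be. The growth rate \<open>b\<close> of the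
  number of sets is prescribed after the decay rate \<open>\<gamma>\<close> of the second moments
  and the moment order \<open>r\<close> are known. Before the power \<open>r\<close> is taken, each
  time step costs \<open>b ^ 5\<close>: one factor for the exponential weight, two for the
  coefficients of both observables, two for the number of pairs. The choice
  \<open>b ^ (5 * r) = \<gamma> powr (- 1 / 2)\<close> leaves half of the decay exponent. On the
  analytic side, Fourier bounds have to be turned into L2 bounds, which is one direction of
  Plancherel's theorem. Gaussian regularisation gives it without Fourier inversion.\<close>

lemma lborel_distr_plus_right:
  fixes h :: "'a::euclidean_space"
  shows "distr lborel borel (\<lambda>x. x + h) = lborel"
proof -
  have "(\<lambda>x. x + h) = (+) h" by (simp add: fun_eq_iff add.commute)
  then show ?thesis using lborel_distr_plus[of h] by simp
qed

lemma integrable_lborel_translate: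
  fixes f :: "'a::euclidean_space \<Rightarrow> 'b::{banach, second_countable_topology}"
  assumes "integrable lborel f"
  shows "integrable lborel (\<lambda>x. f (x + h))"
proof -
  have "integrable (distr lborel borel (\<lambda>x. x + h)) f"
    using assms by (simp add: lborel_distr_plus_right)
  then show ?thesis by (subst (asm) integrable_distr_eq) (use assms in auto)
qed

lemma integral_lborel_translate:
  fixes f :: "'a::euclidean_space \<Rightarrow> 'b::{banach, second_countable_topology}"
  assumes "f \<in> borel_measurable borel"
  shows "(LINT x|lborel. f (x + h)) = (LINT x|lborel. f x)"
proof -
  have "(LINT x|lborel. f x) = (LINT x|distr lborel borel (\<lambda>x. x + h). f x)"
    by (simp add: lborel_distr_plus_right)
  also have "\<dots> = (LINT x|lborel. f (x + h))"
    using assms by (intro integral_distr) auto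
  finally show ?thesis ..
qed

text \<open>Translations are isometries of L1, so a three-term estimate passes the continuity of
  translates to L1 limits.\<close>

lemma tendsto_L1_translate_approx:
  fixes v :: "'a::euclidean_space \<Rightarrow> real" and h :: "nat \<Rightarrow> 'a"
  assumes v: "integrable lborel v"
    and approx: "\<And>e. e > 0 \<Longrightarrow> \<exists>w. integrable lborel w \<and> (LINT x|lborel. \<bar>v x - w x\<bar>) < e \<and>
      (\<lambda>k. LINT x|lborel. \<bar>w (x + h k) - w x\<bar>) \<longlonglongrightarrow> 0"
  shows "(\<lambda>k. LINT x|lborel. \<bar>v (x + h k) - v x\<bar>) \<longlonglongrightarrow> 0"
proof (rule LIMSEQ_I)
  fix e :: real assume "e > 0"
  then obtain w where w: "integrable lborel w" "(LINT x|lborel. \<bar>v x - w x\<bar>) < e / 4"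
    and lim: "(\<lambda>k. LINT x|lborel. \<bar>w (x + h k) - w x\<bar>) \<longlonglongrightarrow> 0"
    using approx[of "e/4"] by auto
  obtain N where N: "\<And>k. k \<ge> N \<Longrightarrow> norm ((LINT x|lborel. \<bar>w (x + h k) - w x\<bar>) - 0) < e / 4"
    using LIMSEQ_D[OF lim, of "e/4"] \<open>e > 0\<close> by auto
  have "norm ((LINT x|lborel. \<bar>v (x + h k) - v x\<bar>) - 0) < e" if "k \<ge> N" for k
  proof -
    have [simp]: "integrable lborel (\<lambda>x. v (x + h k))" "integrable lborel (\<lambda>x. w (x + h k))"
      using v w by (auto intro: integrable_lborel_translate)
    have [measurable]: "v \<in> borel_measurable borel" "w \<in> borel_measurable borel" using v w by auto
    have tr: "(LINT x|lborel. \<bar>v (x + h k) - w (x + h k)\<bar>) = (LINT x|lborel. \<bar>v x - w x\<bar>)"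
      by (rule integral_lborel_translate[of "\<lambda>x. \<bar>v x - w x\<bar>"]) auto
    have "(LINT x|lborel. \<bar>v (x + h k) - v x\<bar>) \<le>
       (LINT x|lborel. \<bar>v (x + h k) - w (x + h k)\<bar> + \<bar>w (x + h k) - w x\<bar> + \<bar>v x - w x\<bar>)"
      using v w by (intro integral_mono) (auto intro!: Bochner_Integration.integrable_add integrable_abs Bochner_Integration.integrable_diff)
    also have "\<dots> = (LINT x|lborel. \<bar>v (x + h k) - w (x + h k)\<bar>) + (LINT x|lborel. \<bar>w (x + h k) - w x\<bar>) +
        (LINT x|lborel. \<bar>v x - w x\<bar>)"
      using v w by (subst Bochner_Integration.integral_add, (auto intro!: Bochner_Integration.integrable_add integrable_abs Bochner_Integration.integrable_diff)[2])+ simp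
    also have "\<dots> < e" using N[OF that] w(2) tr \<open>e > 0\<close> by (simp add: abs_less_iff)
    finally show ?thesis by simp
  qed
  then show "\<exists>N. \<forall>k\<ge>N. norm ((LINT x|lborel. \<bar>v (x + h k) - v x\<bar>) - 0) < e" by blast
qed

text \<open>Points of \<open>U\<close> that the translation moves out of \<open>U\<close> disappear
  in the limit, because \<open>U\<close> is open, and they are dominated by the indicator of
  \<open>U\<close>. Points moved into \<open>U\<close> have neither property, but by translation
  invariance they have the same total mass; so the first kind is counted twice in
  \<open>r\<close>.\<close>

lemma tendsto_L1_translate_open:
  fixes U :: "'a::euclidean_space set" and h :: "nat \<Rightarrow> 'a"
  assumes U: "open U" "emeasure lborel U < \<infinity>" and h: "h \<longlonglongrightarrow> 0"
  shows "(\<lambda>k. LINT x|lborel. \<bar>indicat_real U (x + h k) - indicator U x\<bar>) \<longlonglongrightarrow> 0"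
proof -
  have [measurable]: "U \<in> sets borel" using U by auto
  have iU: "integrable lborel (indicat_real U)" using U by (simp add: integrable_indicator_iff)
  have iUh[simp]: "integrable lborel (\<lambda>x. indicat_real U (x + h k))" for k
    using integrable_lborel_translate[OF iU] .
  define r where "r k x = 2 * (indicat_real U x * (1 - indicator U (x + h k)))" for k x
  have [measurable]: "r k \<in> borel_measurable borel" for k
    unfolding r_def by measurable
  have ir: "integrable lborel (r k)" for k
  proof (rule Bochner_Integration.integrable_bound)
    show "integrable lborel (\<lambda>x. 2 * indicat_real U x)" using iU by simp
    show "AE x in lborel. norm (r k x) \<le> norm (2 * indicat_real U x)"
      by (auto simp: r_def indicator_def)
  qed simp
  have eq: "(LINT x|lborel. \<bar>indicat_real U (x + h k) - indicator U x\<bar>) = (LINT x|lborel. r k x)" for k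
  proof -
    have "(LINT x|lborel. \<bar>indicat_real U (x + h k) - indicator U x\<bar>) =
      (LINT x|lborel. indicat_real U (x + h k) - indicator U x + r k x)"
      by (intro Bochner_Integration.integral_cong) (auto simp: r_def indicator_def)
    also have "\<dots> = (LINT x|lborel. indicat_real U (x + h k)) - (LINT x|lborel. indicator U x) + (LINT x|lborel. r k x)"
      using iU ir by simp
    also have "(LINT x|lborel. indicat_real U (x + h k)) = (LINT x|lborel. indicator U x)"
      by (rule integral_lborel_translate) auto
    finally show ?thesis by simp
  qed
  have "(\<lambda>k. LINT x|lborel. r k x) \<longlonglongrightarrow> (LINT x::'a|lborel. 0::real)"
  proof (rule integral_dominated_convergence[where s=r and f="\<lambda>_. 0" and w="\<lambda>x. 2 * indicat_real U x"])
    show "AE x in lborel. (\<lambda>k. r k x) \<longlonglongrightarrow> 0"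
    proof (intro AE_I2)
      fix x :: 'a
      show "(\<lambda>k. r k x) \<longlonglongrightarrow> 0"
      proof (cases "x \<in> U")
        case True
        have "(\<lambda>k. x + h k) \<longlonglongrightarrow> x + 0" by (intro tendsto_intros h)
        then have "eventually (\<lambda>k. x + h k \<in> U) sequentially"
          using U(1) True by (intro topological_tendstoD) auto
        then have "eventually (\<lambda>k. r k x = 0) sequentially"
          by eventually_elim (simp add: r_def)
        then show ?thesis by (rule tendsto_eventually)
      qed (simp add: r_def)
    qed
    show "integrable lborel (\<lambda>x. 2 * indicat_real U x)" using iU by simp
    show "AE x in lborel. norm (r k x) \<le> 2 * indicat_real U x" for k
      by (auto simp: r_def indicator_def)
  qed auto
  then show ?thesis by (simp add: eq)
qed

text \<open>Induction over integrable functions. Outer regularity reduces the indicator of a Borel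
  set of finite measure to that of an open set.\<close>

lemma tendsto_L1_translate:
  fixes v :: "'a::euclidean_space \<Rightarrow> real" and h :: "nat \<Rightarrow> 'a"
  assumes "integrable lborel v" and h: "h \<longlonglongrightarrow> 0"
  shows "(\<lambda>k. LINT x|lborel. \<bar>v (x + h k) - v x\<bar>) \<longlonglongrightarrow> 0"
  using assms(1)
proof (induction v)
  case (base E c)
  have [measurable]: "E \<in> sets borel" using base by simp
  have iE: "integrable lborel (indicat_real E)" using base by (simp add: integrable_indicator_iff)
  have "(\<lambda>k. LINT x|lborel. \<bar>indicat_real E (x + h k) - indicat_real E x\<bar>) \<longlonglongrightarrow> 0"
  proof (rule tendsto_L1_translate_approx[OF iE])
    fix e :: real assume "e > 0"
    obtain U where U: "open U" "E \<subseteq> U" "emeasure lborel (U - E) < e"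
      using outer_regular_lborel[OF \<open>E \<in> sets borel\<close> \<open>e > 0\<close>] by blast
    have [measurable]: "U \<in> sets borel" using U by auto
    have "emeasure lborel U = emeasure lborel E + emeasure lborel (U - E)"
      using U(2) by (subst plus_emeasure) (auto simp: Un_absorb1)
    also have "\<dots> < \<infinity>" using U base(2) by (auto simp: ennreal_add_eq_top less_top intro: order.strict_trans)
    finally have fU: "emeasure lborel U < \<infinity>" .
    have "(LINT x|lborel. \<bar>indicat_real E x - indicator U x\<bar>) = (LINT x|lborel. indicat_real (U - E) x)"
      using U(2) by (intro Bochner_Integration.integral_cong) (auto simp: indicator_def)
    also have "\<dots> = measure lborel (U - E)" by simp
    also have "\<dots> < e" using U(3) \<open>e > 0\<close>
      by (simp add: measure_def enn2real_less_iff[OF order.strict_trans[OF U(3)]])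
    finally have "(LINT x|lborel. \<bar>indicat_real E x - indicator U x\<bar>) < e" .
    then show "\<exists>w. integrable lborel w \<and> (LINT x|lborel. \<bar>indicat_real E x - w x\<bar>) < e \<and>
      (\<lambda>k. LINT x|lborel. \<bar>w (x + h k) - w x\<bar>) \<longlonglongrightarrow> 0"
      using tendsto_L1_translate_open[OF U(1) fU h] fU
      by (intro exI[of _ "indicat_real U"]) (auto simp: integrable_indicator_iff)
  qed
  from tendsto_mult_right_zero[OF this, of "\<bar>c\<bar>"]
  show ?case by (simp add: abs_mult left_diff_distrib[symmetric] flip: mult.commute[of "\<bar>c\<bar>"])
next
  case (add v w)
  note [simp] = add.hyps[THEN integrable_lborel_translate] add.hyps
  show ?case
  proof (rule tendsto_sandwich[OF _ _ tendsto_const])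
    show "(\<lambda>k. (LINT x|lborel. \<bar>v (x + h k) - v x\<bar>) + (LINT x|lborel. \<bar>w (x + h k) - w x\<bar>)) \<longlonglongrightarrow> 0"
      using tendsto_add[OF add.IH] by simp
    show "\<forall>\<^sub>F k in sequentially. (LINT x|lborel. \<bar>v (x + h k) + w (x + h k) - (v x + w x)\<bar>)
      \<le> (LINT x|lborel. \<bar>v (x + h k) - v x\<bar>) + (LINT x|lborel. \<bar>w (x + h k) - w x\<bar>)"
    proof (intro always_eventually allI)
      fix k
      have "(LINT x|lborel. \<bar>v (x + h k) + w (x + h k) - (v x + w x)\<bar>)
        \<le> (LINT x|lborel. \<bar>v (x + h k) - v x\<bar> + \<bar>w (x + h k) - w x\<bar>)"
        by (intro integral_mono) auto
      then show "(LINT x|lborel. \<bar>v (x + h k) + w (x + h k) - (v x + w x)\<bar>)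
      \<le> (LINT x|lborel. \<bar>v (x + h k) - v x\<bar>) + (LINT x|lborel. \<bar>w (x + h k) - w x\<bar>)"
        by simp
    qed
  qed (auto intro!: always_eventually)
next
  case (lim f s)
  have [measurable]: "f \<in> borel_measurable borel" "s i \<in> borel_measurable borel" for i
    using lim by auto
  show ?case
  proof (rule tendsto_L1_translate_approx[OF lim.hyps(4)])
    fix e :: real assume "e > 0"
    \<comment> \<open>The simple functions satisfy \<bar>s i x\<bar> \<le> 2 * \<bar>f x\<bar>,
      whence the dominating function with factor 3.\<close>
    have "(\<lambda>i. LINT x|lborel. \<bar>f x - s i x\<bar>) \<longlonglongrightarrow> (LINT x::'a|lborel. 0::real)"
    proof (rule integral_dominated_convergence[where w="\<lambda>x. 3 * \<bar>f x\<bar>"])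
      show "AE x in lborel. (\<lambda>i. \<bar>f x - s i x\<bar>) \<longlonglongrightarrow> 0"
        using lim.hyps(2) by (intro AE_I2 tendsto_eq_intros tendsto_rabs_zero) auto
      show "AE x in lborel. norm \<bar>f x - s i x\<bar> \<le> 3 * \<bar>f x\<bar>" for i
      proof (intro AE_I2)
        fix x show "norm \<bar>f x - s i x\<bar> \<le> 3 * \<bar>f x\<bar>" using lim.hyps(3)[of x i] by simp
      qed
    qed (use lim in auto)
    then have "eventually (\<lambda>i. (LINT x|lborel. \<bar>f x - s i x\<bar>) < e) sequentially"
      using \<open>e > 0\<close> by (intro order_tendstoD(2)[of _ 0]) auto
    then obtain i where "(LINT x|lborel. \<bar>f x - s i x\<bar>) < e" by (auto simp: eventually_sequentially)
    then show "\<exists>w. integrable lborel w \<and> (LINT x|lborel. \<bar>f x - w x\<bar>) < e \<and>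
      (\<lambda>k. LINT x|lborel. \<bar>w (x + h k) - w x\<bar>) \<longlonglongrightarrow> 0"
      using lim.hyps(1) lim.IH by blast
  qed
qed

section \<open>Square integrable functions and their autocorrelation\<close>

lemma integrable_mult_L2:
  fixes a b :: "'a \<Rightarrow> real"
  assumes [measurable]: "a \<in> borel_measurable M" "b \<in> borel_measurable M"
    and "integrable M (\<lambda>x. (a x)\<^sup>2)" "integrable M (\<lambda>x. (b x)\<^sup>2)"
  shows "integrable M (\<lambda>x. a x * b x)"
proof (rule Bochner_Integration.integrable_bound)
  show "integrable M (\<lambda>x. (a x)\<^sup>2 + (b x)\<^sup>2)" using assms by simp
  show "AE x in M. norm (a x * b x) \<le> norm ((a x)\<^sup>2 + (b x)\<^sup>2)"
  proof (intro AE_I2)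
    fix x
    have "0 \<le> (\<bar>a x\<bar> - \<bar>b x\<bar>)\<^sup>2" "0 \<le> (a x)\<^sup>2 + (b x)\<^sup>2" "0 \<le> \<bar>a x\<bar> * \<bar>b x\<bar>" by auto
    then show "norm (a x * b x) \<le> norm ((a x)\<^sup>2 + (b x)\<^sup>2)"
      by (simp only: power2_diff power2_abs real_norm_def abs_mult abs_of_nonneg)
  qed
qed measurable

lemma integrable_diff_L2:
  fixes a b :: "'a \<Rightarrow> real"
  assumes "a \<in> borel_measurable M" "b \<in> borel_measurable M"
    and "integrable M (\<lambda>x. (a x)\<^sup>2)" "integrable M (\<lambda>x. (b x)\<^sup>2)"
  shows "integrable M (\<lambda>x. (a x - b x)\<^sup>2)"
  using assms integrable_mult_L2[OF assms] by (simp add: power2_diff mult.assoc)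

text \<open>The map \<open>t \<mapsto> t * \<bar>t\<bar>\<close> carries L2 functions to L1
  functions, and \<open>pt\<close> bounds squared differences by differences of the images. So L2
  continuity of translations is inherited from L1 continuity.\<close>

lemma tendsto_autocorrelation:
  fixes v :: "'a::euclidean_space \<Rightarrow> real" and h :: "nat \<Rightarrow> 'a"
  assumes [measurable]: "v \<in> borel_measurable borel" and v2: "integrable lborel (\<lambda>x. (v x)\<^sup>2)"
    and h: "h \<longlonglongrightarrow> 0"
  shows "(\<lambda>k. LINT x|lborel. v x * v (x + h k)) \<longlonglongrightarrow> (LINT x|lborel. (v x)\<^sup>2)"
proof -
  have v2h: "integrable lborel (\<lambda>x. (v (x + y))\<^sup>2)" for y
    using integrable_lborel_translate[OF v2] .
  note im = integrable_mult_L2[OF _ _ v2 v2h, simplified] and id = integrable_diff_L2[OF _ _ v2h v2, simplified]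
  have *: "integrable lborel (\<lambda>x. v x * \<bar>v x\<bar>)"
    by (rule Bochner_Integration.integrable_bound[OF v2]) (auto simp: power2_eq_square abs_mult)
  \<comment> \<open>For equal signs \<bar>a - b\<bar> \<le> \<bar>a + b\<bar> is the point; for
    opposite signs the right side is twice the sum of the squares.\<close>
  have pt: "(a - b)\<^sup>2 \<le> 2 * \<bar>a * \<bar>a\<bar> - b * \<bar>b\<bar>\<bar>" for a b :: real
  proof (cases "a * b \<ge> 0")
    case True
    have "(a - b)\<^sup>2 = \<bar>a - b\<bar> * \<bar>a - b\<bar>" by (simp add: power2_eq_square)
    also have "\<dots> \<le> \<bar>a - b\<bar> * \<bar>a + b\<bar>" using True by (intro mult_left_mono) (auto simp: zero_le_mult_iff)
    also have "\<dots> = \<bar>a * \<bar>a\<bar> - b * \<bar>b\<bar>\<bar>"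
    proof (cases "a \<ge> 0 \<and> b \<ge> 0")
      case nn: True
      then show ?thesis unfolding abs_mult[symmetric] by (simp add: algebra_simps)
    next
      case False
      with True have "a \<le> 0 \<and> b \<le> 0" by (auto simp: zero_le_mult_iff)
      then show ?thesis unfolding abs_mult[symmetric]
        by (simp add: algebra_simps abs_minus_commute)
    qed
    also have "\<dots> \<le> 2 * \<dots>" by (rule order.trans[OF _ mult_right_mono[of 1 2]]) auto
    finally show ?thesis .
  next
    case False
    have "\<bar>a * \<bar>a\<bar> - b * \<bar>b\<bar>\<bar> = a\<^sup>2 + b\<^sup>2"
    proof (cases "a > 0")
      case True
      with False have "b < 0" by (simp add: zero_le_mult_iff not_le)
      with True show ?thesis by (simp add: power2_eq_square)
    next
      case a: False
      with False have "a < 0" "b > 0" by (auto simp: zero_le_mult_iff not_le)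
      then have "\<bar>a * \<bar>a\<bar> - b * \<bar>b\<bar>\<bar> = \<bar>- (a\<^sup>2 + b\<^sup>2)\<bar>" by (simp add: power2_eq_square)
      then show ?thesis by simp
    qed
    moreover have "(a - b)\<^sup>2 \<le> 2 * (a\<^sup>2 + b\<^sup>2)"
      using zero_le_power2[of "a + b"] by (simp add: power2_diff power2_sum)
    ultimately show ?thesis by simp
  qed
  have "(\<lambda>k. LINT x|lborel. (v (x + h k) - v x)\<^sup>2) \<longlonglongrightarrow> 0"
  proof (rule tendsto_sandwich[OF _ _ tendsto_const])
    show "(\<lambda>k. 2 * (LINT x|lborel. \<bar>v (x + h k) * \<bar>v (x + h k)\<bar> - v x * \<bar>v x\<bar>\<bar>)) \<longlonglongrightarrow> 0"
      using tendsto_mult_right_zero[OF tendsto_L1_translate[OF * h], of 2] by simp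
    show "\<forall>\<^sub>F k in sequentially. (LINT x|lborel. (v (x + h k) - v x)\<^sup>2)
       \<le> 2 * (LINT x|lborel. \<bar>v (x + h k) * \<bar>v (x + h k)\<bar> - v x * \<bar>v x\<bar>\<bar>)"
    proof (intro always_eventually allI)
      fix k
      have "(LINT x|lborel. (v (x + h k) - v x)\<^sup>2)
       \<le> (LINT x|lborel. 2 * \<bar>v (x + h k) * \<bar>v (x + h k)\<bar> - v x * \<bar>v x\<bar>\<bar>)"
        using pt id * integrable_lborel_translate[OF *] by (intro integral_mono) auto
      then show "(LINT x|lborel. (v (x + h k) - v x)\<^sup>2)
       \<le> 2 * (LINT x|lborel. \<bar>v (x + h k) * \<bar>v (x + h k)\<bar> - v x * \<bar>v x\<bar>\<bar>)" by simp
    qed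
  qed (auto intro!: always_eventually)
  \<comment> \<open>Polarisation: both translates have the same L2 norm.\<close>
  moreover have "(LINT x|lborel. v x * v (x + h k)) = (LINT x|lborel. (v x)\<^sup>2) - (LINT x|lborel. (v (x + h k) - v x)\<^sup>2) / 2" for k
  proof -
    have "(LINT x|lborel. (v (x + h k) - v x)\<^sup>2) = (LINT x|lborel. (v (x + h k))\<^sup>2 + (v x)\<^sup>2 - 2 * (v x * v (x + h k)))"
      by (intro Bochner_Integration.integral_cong) (auto simp: power2_diff)
    also have "\<dots> = (LINT x|lborel. (v (x + h k))\<^sup>2) + (LINT x|lborel. (v x)\<^sup>2) - 2 * (LINT x|lborel. v x * v (x + h k))"
      using v2 v2h im by simp
    also have "(LINT x|lborel. (v (x + h k))\<^sup>2) = (LINT x|lborel. (v x)\<^sup>2)"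
      by (rule integral_lborel_translate) auto
    finally show ?thesis by linarith
  qed
  ultimately have "(\<lambda>k. LINT x|lborel. v x * v (x + h k)) \<longlonglongrightarrow> (LINT x|lborel. (v x)\<^sup>2) - 0 / 2"
    by (simp only:) (intro tendsto_intros; simp)
  then show ?thesis by simp
qed

section \<open>The standard Gaussian density and its Fourier transform\<close>

lemma integral_lborel_scale:
  fixes f :: "'a::euclidean_space \<Rightarrow> 'b::{banach, second_countable_topology}"
  assumes [measurable]: "f \<in> borel_measurable borel" and "t > 0"
  shows "(LINT x|lborel. f x) = t ^ DIM('a) *\<^sub>R (LINT x|lborel. f (t *\<^sub>R x))"
proof -
  have "(LINT x|lborel. f x) = (LINT x|density (distr lborel borel (\<lambda>x::'a. 0 + t *\<^sub>R x)) (\<lambda>_. \<bar>t\<bar> ^ DIM('a)). f x)"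
    using \<open>t > 0\<close> by (subst lborel_affine[of t 0]) auto
  also have "\<dots> = (LINT x|distr lborel borel (\<lambda>x::'a. 0 + t *\<^sub>R x). \<bar>t\<bar> ^ DIM('a) *\<^sub>R f x)"
    by (rule integral_density) auto
  also have "\<dots> = (LINT x|lborel. t ^ DIM('a) *\<^sub>R f (t *\<^sub>R x))"
    using \<open>t > 0\<close> by (subst integral_distr) auto
  finally show ?thesis by simp
qed

lemma integrable_lborel_scale:
  fixes f :: "'a::euclidean_space \<Rightarrow> 'b::{banach, second_countable_topology}"
  assumes f: "integrable lborel f" and "t > 0"
  shows "integrable lborel (\<lambda>x. f (t *\<^sub>R x))"
proof -
  have [measurable]: "f \<in> borel_measurable borel" using f by simp
  have "integrable (density (distr lborel borel (\<lambda>x::'a. 0 + t *\<^sub>R x)) (\<lambda>_. \<bar>t\<bar> ^ DIM('a))) f"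
    using f \<open>t > 0\<close> by (subst lborel_affine[of t 0, symmetric]) auto
  then have "integrable (distr lborel borel (\<lambda>x::'a. 0 + t *\<^sub>R x)) (\<lambda>x. \<bar>t\<bar> ^ DIM('a) *\<^sub>R f x)"
    by (subst (asm) integrable_density) auto
  then have "integrable lborel (\<lambda>x. t ^ DIM('a) *\<^sub>R f (t *\<^sub>R x))"
    using \<open>t > 0\<close> by (subst (asm) integrable_distr_eq) auto
  then have "integrable lborel (\<lambda>x. inverse (t ^ DIM('a)) *\<^sub>R t ^ DIM('a) *\<^sub>R f (t *\<^sub>R x))"
    by (rule integrable_scaleR_right)
  then show ?thesis using \<open>t > 0\<close> by simp
qed

lemma lborel_integral_prod_Basis:
  fixes f :: "'a::euclidean_space \<Rightarrow> real \<Rightarrow> 'b::{real_normed_field, banach, second_countable_topology}"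
  assumes f: "\<And>b. b \<in> Basis \<Longrightarrow> integrable lborel (f b)"
  shows "integrable lborel (\<lambda>x::'a. \<Prod>b\<in>Basis. f b (x \<bullet> b))"
    and "(LINT x|lborel. (\<Prod>b\<in>Basis. f b (x \<bullet> b))) = (\<Prod>b\<in>Basis. LINT x|lborel. f b x)"
proof -
  interpret product_sigma_finite "\<lambda>_::'a. lborel :: real measure" ..
  have [measurable]: "f b \<in> borel_measurable borel" if "b \<in> Basis" for b using f[OF that] by simp
  have [measurable]: "(\<lambda>x::'a. \<Prod>b\<in>Basis. f b (x \<bullet> b)) \<in> borel_measurable borel"
    by (intro borel_measurable_prod) measurable
  have rep: "(\<Prod>b\<in>Basis. f b ((\<Sum>b\<in>Basis. y b *\<^sub>R b) \<bullet> b)) = (\<Prod>b\<in>Basis. f b (y b))" for y :: "'a \<Rightarrow> real"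
    by (intro prod.cong) auto
  have m: "(\<lambda>y. \<Sum>b\<in>Basis. y b *\<^sub>R b) \<in> (\<Pi>\<^sub>M b\<in>Basis. lborel) \<rightarrow>\<^sub>M (borel :: 'a measure)" by measurable
  have "integrable (\<Pi>\<^sub>M b\<in>Basis. lborel) (\<lambda>y. \<Prod>b\<in>Basis. f b ((\<Sum>b\<in>Basis. y b *\<^sub>R b) \<bullet> b))"
    unfolding rep by (rule product_integrable_prod) (use f in auto)
  then show "integrable lborel (\<lambda>x::'a. \<Prod>b\<in>Basis. f b (x \<bullet> b))"
    by (subst lborel_eq) (subst integrable_distr_eq[OF m], auto)
  have "(LINT x|lborel. (\<Prod>b\<in>Basis. f b (x \<bullet> b)))
      = (LINT y|(\<Pi>\<^sub>M b\<in>Basis. lborel). (\<Prod>b\<in>Basis. f b ((\<Sum>b\<in>Basis. y b *\<^sub>R b) \<bullet> b)))"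
    by (subst lborel_eq) (subst integral_distr[OF m], auto)
  also have "\<dots> = (\<Prod>b\<in>Basis. LINT x|lborel. f b x)"
    unfolding rep by (rule product_integral_prod) (use f in auto)
  finally show "(LINT x|lborel. (\<Prod>b\<in>Basis. f b (x \<bullet> b))) = (\<Prod>b\<in>Basis. LINT x|lborel. f b x)" .
qed

definition gauss :: "'a::euclidean_space \<Rightarrow> real" where
  "gauss x = (\<Prod>b\<in>Basis. std_normal_density (x \<bullet> b))"

lemma gauss_eq:
  fixes x :: "'a::euclidean_space"
  shows "gauss x = (1 / sqrt (2 * pi)) ^ DIM('a) * exp (- (norm x)\<^sup>2 / 2)"
proof -
  have "gauss x = (1 / sqrt (2 * pi)) ^ DIM('a) * exp (\<Sum>b\<in>Basis. - (x \<bullet> b)\<^sup>2 / 2)"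
    unfolding gauss_def normal_density_def by (simp add: prod.distrib prod_dividef exp_sum power_divide)
  also have "(\<Sum>b\<in>Basis. - (x \<bullet> b)\<^sup>2 / 2) = - (\<Sum>b\<in>Basis. (x \<bullet> b)\<^sup>2) / 2"
    by (simp add: sum_negf sum_divide_distrib)
  also have "(\<Sum>b\<in>Basis. (x \<bullet> b)\<^sup>2) = (norm x)\<^sup>2"
    by (simp add: norm_eq_sqrt_inner euclidean_inner[of x x] power2_eq_square sum_nonneg)
  finally show ?thesis .
qed

lemma gauss_pos: "gauss x > 0"
  by (simp add: gauss_eq)

lemma gauss_measurable [measurable]: "gauss \<in> borel_measurable borel"
  unfolding gauss_def by (intro borel_measurable_prod) measurable

lemma integrable_gauss: "integrable lborel (gauss :: 'a::euclidean_space \<Rightarrow> real)"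
  unfolding gauss_def by (rule lborel_integral_prod_Basis) simp

lemma integral_gauss: "(LINT x::'a::euclidean_space|lborel. gauss x) = 1"
  unfolding gauss_def by (subst lborel_integral_prod_Basis(2)) simp_all

text \<open>Both the density and the phase factor over the coordinates; each factor is the
  characteristic function of the standard normal distribution.\<close>

lemma fourier_gauss:
  fixes h :: "'a::euclidean_space"
  shows "(LINT x|lborel. of_real (gauss x) * cis (x \<bullet> h)) = of_real (exp (- (norm h)\<^sup>2 / 2))"
proof -
  have 1: "(LINT x|lborel. of_real (std_normal_density x) * cis (t * x)) = complex_of_real (exp (- t\<^sup>2 / 2))" for t
  proof -
    have "char std_normal_distribution t = (LINT x|lborel. std_normal_density x *\<^sub>R iexp (t * x))"
      unfolding char_def by (rule integral_density) auto
    also have "\<dots> = (LINT x|lborel. of_real (std_normal_density x) * cis (t * x))"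
      by (simp add: scaleR_conv_of_real cis_conv_exp)
    finally show ?thesis by (simp add: char_std_normal_distribution)
  qed
  have int: "integrable lborel (\<lambda>x. of_real (std_normal_density x) * cis (t * x))" for t
  proof (rule Bochner_Integration.integrable_bound[where f=std_normal_density])
    have [measurable]: "(\<lambda>x. cis (t * x)) \<in> borel_measurable borel"
      by (intro borel_measurable_continuous_onI continuous_intros)
    show "(\<lambda>x. of_real (std_normal_density x) * cis (t * x)) \<in> borel_measurable lborel" by measurable
  qed (auto simp: norm_mult)
  have cis_prod: "(\<Prod>b\<in>S. cis (g b)) = cis (\<Sum>b\<in>S. g b)" for g :: "'a \<Rightarrow> real" and S
    by (induction S rule: infinite_finite_induct) (simp_all add: cis_mult)
  have eq: "of_real (gauss x) * cis (x \<bullet> h) =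
      (\<Prod>b\<in>Basis. of_real (std_normal_density (x \<bullet> b)) * cis ((h \<bullet> b) * (x \<bullet> b)))" for x
    unfolding gauss_def prod.distrib cis_prod
    by (simp add: euclidean_inner[of x h] mult.commute)
  have "(LINT x|lborel. of_real (gauss x) * cis (x \<bullet> h)) = (\<Prod>b\<in>Basis. complex_of_real (exp (- (h \<bullet> b)\<^sup>2 / 2)))"
    unfolding eq by (subst lborel_integral_prod_Basis(2)[OF int]) (simp add: 1)
  also have "\<dots> = of_real (exp (\<Sum>b\<in>Basis. - (h \<bullet> b)\<^sup>2 / 2))"
    by (simp add: exp_sum)
  also have "(\<Sum>b\<in>Basis. - (h \<bullet> b)\<^sup>2 / 2) = - (norm h)\<^sup>2 / 2"
  proof -
    have "(\<Sum>b\<in>Basis. - (h \<bullet> b)\<^sup>2 / 2) = - (\<Sum>b\<in>Basis. (h \<bullet> b)\<^sup>2) / 2"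
      by (simp add: sum_negf sum_divide_distrib)
    also have "(\<Sum>b\<in>Basis. (h \<bullet> b)\<^sup>2) = (norm h)\<^sup>2"
      by (simp add: norm_eq_sqrt_inner euclidean_inner[of h h] power2_eq_square sum_nonneg)
    finally show ?thesis .
  qed
  finally show ?thesis .
qed

lemma measurable_cis [measurable (raw)]:
  assumes [measurable]: "f \<in> borel_measurable M"
  shows "(\<lambda>x. cis (f x)) \<in> borel_measurable M"
proof -
  have [measurable]: "cis \<in> borel_measurable borel"
    by (intro borel_measurable_continuous_onI continuous_intros)
  show ?thesis by measurable
qed

text \<open>The normalisation of \<open>fourier\<close> coincides with the value of
  \<open>gauss\<close> at 0, which lets all constants cancel in
  \<open>gaussian_regularised_fourier\<close>.\<close>

lemma fourier_const:
  "(2 * pi) powr (- real n / 2) = (1 / sqrt (2 * pi)) ^ n"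
proof -
  have "(1 / sqrt (2 * pi)) = (2 * pi) powr (- 1 / 2)"
    by (simp add: powr_minus powr_half_sqrt divide_simps)
  then have "(1 / sqrt (2 * pi)) ^ n = ((2 * pi) powr (- 1 / 2)) powr real n"
    by (simp add: powr_realpow)
  then show ?thesis by (simp add: powr_powr)
qed

section \<open>Plancherel inequality by Gaussian regularisation\<close>

lemma integrable_cis_mult:
  fixes v :: "'a::euclidean_space \<Rightarrow> real"
  assumes "integrable lborel v"
  shows "integrable lborel (\<lambda>y. cis (\<xi> \<bullet> y) * of_real (v y))"
  by (rule Bochner_Integration.integrable_bound[OF assms]) (use assms in \<open>auto simp: norm_mult\<close>)

text \<open>
  The squared modulus of the Fourier transform of \<open>v\<close> is the Fourier transform of the autocorrelation of \<open>v\<close>.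
  This reduces the Plancherel inequality to the continuity of the autocorrelation at 0.
\<close>

lemma
  fixes v :: "'a::euclidean_space \<Rightarrow> real"
  assumes v: "integrable lborel v"
  defines "A \<equiv> \<lambda>h. LINT x|lborel. v x * v (x + h)"
  shows integrable_autocorrelation: "integrable lborel A"
    and norm_fourier_square: "complex_of_real ((norm (fourier v \<xi>))\<^sup>2) =
      of_real (((1 / sqrt (2 * pi)) ^ DIM('a))\<^sup>2) * (LINT h|lborel. cis (\<xi> \<bullet> h) * of_real (A h))"
proof -
  have [measurable]: "v \<in> borel_measurable borel" using v by simp
  have tr: "integrable lborel (\<lambda>h. v (x + h))" "(LINT h|lborel. \<bar>v (x + h)\<bar>) = (LINT h|lborel. \<bar>v h\<bar>)" for x
    using integrable_lborel_translate[OF v, of x] integral_lborel_translate[of "\<lambda>x. \<bar>v x\<bar>" x]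
    by (simp_all add: add.commute)
  \<comment> \<open>The double integral of the modulus is the square of the L1 norm of
    \<open>v\<close>, so Fubini's theorem is available throughout.\<close>
  have W: "integrable (lborel \<Otimes>\<^sub>M lborel) (\<lambda>(x, h). v x * v (x + h))"
  proof (rule lborel_pair.Fubini_integrable)
    show "integrable lborel (\<lambda>x. LINT h|lborel. norm (case (x, h) of (x, h) \<Rightarrow> v x * v (x + h)))"
      using v tr by (simp add: abs_mult)
    show "AE x in lborel. integrable lborel (\<lambda>h. case (x, h) of (x, h) \<Rightarrow> v x * v (x + h))"
      using tr by simp
  qed measurable
  show A: "integrable lborel A"
    unfolding A_def by (rule lborel_pair.integrable_snd) (use W in simp)
  define I where "I = (LINT y|lborel. cis (- (\<xi> \<bullet> y)) * of_real (v y))"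
  have cnjI: "cnj I = (LINT y|lborel. cis (\<xi> \<bullet> y) * of_real (v y))"
    unfolding I_def by (simp add: cis_cnj flip: Bochner_Integration.integral_cnj)
  have tr2: "(LINT h|lborel. cis (\<xi> \<bullet> (x + h)) * of_real (v (x + h))) = cnj I" for x
    unfolding cnjI using integral_lborel_translate[of "\<lambda>y. cis (\<xi> \<bullet> y) * of_real (v y)" x]
    by (simp add: add.commute)
  \<comment> \<open>The conjugate factor is written as an integral over \<open>x + h\<close>; the
    two phases then multiply to \<open>cis (\<xi> \<bullet> h)\<close>, which no longer depends on
    \<open>x\<close>.\<close>
  have "I * cnj I = (LINT x|lborel. cis (- (\<xi> \<bullet> x)) * of_real (v x) * cnj I)"
    by (subst I_def) simp
  also have "\<dots> = (LINT x|lborel. LINT h|lborel. cis (\<xi> \<bullet> h) * of_real (v x * v (x + h)))"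
  proof (intro Bochner_Integration.integral_cong refl)
    fix x
    have c: "cis (\<xi> \<bullet> h) = cis (- (\<xi> \<bullet> x)) * cis (\<xi> \<bullet> (x + h))" for h
      by (simp add: cis_mult inner_add_right)
    have "cis (\<xi> \<bullet> h) * of_real (v x * v (x + h)) =
        cis (- (\<xi> \<bullet> x)) * of_real (v x) * (cis (\<xi> \<bullet> (x + h)) * of_real (v (x + h)))" for h
      unfolding c[of h] by (simp only: of_real_mult mult_ac)
    then show "cis (- (\<xi> \<bullet> x)) * of_real (v x) * cnj I =
        (LINT h|lborel. cis (\<xi> \<bullet> h) * of_real (v x * v (x + h)))"
      by (simp only: integral_mult_right_zero tr2)
  qed
  also have "\<dots> = (LINT h|lborel. LINT x|lborel. cis (\<xi> \<bullet> h) * of_real (v x * v (x + h)))"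
  proof (rule lborel_pair.Fubini_integral)
    show "integrable (lborel \<Otimes>\<^sub>M lborel) (\<lambda>(h, x). cis (\<xi> \<bullet> h) * complex_of_real (v x * v (x + h)))"
      using W by (subst lborel_pair.integrable_product_swap_iff[symmetric])
        (rule Bochner_Integration.integrable_bound[OF W], auto simp: norm_mult)
  qed
  also have "\<dots> = (LINT h|lborel. cis (\<xi> \<bullet> h) * of_real (A h))"
    unfolding A_def integral_mult_right_zero integral_complex_of_real ..
  finally have II: "I * cnj I = \<dots>" .
  have "fourier v \<xi> = of_real ((1 / sqrt (2 * pi)) ^ DIM('a)) * I"
    unfolding fourier_def I_def fourier_const ..
  moreover have "(complex_of_real (norm I))\<^sup>2 = I * cnj I"
    by (simp only: of_real_power[symmetric] complex_norm_square)
  ultimately have "complex_of_real ((norm (fourier v \<xi>))\<^sup>2) = of_real (((1 / sqrt (2 * pi)) ^ DIM('a))\<^sup>2) * (I * cnj I)"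
    by (simp add: norm_mult power_mult_distrib norm_power norm_divide power_divide)
  then show "complex_of_real ((norm (fourier v \<xi>))\<^sup>2) =
      of_real (((1 / sqrt (2 * pi)) ^ DIM('a))\<^sup>2) * (LINT h|lborel. cis (\<xi> \<bullet> h) * of_real (A h))"
    unfolding II .
qed

lemma fourier_measurable:
  fixes v :: "'a::euclidean_space \<Rightarrow> real"
  assumes [measurable]: "v \<in> borel_measurable borel"
  shows "fourier v \<in> borel_measurable borel"
  unfolding fourier_def by measurable

text \<open>The weight makes the double integral over \<open>\<xi>\<close> and \<open>h\<close>
  absolutely convergent for mere L1 data. The Gaussian is its own Fourier transform, so it moves
  from the frequency side to the autocorrelation. Of the constants, the squared Fourier
  normalisation \<open>\<kappa>\<^sup>2\<close> meets two factors \<open>1 / \<kappa>\<close>, one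
  from \<open>E\<close> and one from \<open>inner\<close>.\<close>

lemma gaussian_regularised_fourier:
  fixes v :: "'a::euclidean_space \<Rightarrow> real"
  assumes v: "integrable lborel v" and t: "t > 0"
  shows "(LINT \<xi>|lborel. exp (- (norm (t *\<^sub>R \<xi>))\<^sup>2 / 2) * (norm (fourier v \<xi>))\<^sup>2) =
         (LINT z|lborel. gauss z * (LINT x|lborel. v x * v (x + t *\<^sub>R z)))"
proof -
  define A where "A = (\<lambda>h. LINT x|lborel. v x * v (x + h))"
  define \<kappa> where "\<kappa> = (1 / sqrt (2 * pi)) ^ DIM('a)"
  have \<kappa>: "\<kappa> > 0" by (simp add: \<kappa>_def)
  have E: "exp (- (norm z)\<^sup>2 / 2) = gauss z / \<kappa>" for z :: 'a
    using \<kappa> by (simp add: gauss_eq \<kappa>_def)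
  have A: "integrable lborel A" unfolding A_def by (rule integrable_autocorrelation[OF v])
  then have [measurable]: "A \<in> borel_measurable borel" by simp
  have g: "integrable lborel (\<lambda>\<xi>::'a. gauss (t *\<^sub>R \<xi>))"
    using t by (intro integrable_lborel_scale integrable_gauss)
  \<comment> \<open>The power of \<open>t\<close> in the denominator is undone by the substitution
    of \<open>t *\<^sub>R z\<close> for \<open>h\<close> at the end.\<close>
  have inner: "(LINT \<xi>|lborel. cis (\<xi> \<bullet> h) * of_real (gauss (t *\<^sub>R \<xi>))) = of_real (gauss (h /\<^sub>R t) / (\<kappa> * t ^ DIM('a)))" for h :: 'a
  proof -
    have "of_real (gauss (h /\<^sub>R t) / \<kappa>) = (LINT x|lborel. of_real (gauss x) * cis (x \<bullet> (h /\<^sub>R t)))"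
      unfolding fourier_gauss E ..
    also have "\<dots> = t ^ DIM('a) *\<^sub>R (LINT \<xi>|lborel. of_real (gauss (t *\<^sub>R \<xi>)) * cis ((t *\<^sub>R \<xi>) \<bullet> (h /\<^sub>R t)))"
      using t by (intro integral_lborel_scale) measurable
    also have "\<dots> = t ^ DIM('a) *\<^sub>R (LINT \<xi>|lborel. cis (\<xi> \<bullet> h) * of_real (gauss (t *\<^sub>R \<xi>)))"
    proof -
      have "(t *\<^sub>R \<xi>) \<bullet> (h /\<^sub>R t) = \<xi> \<bullet> h" for \<xi> using t by simp
      then show ?thesis by (simp only: mult.commute)
    qed
    finally show ?thesis using t \<kappa>
      by (simp add: scaleR_conv_of_real field_simps)
  qed
  have nf: "complex_of_real ((norm (fourier v \<xi>))\<^sup>2) =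
      of_real (\<kappa>\<^sup>2) * (LINT h|lborel. cis (\<xi> \<bullet> h) * of_real (A h))" for \<xi>
    unfolding A_def \<kappa>_def by (rule norm_fourier_square[OF v])
  have "complex_of_real (LINT \<xi>|lborel. exp (- (norm (t *\<^sub>R \<xi>))\<^sup>2 / 2) * (norm (fourier v \<xi>))\<^sup>2) =
      (LINT \<xi>|lborel. of_real (exp (- (norm (t *\<^sub>R \<xi>))\<^sup>2 / 2)) * of_real ((norm (fourier v \<xi>))\<^sup>2))"
    by (subst integral_complex_of_real[symmetric]) (simp only: of_real_mult)
  also have "\<dots> = (LINT \<xi>|lborel. of_real \<kappa> * (LINT h|lborel. of_real (gauss (t *\<^sub>R \<xi>)) * cis (\<xi> \<bullet> h) * of_real (A h)))"
  proof (intro Bochner_Integration.integral_cong refl)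
    fix \<xi> :: 'a
    show "of_real (exp (- (norm (t *\<^sub>R \<xi>))\<^sup>2 / 2)) * of_real ((norm (fourier v \<xi>))\<^sup>2) =
       of_real \<kappa> * (LINT h|lborel. of_real (gauss (t *\<^sub>R \<xi>)) * cis (\<xi> \<bullet> h) * of_real (A h))"
      unfolding nf E mult.assoc integral_mult_right_zero using \<kappa>
      by (simp add: power2_eq_square)
  qed
  also have "\<dots> = of_real \<kappa> * (LINT \<xi>|lborel. LINT h|lborel. of_real (gauss (t *\<^sub>R \<xi>)) * cis (\<xi> \<bullet> h) * of_real (A h))"
    by simp
  also have "(LINT \<xi>|lborel. LINT h|lborel. of_real (gauss (t *\<^sub>R \<xi>)) * cis (\<xi> \<bullet> h) * of_real (A h)) =
     (LINT h|lborel. LINT \<xi>|lborel. of_real (gauss (t *\<^sub>R \<xi>)) * cis (\<xi> \<bullet> h) * of_real (A h))"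
  proof (rule lborel_pair.Fubini_integral)
    have "integrable (lborel \<Otimes>\<^sub>M lborel) (\<lambda>(h, \<xi>::'a). A h * gauss (t *\<^sub>R \<xi>))"
      by (rule lborel_pair.Fubini_integrable) (use A g in \<open>simp_all add: abs_mult\<close>)
    then show "integrable (lborel \<Otimes>\<^sub>M lborel) (\<lambda>(h, \<xi>). complex_of_real (gauss (t *\<^sub>R \<xi>)) * cis (\<xi> \<bullet> h) * complex_of_real (A h))"
      by (rule Bochner_Integration.integrable_bound) (auto simp: norm_mult abs_mult split: prod.split)
  qed
  also have "\<dots> = (LINT h|lborel. of_real (A h * gauss (h /\<^sub>R t) / (\<kappa> * t ^ DIM('a))))"
  proof (intro Bochner_Integration.integral_cong refl)
    fix h :: 'a
    have "(LINT \<xi>|lborel. of_real (gauss (t *\<^sub>R \<xi>)) * cis (\<xi> \<bullet> h) * of_real (A h)) =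
        (LINT \<xi>|lborel. cis (\<xi> \<bullet> h) * of_real (gauss (t *\<^sub>R \<xi>))) * of_real (A h)"
      by (simp only: integral_mult_left_zero mult.commute[of "of_real (gauss _)"])
    then show "(LINT \<xi>|lborel. of_real (gauss (t *\<^sub>R \<xi>)) * cis (\<xi> \<bullet> h) * of_real (A h)) =
        complex_of_real (A h * gauss (h /\<^sub>R t) / (\<kappa> * t ^ DIM('a)))"
      by (simp add: inner)
  qed
  also have "\<dots> = of_real (LINT h|lborel. A h * gauss (h /\<^sub>R t) / (\<kappa> * t ^ DIM('a)))"
    by (rule integral_complex_of_real)
  also have "(LINT h|lborel. A h * gauss (h /\<^sub>R t) / (\<kappa> * t ^ DIM('a))) =
     (LINT h|lborel. A h * gauss (h /\<^sub>R t)) / (\<kappa> * t ^ DIM('a))"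
    by simp
  also have "(LINT h|lborel. A h * gauss (h /\<^sub>R t)) = t ^ DIM('a) * (LINT z|lborel. A (t *\<^sub>R z) * gauss z)"
    using t by (subst integral_lborel_scale[of _ t]) auto
  finally have "complex_of_real (LINT \<xi>|lborel. exp (- (norm (t *\<^sub>R \<xi>))\<^sup>2 / 2) * (norm (fourier v \<xi>))\<^sup>2) =
     of_real (LINT z|lborel. A (t *\<^sub>R z) * gauss z)"
    using \<kappa> t by simp
  then show ?thesis
    unfolding of_real_eq_iff A_def by (simp only: mult.commute)
qed

text \<open>As the regularisation is removed, the autocorrelation side of
  \<open>gaussian_regularised_fourier\<close> tends to the value at 0, the squared L2 norm, while
  the Fourier side never exceeds the unweighted integral.\<close>

lemma plancherel_le:
  fixes v :: "'a::euclidean_space \<Rightarrow> real"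
  assumes v: "integrable lborel v" and v2: "integrable lborel (\<lambda>x. (v x)\<^sup>2)"
    and F: "integrable lborel (\<lambda>\<xi>. (norm (fourier v \<xi>))\<^sup>2)"
  shows "(LINT x|lborel. (v x)\<^sup>2) \<le> (LINT \<xi>|lborel. (norm (fourier v \<xi>))\<^sup>2)"
proof -
  define t where "t k = 1 / real (Suc k)" for k
  have t: "t k > 0" "t \<longlonglongrightarrow> 0" for k
    unfolding t_def using LIMSEQ_inverse_real_of_nat by (auto simp: inverse_eq_divide)
  define A where "A = (\<lambda>h. LINT x|lborel. v x * v (x + h))"
  have [measurable]: "v \<in> borel_measurable borel" using v by simp
  have [measurable]: "A \<in> borel_measurable borel" unfolding A_def by measurable
  have v2h: "integrable lborel (\<lambda>x. (v (x + h))\<^sup>2)" for h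
    by (rule integrable_lborel_translate[OF v2])
  \<comment> \<open>The autocorrelation is largest at 0; this bound is the constant that dominates
    the limit below.\<close>
  have Abd: "\<bar>A h\<bar> \<le> (LINT x|lborel. (v x)\<^sup>2)" for h
  proof -
    have "\<bar>A h\<bar> \<le> (LINT x|lborel. \<bar>v x * v (x + h)\<bar>)"
      unfolding A_def by (rule integral_abs_bound)
    also have "\<dots> \<le> (LINT x|lborel. ((v x)\<^sup>2 + (v (x + h))\<^sup>2) / 2)"
    proof (rule integral_mono)
      show "integrable lborel (\<lambda>x. \<bar>v x * v (x + h)\<bar>)"
        using integrable_mult_L2[OF _ _ v2 v2h] by auto
      show "\<bar>v x * v (x + h)\<bar> \<le> ((v x)\<^sup>2 + (v (x + h))\<^sup>2) / 2" for x
        using zero_le_power2[of "\<bar>v x\<bar> - \<bar>v (x + h)\<bar>"] by (simp add: power2_diff abs_mult)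
    qed (use v2 v2h in auto)
    also have "\<dots> = (LINT x|lborel. (v x)\<^sup>2)"
      using v2 v2h integral_lborel_translate[of "\<lambda>x. (v x)\<^sup>2" h] by simp
    finally show ?thesis .
  qed
  have "(\<lambda>k. LINT z|lborel. gauss z * A (t k *\<^sub>R z)) \<longlonglongrightarrow> (LINT z::'a|lborel. gauss z * (LINT x|lborel. (v x)\<^sup>2))"
  proof (rule integral_dominated_convergence[where w="\<lambda>z. gauss z * (LINT x|lborel. (v x)\<^sup>2)"])
    show "integrable lborel (\<lambda>z::'a. gauss z * (LINT x|lborel. (v x)\<^sup>2))"
      using integrable_gauss[where 'a='a] by simp
    show "AE z in lborel. (\<lambda>k. gauss z * A (t k *\<^sub>R z)) \<longlonglongrightarrow> gauss z * (LINT x|lborel. (v x)\<^sup>2)"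
    proof (intro AE_I2 tendsto_intros)
      fix z :: 'a
      have "(\<lambda>k. t k *\<^sub>R z) \<longlonglongrightarrow> 0 *\<^sub>R z" by (intro tendsto_intros t)
      then show "(\<lambda>k. A (t k *\<^sub>R z)) \<longlonglongrightarrow> (LINT x|lborel. (v x)\<^sup>2)"
        unfolding A_def by (intro tendsto_autocorrelation v2) auto
    qed
    show "AE z in lborel. norm (gauss z * A (t k *\<^sub>R z)) \<le> gauss z * (LINT x|lborel. (v x)\<^sup>2)" for k
    proof (intro AE_I2)
      fix z :: 'a
      show "norm (gauss z * A (t k *\<^sub>R z)) \<le> gauss z * (LINT x|lborel. (v x)\<^sup>2)"
        using Abd[of "t k *\<^sub>R z"] gauss_pos[of z] by (simp add: abs_mult)
    qed
  qed measurable
  then have "(\<lambda>k. LINT z|lborel. gauss z * A (t k *\<^sub>R z)) \<longlonglongrightarrow> (LINT x|lborel. (v x)\<^sup>2)"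
    by (simp add: integral_gauss)
  moreover have "(LINT z|lborel. gauss z * A (t k *\<^sub>R z)) \<le> (LINT \<xi>|lborel. (norm (fourier v \<xi>))\<^sup>2)" for k
    unfolding A_def gaussian_regularised_fourier[OF v t(1), symmetric]
  proof (rule integral_mono'[OF F])
    show "exp (- (norm (t k *\<^sub>R \<xi>))\<^sup>2 / 2) * (norm (fourier v \<xi>))\<^sup>2 \<le> (norm (fourier v \<xi>))\<^sup>2" for \<xi>
      by (rule mult_left_le_one_le) auto
  qed auto
  ultimately show ?thesis by (blast intro: LIMSEQ_le_const2)
qed

section \<open>Sobolev functions and averages over cubes\<close>

lemma fourier_translate_diff:
  fixes u :: "'a::euclidean_space \<Rightarrow> real"
  assumes u: "integrable lborel u"
  shows "fourier (\<lambda>x. u (x + h) - u x) \<xi> = (cis (\<xi> \<bullet> h) - 1) * fourier u \<xi>"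
proof -
  define I where "I = (LINT y|lborel. cis (- (\<xi> \<bullet> y)) * complex_of_real (u y))"
  have [measurable]: "u \<in> borel_measurable borel" using u by simp
  have i: "integrable lborel (\<lambda>y. cis (- (\<xi> \<bullet> y)) * complex_of_real (u y))"
    using integrable_cis_mult[OF u, of "- \<xi>"] by simp
  have eq: "cis (- (\<xi> \<bullet> y)) * complex_of_real (u (y + h)) =
      cis (\<xi> \<bullet> h) * (cis (- (\<xi> \<bullet> (y + h))) * complex_of_real (u (y + h)))" for y
    by (simp add: mult.assoc[symmetric] cis_mult inner_add_right)
  have i2: "integrable lborel (\<lambda>y. cis (- (\<xi> \<bullet> y)) * complex_of_real (u (y + h)))"
    unfolding eq by (intro integrable_mult_right integrable_lborel_translate[OF i])
  have "(LINT y|lborel. cis (- (\<xi> \<bullet> y)) * complex_of_real (u (y + h) - u y)) =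
     (LINT y|lborel. cis (- (\<xi> \<bullet> y)) * complex_of_real (u (y + h))) - I"
    unfolding I_def using i i2
    by (subst Bochner_Integration.integral_diff[symmetric]) (simp_all add: right_diff_distrib)
  also have "(LINT y|lborel. cis (- (\<xi> \<bullet> y)) * complex_of_real (u (y + h))) = cis (\<xi> \<bullet> h) * I"
    unfolding eq integral_mult_right_zero I_def
    by (subst integral_lborel_translate[of "\<lambda>y. cis (- (\<xi> \<bullet> y)) * complex_of_real (u y)" h]) auto
  finally have J: "(LINT y|lborel. cis (- (\<xi> \<bullet> y)) * complex_of_real (u (y + h) - u y)) = cis (\<xi> \<bullet> h) * I - I" .
  show ?thesis
    unfolding fourier_def J I_def[symmetric] by (simp only: left_diff_distrib right_diff_distrib mult_ac mult_1)
qed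

text \<open>For \<bar>t\<bar> \<le> 1 the left side is at most the square of \<open>t\<close>, and
  lowering the exponent from 2 to \<open>2 * \<sigma>\<close> only enlarges it. For larger
  \<bar>t\<bar> the trivial bound 2 for the norm gives the constant 4.\<close>

lemma norm_cis_minus_one_square_le:
  assumes "0 \<le> \<sigma>" "\<sigma> \<le> 1"
  shows "(norm (cis t - 1))\<^sup>2 \<le> 4 * \<bar>t\<bar> powr (2 * \<sigma>)"
proof (cases "\<bar>t\<bar> \<le> 1")
  case True
  have "(norm (cis t - 1))\<^sup>2 = 2 - 2 * cos t"
    unfolding cmod_power2 using sin_cos_squared_add[of t]
    by (simp add: power2_eq_square algebra_simps)
  also have "\<dots> = 4 * (sin (t / 2))\<^sup>2"
    using cos_double_sin[of "t/2"] by simp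
  also have "(sin (t / 2))\<^sup>2 \<le> (t / 2)\<^sup>2"
    using abs_sin_x_le_abs_x[of "t/2"] by (rule abs_le_square_iff[THEN iffD1])
  finally have le: "(norm (cis t - 1))\<^sup>2 \<le> t\<^sup>2" by (simp add: power_divide)
  also have "t\<^sup>2 \<le> \<bar>t\<bar> powr (2 * \<sigma>)"
  proof (cases "t = 0")
    case False
    then have "t\<^sup>2 = \<bar>t\<bar> powr 2" by (simp add: powr_numeral)
    also have "\<dots> \<le> \<bar>t\<bar> powr (2 * \<sigma>)"
      using True assms by (intro powr_mono') auto
    finally show ?thesis .
  qed simp
  also have "\<dots> \<le> 4 * \<bar>t\<bar> powr (2 * \<sigma>)" by simp
  finally show ?thesis .
next
  case False
  have "norm (cis t - 1) \<le> norm (cis t) + norm (1::complex)" by (rule norm_triangle_ineq4)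
  then have "(norm (cis t - 1))\<^sup>2 \<le> 2\<^sup>2" by (intro power_mono) auto
  moreover have "1 \<le> \<bar>t\<bar> powr (2 * \<sigma>)" using False assms by (intro ge_one_powr_ge_zero) auto
  ultimately show ?thesis by simp
qed

lemma sobolev_L2_le:
  fixes u :: "'a::euclidean_space \<Rightarrow> real"
  assumes u: "integrable lborel u" "integrable lborel (\<lambda>x. (u x)\<^sup>2)" and s: "0 \<le> s"
    and S: "integrable lborel (\<lambda>\<xi>. (1 + (norm \<xi>)\<^sup>2) powr s * (norm (fourier u \<xi>))\<^sup>2)"
  shows "(LINT x|lborel. (u x)\<^sup>2) \<le>
    (LINT \<xi>|lborel. (1 + (norm \<xi>)\<^sup>2) powr s * (norm (fourier u \<xi>))\<^sup>2)"
proof -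
  have [measurable]: "fourier u \<in> borel_measurable borel" using u by (intro fourier_measurable) auto
  have le: "(norm (fourier u \<xi>))\<^sup>2 \<le> (1 + (norm \<xi>)\<^sup>2) powr s * (norm (fourier u \<xi>))\<^sup>2" for \<xi>
    using ge_one_powr_ge_zero[of "1 + (norm \<xi>)\<^sup>2" s] s
    by (intro mult_le_cancel_right1[THEN iffD2]) auto
  have "integrable lborel (\<lambda>\<xi>. (norm (fourier u \<xi>))\<^sup>2)"
    by (rule Bochner_Integration.integrable_bound[OF S]) (use le in auto)
  then show ?thesis
    using plancherel_le[OF u] integral_mono[OF _ S le] by fastforce
qed

text \<open>A translation multiplies the Fourier transform by a phase. The squared distance of the
  phase from 1 is traded for a power \<open>2 * \<sigma>\<close> of the frequency, which the Sobolev
  weight pays for, times the same power of \<open>norm h\<close>. The cap at 1 reflects that this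
  squared distance vanishes only to second order.\<close>

lemma sobolev_translate_le:
  fixes u :: "'a::euclidean_space \<Rightarrow> real"
  assumes u: "integrable lborel u" "integrable lborel (\<lambda>x. (u x)\<^sup>2)"
    and \<sigma>: "0 \<le> \<sigma>" "\<sigma> \<le> 1" "\<sigma> \<le> s"
    and S: "integrable lborel (\<lambda>\<xi>. (1 + (norm \<xi>)\<^sup>2) powr s * (norm (fourier u \<xi>))\<^sup>2)"
  shows "(LINT x|lborel. (u (x + h) - u x)\<^sup>2) \<le> 4 * norm h powr (2 * \<sigma>) *
    (LINT \<xi>|lborel. (1 + (norm \<xi>)\<^sup>2) powr s * (norm (fourier u \<xi>))\<^sup>2)"
proof -
  have [measurable]: "u \<in> borel_measurable borel" using u by auto
  have [measurable]: "fourier u \<in> borel_measurable borel" by (intro fourier_measurable) auto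
  have v: "integrable lborel (\<lambda>x. u (x + h) - u x)" "integrable lborel (\<lambda>x. (u (x + h) - u x)\<^sup>2)"
    using u integrable_lborel_translate[OF u(1)] integrable_diff_L2[OF _ _ integrable_lborel_translate[OF u(2)] u(2)]
    by auto
  have le: "(norm (fourier (\<lambda>x. u (x + h) - u x) \<xi>))\<^sup>2 \<le>
      4 * norm h powr (2 * \<sigma>) * ((1 + (norm \<xi>)\<^sup>2) powr s * (norm (fourier u \<xi>))\<^sup>2)" for \<xi>
  proof -
    have "(norm (cis (\<xi> \<bullet> h) - 1))\<^sup>2 \<le> 4 * \<bar>\<xi> \<bullet> h\<bar> powr (2 * \<sigma>)"
      by (rule norm_cis_minus_one_square_le) fact+
    also have "\<bar>\<xi> \<bullet> h\<bar> powr (2 * \<sigma>) \<le> (norm \<xi> * norm h) powr (2 * \<sigma>)"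
      using Cauchy_Schwarz_ineq2[of \<xi> h] \<sigma> by (intro powr_mono2) auto
    also have "\<dots> = norm h powr (2 * \<sigma>) * norm \<xi> powr (2 * \<sigma>)"
      by (simp add: powr_mult)
    also have "norm \<xi> powr (2 * \<sigma>) \<le> (1 + (norm \<xi>)\<^sup>2) powr s"
    proof -
      have "norm \<xi> powr (2 * \<sigma>) = ((norm \<xi>)\<^sup>2) powr \<sigma>"
        by (cases "\<xi> = 0") (auto simp: powr_powr simp flip: powr_numeral)
      also have "\<dots> \<le> (1 + (norm \<xi>)\<^sup>2) powr \<sigma>" using \<sigma> by (intro powr_mono2) auto
      also have "\<dots> \<le> (1 + (norm \<xi>)\<^sup>2) powr s" using \<sigma> by (intro powr_mono) auto
      finally show ?thesis .
    qed
    finally have "(norm (cis (\<xi> \<bullet> h) - 1))\<^sup>2 \<le> 4 * (norm h powr (2 * \<sigma>) * (1 + (norm \<xi>)\<^sup>2) powr s)"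
      by (simp add: mult_left_mono)
    from mult_right_mono[OF this, of "(norm (fourier u \<xi>))\<^sup>2"] show ?thesis
      by (simp add: fourier_translate_diff[OF u(1)] norm_mult power_mult_distrib mult.assoc)
  qed
  have S': "integrable lborel (\<lambda>\<xi>. 4 * norm h powr (2 * \<sigma>) * ((1 + (norm \<xi>)\<^sup>2) powr s * (norm (fourier u \<xi>))\<^sup>2))"
    by (intro integrable_mult_right S)
  have i: "integrable lborel (\<lambda>\<xi>. (norm (fourier (\<lambda>x. u (x + h) - u x) \<xi>))\<^sup>2)"
  proof (rule Bochner_Integration.integrable_bound[OF S'])
    show "(\<lambda>\<xi>. (norm (fourier (\<lambda>x. u (x + h) - u x) \<xi>))\<^sup>2) \<in> borel_measurable lborel"
      unfolding fourier_translate_diff[OF u(1)] by measurable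
  qed (use le in auto)
  have "(LINT x|lborel. (u (x + h) - u x)\<^sup>2) \<le> (LINT \<xi>|lborel. (norm (fourier (\<lambda>x. u (x + h) - u x) \<xi>))\<^sup>2)"
    by (rule plancherel_le[OF v i])
  also have "\<dots> \<le> (LINT \<xi>|lborel. 4 * norm h powr (2 * \<sigma>) * ((1 + (norm \<xi>)\<^sup>2) powr s * (norm (fourier u \<xi>))\<^sup>2))"
    by (rule integral_mono[OF i S' le])
  finally show ?thesis by simp
qed

section \<open>Grid cells of side length \<open>1 / M\<close> and averages over them\<close>

definition cell_index :: "nat \<Rightarrow> 'a::euclidean_space \<Rightarrow> 'a \<Rightarrow> int" where
  "cell_index M x = (\<lambda>b\<in>Basis. \<lfloor>real M * (x \<bullet> b)\<rfloor>)"

definition cell :: "nat \<Rightarrow> ('a::euclidean_space \<Rightarrow> int) \<Rightarrow> 'a set" where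
  "cell M k = {x. cell_index M x = k}"

definition cell_average :: "nat \<Rightarrow> ('a::euclidean_space \<Rightarrow> real) \<Rightarrow> ('a \<Rightarrow> int) \<Rightarrow> real" where
  "cell_average M u k = (LINT y|lborel. indicator (cell M k) y * u y) / measure lborel (cell M k)"

lemma cell_measurable [measurable]: "cell M k \<in> sets borel"
proof -
  have "cell M k = {x \<in> space borel. k \<in> extensional Basis \<and> (\<forall>b\<in>Basis. \<lfloor>real M * (x \<bullet> b)\<rfloor> = k b)}"
    by (auto simp: cell_def cell_index_def fun_eq_iff restrict_def extensional_def)
  also have "\<dots> \<in> sets borel" by measurable
  finally show ?thesis .
qed

lemma cell_dist:
  fixes x y :: "'a::euclidean_space"
  assumes "M \<ge> 1" "cell_index M x = cell_index M y" "b \<in> Basis"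
  shows "\<bar>(y - x) \<bullet> b\<bar> \<le> 1 / real M"
proof -
  have "\<lfloor>real M * (x \<bullet> b)\<rfloor> = \<lfloor>real M * (y \<bullet> b)\<rfloor>"
    using fun_cong[OF assms(2), of b] assms(3) by (simp add: cell_index_def)
  then have "\<bar>real M * (y \<bullet> b) - real M * (x \<bullet> b)\<bar> \<le> 1" by linarith
  then have "real M * \<bar>y \<bullet> b - x \<bullet> b\<bar> \<le> 1"
    by (simp add: abs_mult right_diff_distrib[symmetric])
  then show ?thesis using assms(1) by (simp add: inner_diff_left field_simps)
qed

text \<open>A nonempty cell is a half-open cube, squeezed between the open and the closed box with
  corners \<open>l\<close> and \<open>r\<close>.\<close>

lemma emeasure_cell:
  fixes k :: "'a::euclidean_space \<Rightarrow> int"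
  assumes M: "M \<ge> 1" and "cell M k \<noteq> {}"
  shows "emeasure lborel (cell M k) < \<infinity>" "measure lborel (cell M k) \<ge> (1 / real M) ^ DIM('a)"
proof -
  obtain z where z: "cell_index M z = k" using assms by (auto simp: cell_def)
  then have k: "k \<in> extensional Basis" by (auto simp: cell_index_def)
  define l where "l = (\<Sum>b\<in>Basis. (real_of_int (k b) / real M) *\<^sub>R b :: 'a)"
  define r where "r = (\<Sum>b\<in>Basis. (real_of_int (k b + 1) / real M) *\<^sub>R b :: 'a)"
  have l: "l \<bullet> b = real_of_int (k b) / real M" and r: "r \<bullet> b = (real_of_int (k b) + 1) / real M" if "b \<in> Basis" for b
    using that by (simp_all add: l_def r_def)
  have mem: "x \<in> cell M k \<longleftrightarrow> (\<forall>b\<in>Basis. real_of_int (k b) \<le> real M * (x \<bullet> b) \<and> real M * (x \<bullet> b) < real_of_int (k b) + 1)" for x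
    using k by (auto simp: cell_def cell_index_def fun_eq_iff restrict_def extensional_def floor_eq_iff)
  have sub: "cell M k \<subseteq> cbox l r"
    unfolding mem cbox_def using M by (auto simp: mem l r field_simps less_imp_le)
  then have "emeasure lborel (cell M k) \<le> emeasure lborel (cbox l r)" by (intro emeasure_mono) auto
  also have "\<dots> < \<infinity>" by (simp add: emeasure_lborel_cbox_eq)
  finally show fin: "emeasure lborel (cell M k) < \<infinity>" .
  have "box l r \<subseteq> cell M k"
    unfolding box_def using M by (auto simp: mem l r field_simps less_imp_le)
  then have "measure lborel (box l r) \<le> measure lborel (cell M k)"
    using fin by (intro measure_mono_fmeasurable) (auto simp: fmeasurable_def)
  moreover have "measure lborel (box l r) = (\<Prod>b\<in>Basis. (r - l) \<bullet> b)"
    using M by (subst measure_lborel_box_eq) (auto simp: l r divide_right_mono)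
  moreover have "(\<Prod>b\<in>Basis. (r - l) \<bullet> b) = (1 / real M) ^ DIM('a)"
    by (simp add: inner_diff_left l r diff_divide_distrib[symmetric])
  ultimately show "measure lborel (cell M k) \<ge> (1 / real M) ^ DIM('a)" by simp
qed

text \<open>The integral of \<open>(d - u)\<^sup>2\<close> over \<open>Q\<close> is a quadratic
  polynomial in the constant \<open>d\<close> with its minimum at the average \<open>a\<close>.
  Nonnegativity at \<open>d = a\<close> is the first inequality; put into the expansion at
  \<open>d = c\<close>, it completes the square and gives the second.\<close>

lemma
  fixes u :: "'a \<Rightarrow> real"
  assumes Q [measurable]: "Q \<in> sets N" and fin: "emeasure N Q < \<infinity>" and pos: "measure N Q > 0"
    and [measurable]: "u \<in> borel_measurable N" and u2: "integrable N (\<lambda>x. (u x)\<^sup>2)"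
  defines "a \<equiv> (LINT y|N. indicator Q y * u y) / measure N Q"
  shows average_square_le: "measure N Q * a\<^sup>2 \<le> (LINT y|N. (u y)\<^sup>2)"
    and average_diff_square_le: "measure N Q * (c - a)\<^sup>2 \<le> (LINT y|N. indicator Q y * (c - u y)\<^sup>2)"
    and integrable_indicator_diff_square: "integrable N (\<lambda>y. indicator Q y * (c - u y)\<^sup>2)"
proof -
  have iQ: "integrable N (indicat_real Q)" using fin by (simp add: integrable_indicator_iff)
  have i2: "integrable N (\<lambda>y. indicat_real Q y * (u y)\<^sup>2)"
    by (rule Bochner_Integration.integrable_bound[OF u2]) (auto simp: indicator_def)
  have i1: "integrable N (\<lambda>y. indicat_real Q y * u y)"
    by (rule integrable_mult_L2[OF _ _ _ u2]) (use iQ in \<open>auto simp: power2_eq_square indicator_inter_arith[symmetric]\<close>)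
  have split: "indicat_real Q y * (d - u y)\<^sup>2 = d\<^sup>2 * indicat_real Q y - 2 * d * (indicat_real Q y * u y) + indicat_real Q y * (u y)\<^sup>2" for d y
    by (simp add: power2_diff algebra_simps)
  show int: "integrable N (\<lambda>y. indicator Q y * (c - u y)\<^sup>2)" for c
    unfolding split using iQ i1 i2 by simp
  have a: "(LINT y|N. indicator Q y * u y) = measure N Q * a"
    using pos by (simp add: a_def)
  have exp: "(LINT y|N. indicator Q y * (d - u y)\<^sup>2) =
     d\<^sup>2 * measure N Q - 2 * d * (measure N Q * a) + (LINT y|N. indicator Q y * (u y)\<^sup>2)" for d
    unfolding split using iQ i1 i2 by (simp add: a)
  have nn: "0 \<le> (LINT y|N. indicator Q y * (a - u y)\<^sup>2)" by (intro integral_nonneg_AE) auto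
  then have *: "measure N Q * a\<^sup>2 \<le> (LINT y|N. indicator Q y * (u y)\<^sup>2)"
    unfolding exp by (simp add: power2_eq_square algebra_simps)
  then show "measure N Q * (c - a)\<^sup>2 \<le> (LINT y|N. indicator Q y * (c - u y)\<^sup>2)" for c
    unfolding exp by (simp add: power2_eq_square algebra_simps)
  have "(LINT y|N. indicator Q y * (u y)\<^sup>2) \<le> (LINT y|N. (u y)\<^sup>2)"
    by (rule integral_mono[OF i2 u2]) (auto simp: indicator_def)
  with * show "measure N Q * a\<^sup>2 \<le> (LINT y|N. (u y)\<^sup>2)" by simp
qed

lemma cell_average_bound:
  fixes u :: "'a::euclidean_space \<Rightarrow> real"
  assumes M: "M \<ge> 1" and [measurable]: "u \<in> borel_measurable borel"
    and u2: "integrable lborel (\<lambda>x. (u x)\<^sup>2)"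
  shows "(cell_average M u k)\<^sup>2 \<le> real M ^ DIM('a) * (LINT x|lborel. (u x)\<^sup>2)"
proof (cases "cell M k = {}")
  case True
  \<comment> \<open>An index that no point realises has an empty cell; its average is 0 divided by
    0, hence 0.\<close>
  then show ?thesis by (simp add: cell_average_def)
next
  case False
  note c = emeasure_cell[OF M False]
  have Mp: "(1 / real M) ^ DIM('a) > 0" using M by simp
  with c have pos: "measure lborel (cell M k) > 0" by linarith
  have "(1 / real M) ^ DIM('a) * (cell_average M u k)\<^sup>2 \<le> measure lborel (cell M k) * (cell_average M u k)\<^sup>2"
    using c by (intro mult_right_mono) auto
  also have "\<dots> \<le> (LINT x|lborel. (u x)\<^sup>2)"
    unfolding cell_average_def by (rule average_square_le) (use c pos u2 in auto)
  finally show ?thesis using M by (simp add: field_simps)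
qed

text \<open>The squared deviation of \<open>u x\<close> from the average is at most the mean of the
  squared differences over the cell of \<open>x\<close>. Enlarging that cell to the cube
  \<open>B\<close> centred at \<open>x\<close> makes the range of increments independent of
  \<open>x\<close>. Then the integrals can be exchanged, and \<open>sobolev_translate_le\<close>
  applies to every increment separately.\<close>

lemma cell_average_L2_error:
  fixes u :: "'a::euclidean_space \<Rightarrow> real"
  assumes M: "M \<ge> 1" and u: "integrable lborel u" "integrable lborel (\<lambda>x. (u x)\<^sup>2)"
    and \<sigma>: "0 \<le> \<sigma>" "\<sigma> \<le> 1" "\<sigma> \<le> s"
    and S: "integrable lborel (\<lambda>\<xi>. (1 + (norm \<xi>)\<^sup>2) powr s * (norm (fourier u \<xi>))\<^sup>2)"
  shows "(\<integral>\<^sup>+ x. ennreal ((u x - cell_average M u (cell_index M x))\<^sup>2) \<partial>lborel) \<le>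
     ennreal (2 ^ DIM('a) * 4 * real DIM('a) powr (2 * \<sigma>) * real M powr (- 2 * \<sigma>) *
       (LINT \<xi>|lborel. (1 + (norm \<xi>)\<^sup>2) powr s * (norm (fourier u \<xi>))\<^sup>2))"
proof -
  define H where "H = (LINT \<xi>|lborel. (1 + (norm \<xi>)\<^sup>2) powr s * (norm (fourier u \<xi>))\<^sup>2)"
  define m where "m = real M ^ DIM('a)"
  have m: "m > 0" using M by (simp add: m_def)
  \<comment> \<open>The side length of \<open>B\<close> is twice that of a cell, whence the factor
    \<open>2 ^ DIM('a)\<close> in the result.\<close>
  define B where "B = {h::'a. \<forall>b\<in>Basis. \<bar>h \<bullet> b\<bar> \<le> 1 / real M}"
  have [measurable]: "u \<in> borel_measurable borel" using u by auto
  have Bcbox: "B = cbox (- (\<Sum>b\<in>Basis. (1 / real M) *\<^sub>R b)) (\<Sum>b\<in>Basis. (1 / real M) *\<^sub>R b)"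
    by (auto simp: B_def cbox_def abs_le_iff inner_minus_left)
  have B: "B \<in> sets borel" unfolding Bcbox by simp
  have emB: "emeasure lborel B = ennreal (2 ^ DIM('a) / m)"
  proof -
    define w where "w = (\<Sum>b\<in>Basis. (1 / real M) *\<^sub>R b :: 'a)"
    have w: "w \<bullet> b = 1 / real M" if "b \<in> Basis" for b using that by (simp add: w_def)
    have "emeasure lborel B = ennreal (\<Prod>b\<in>Basis. (w - (- w)) \<bullet> b)"
      unfolding Bcbox w_def[symmetric] by (subst emeasure_lborel_cbox_eq) (auto simp: w inner_minus_left)
    also have "(\<Prod>b\<in>Basis. (w - (- w)) \<bullet> b) = (\<Prod>b\<in>(Basis::'a set). 2 / real M)"
      by (intro prod.cong) (auto simp: inner_add_left w)
    finally show ?thesis by (simp add: m_def power_divide)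
  qed
  have pt: "ennreal ((u x - cell_average M u (cell_index M x))\<^sup>2) \<le>
      (\<integral>\<^sup>+ h. ennreal m * (indicator B h * ennreal ((u (x + h) - u x)\<^sup>2)) \<partial>lborel)" for x
  proof -
    let ?k = "cell_index M x" let ?Q = "cell M ?k"
    have "?Q \<noteq> {}" by (auto simp: cell_def)
    note c = emeasure_cell[OF M this]
    have Mp: "(1 / real M) ^ DIM('a) > 0" using M by simp
    with c have pos: "measure lborel ?Q > 0" by linarith
    have "(1 / real M) ^ DIM('a) * (u x - cell_average M u ?k)\<^sup>2 \<le> measure lborel ?Q * (u x - cell_average M u ?k)\<^sup>2"
      using c by (intro mult_right_mono) auto
    also have "\<dots> \<le> (LINT y|lborel. indicator ?Q y * (u x - u y)\<^sup>2)"
      unfolding cell_average_def by (rule average_diff_square_le) (use c pos u in auto)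
    finally have "(u x - cell_average M u ?k)\<^sup>2 \<le> m * (LINT y|lborel. indicator ?Q y * (u x - u y)\<^sup>2)"
      using M by (simp add: m_def field_simps)
    then have "ennreal ((u x - cell_average M u ?k)\<^sup>2) \<le> ennreal m * ennreal (LINT y|lborel. indicator ?Q y * (u x - u y)\<^sup>2)"
      using m by (subst ennreal_mult[symmetric]) (auto intro!: ennreal_leI integral_nonneg_AE)
    also have "ennreal (LINT y|lborel. indicator ?Q y * (u x - u y)\<^sup>2) =
       (\<integral>\<^sup>+ y. ennreal (indicator ?Q y * (u x - u y)\<^sup>2) \<partial>lborel)"
      by (rule nn_integral_eq_integral[symmetric])
        (use integrable_indicator_diff_square[OF _ c(1) pos _ u(2), of "u x"] in auto)
    also have "\<dots> \<le> (\<integral>\<^sup>+ y. indicator B (y - x) * ennreal ((u y - u x)\<^sup>2) \<partial>lborel)"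
    proof (rule nn_integral_mono)
      fix y
      show "ennreal (indicator ?Q y * (u x - u y)\<^sup>2) \<le> indicator B (y - x) * ennreal ((u y - u x)\<^sup>2)"
      proof (cases "y \<in> ?Q")
        case True
        then have "cell_index M x = cell_index M y" by (simp add: cell_def)
        then have "y - x \<in> B" using cell_dist[OF M] by (auto simp: B_def)
        with True show ?thesis by (simp add: power2_commute)
      qed simp
    qed
    also have "\<dots> = (\<integral>\<^sup>+ y. indicator B (y - x) * ennreal ((u y - u x)\<^sup>2) \<partial>distr lborel borel ((+) x))"
      by (simp add: lborel_distr_plus)
    also have "\<dots> = (\<integral>\<^sup>+ h. indicator B h * ennreal ((u (x + h) - u x)\<^sup>2) \<partial>lborel)"
      using B by (subst nn_integral_distr) auto
    finally show ?thesis
      using B by (simp add: mult_left_mono nn_integral_cmult)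
  qed
  have "(\<integral>\<^sup>+ x. ennreal ((u x - cell_average M u (cell_index M x))\<^sup>2) \<partial>lborel) \<le>
     (\<integral>\<^sup>+ x. (\<integral>\<^sup>+ h. ennreal m * (indicator B h * ennreal ((u (x + h) - u x)\<^sup>2)) \<partial>lborel) \<partial>lborel)"
    by (rule nn_integral_mono) (rule pt)
  also have "\<dots> = (\<integral>\<^sup>+ h. (\<integral>\<^sup>+ x. ennreal m * (indicator B h * ennreal ((u (x + h) - u x)\<^sup>2)) \<partial>lborel) \<partial>lborel)"
    by (rule lborel_pair.Fubini') (use B in measurable)
  also have "\<dots> \<le> (\<integral>\<^sup>+ h. ennreal (m * 4 * (real DIM('a) / real M) powr (2 * \<sigma>) * H) * indicator B h \<partial>lborel)"
  proof (rule nn_integral_mono)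
    fix h :: 'a
    have H0: "H \<ge> 0" unfolding H_def by (intro integral_nonneg_AE) auto
    show "(\<integral>\<^sup>+ x. ennreal m * (indicator B h * ennreal ((u (x + h) - u x)\<^sup>2)) \<partial>lborel) \<le>
       ennreal (m * 4 * (real DIM('a) / real M) powr (2 * \<sigma>) * H) * indicator B h"
    proof (cases "h \<in> B")
      case True
      \<comment> \<open>The Euclidean norm is estimated by the sum of the coordinates, which is
        where the power of \<open>DIM('a)\<close> comes from.\<close>
      have "norm h \<le> (\<Sum>b\<in>Basis. \<bar>h \<bullet> b\<bar>)" by (rule norm_le_l1)
      also have "\<dots> \<le> (\<Sum>b\<in>(Basis::'a set). 1 / real M)" using True by (intro sum_mono) (auto simp: B_def)
      finally have hb: "norm h \<le> real DIM('a) / real M" by simp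
      have "(LINT x|lborel. (u (x + h) - u x)\<^sup>2) \<le> 4 * norm h powr (2 * \<sigma>) * H"
        unfolding H_def by (rule sobolev_translate_le) fact+
      also have "\<dots> \<le> 4 * (real DIM('a) / real M) powr (2 * \<sigma>) * H"
        using hb \<sigma> H0 by (intro mult_right_mono mult_left_mono powr_mono2) auto
      finally have le: "(LINT x|lborel. (u (x + h) - u x)\<^sup>2) \<le> 4 * (real DIM('a) / real M) powr (2 * \<sigma>) * H" .
      have "(\<integral>\<^sup>+ x. ennreal ((u (x + h) - u x)\<^sup>2) \<partial>lborel) = ennreal (LINT x|lborel. (u (x + h) - u x)\<^sup>2)"
        by (rule nn_integral_eq_integral)
          (use integrable_diff_L2[OF _ _ integrable_lborel_translate[OF u(2)] u(2)] in auto)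
      also have "\<dots> \<le> ennreal (4 * (real DIM('a) / real M) powr (2 * \<sigma>) * H)" using le by (rule ennreal_leI)
      finally have "ennreal m * (\<integral>\<^sup>+ x. ennreal ((u (x + h) - u x)\<^sup>2) \<partial>lborel) \<le>
          ennreal m * ennreal (4 * (real DIM('a) / real M) powr (2 * \<sigma>) * H)" by (rule mult_left_mono) simp
      also have "\<dots> = ennreal (m * 4 * (real DIM('a) / real M) powr (2 * \<sigma>) * H)"
        using m H0 by (subst ennreal_mult[symmetric]) (auto simp: mult.assoc)
      finally show ?thesis using True by (simp add: nn_integral_cmult)
    qed simp
  qed
  also have "\<dots> = ennreal (m * 4 * (real DIM('a) / real M) powr (2 * \<sigma>) * H) * emeasure lborel B"
    using B by (simp add: nn_integral_cmult)
  also have "\<dots> = ennreal (2 ^ DIM('a) * 4 * real DIM('a) powr (2 * \<sigma>) * real M powr (- 2 * \<sigma>) * H)"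
  proof -
    have H0: "H \<ge> 0" unfolding H_def by (intro integral_nonneg_AE) auto
    have "m * 4 * (real DIM('a) / real M) powr (2 * \<sigma>) * H * (2 ^ DIM('a) / m) =
       2 ^ DIM('a) * 4 * real DIM('a) powr (2 * \<sigma>) * real M powr (- 2 * \<sigma>) * H"
      using m by (simp add: powr_divide powr_minus divide_simps)
    then show ?thesis unfolding emB using m H0 by (subst ennreal_mult[symmetric]) auto
  qed
  finally show ?thesis unfolding H_def .
qed

lemma cell_index_bounded:
  fixes x :: "'a::euclidean_space"
  assumes "M \<ge> 1" and "\<And>b. b \<in> Basis \<Longrightarrow> \<bar>x \<bullet> b\<bar> \<le> real R"
  shows "cell_index M x \<in> Basis \<rightarrow>\<^sub>E {- int (R * M) .. int (R * M)}"
proof (intro PiE_I)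
  fix b :: 'a assume b: "b \<in> Basis"
  have "\<bar>real M * (x \<bullet> b)\<bar> \<le> real M * real R"
    using assms(2)[OF b] by (simp add: abs_mult mult_left_mono)
  then have "\<bar>real M * (x \<bullet> b)\<bar> \<le> real_of_int (int (R * M))" by (simp add: mult.commute)
  then show "cell_index M x b \<in> {- int (R * M) .. int (R * M)}"
    using b unfolding cell_index_def by (simp add: abs_le_iff floor_le_iff le_floor_iff)
qed (simp add: cell_index_def)

lemma card_cell_indices:
  assumes "M \<ge> 1"
  shows "real (card (Basis \<rightarrow>\<^sub>E {- int (R * M) .. int (R * M)} :: ('a::euclidean_space \<Rightarrow> int) set)) \<le>
    (2 * real R + 1) ^ DIM('a) * real M ^ DIM('a)"
proof -
  have "real (card (Basis \<rightarrow>\<^sub>E {- int (R * M) .. int (R * M)} :: ('a \<Rightarrow> int) set)) = (2 * real R * real M + 1) ^ DIM('a)"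
    by (simp add: card_PiE algebra_simps nat_add_distrib)
  also have "\<dots> \<le> ((2 * real R + 1) * real M) ^ DIM('a)"
    using assms by (intro power_mono) (auto simp: algebra_simps)
  finally show ?thesis by (simp add: power_mult_distrib)
qed

section \<open>Riemannian volume in charts\<close>

lemma continuous_on_det:
  fixes G :: "'a::topological_space \<Rightarrow> real ^ 'n ^ 'n"
  assumes "\<And>i j. continuous_on S (\<lambda>y. G y $ i $ j)"
  shows "continuous_on S (\<lambda>y. det (G y))"
  unfolding det_def by (intro continuous_intros assms)

text \<open>The segment from the identity to \<open>G\<close> consists of matrices with positive
  quadratic form, hence trivial kernel. So the determinant, which starts at 1, cannot vanish on the
  way.\<close>

lemma det_pos_def:
  fixes G :: "real ^ 'n ^ 'n"
  assumes pos: "\<And>x. x \<noteq> 0 \<Longrightarrow> x \<bullet> (G *v x) > 0"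
  shows "det G > 0"
proof (rule ccontr)
  assume neg: "\<not> det G > 0"
  define P where "P t = t *\<^sub>R G + (1 - t) *\<^sub>R mat 1" for t :: real
  have cont: "continuous_on {0..1} (\<lambda>t. det (P t))"
    unfolding P_def by (intro continuous_on_det) (auto intro!: continuous_intros)
  have P: "P 0 = mat 1" "P 1 = G" by (simp_all add: P_def)
  have "\<exists>t\<ge>0. t \<le> 1 \<and> det (P t) = 0"
    using IVT2'[of "\<lambda>t. det (P t)" 1 0 0] neg cont P by simp
  then obtain t where t: "0 \<le> t" "t \<le> 1" "det (P t) = 0" by blast
  then have "\<not> (\<forall>x. P t *v x = 0 \<longrightarrow> x = 0)"
    by (metis invertible_det_nz invertible_left_inverse matrix_left_invertible_ker)
  then obtain x where x: "x \<noteq> 0" "P t *v x = 0" by blast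
  have "0 = x \<bullet> (P t *v x)" using x by simp
  also have "\<dots> = t * (x \<bullet> (G *v x)) + (1 - t) * (x \<bullet> x)"
    by (simp add: P_def matrix_vector_mult_add_rdistrib scaleR_matrix_vector_assoc[symmetric] inner_add_right)
  also have "\<dots> > 0"
  proof (cases "t = 0")
    case False
    then show ?thesis using pos[OF x(1)] t by (intro add_pos_nonneg) auto
  qed (use x in simp)
  finally show False by simp
qed

lemma inner_bilinear_matrix:
  fixes m :: "real ^ 'n \<Rightarrow> real ^ 'n \<Rightarrow> real"
  assumes "bilinear m"
  shows "x \<bullet> ((\<chi> i j. m (axis i 1) (axis j 1)) *v x) = m x x"
proof -
  have x: "x = (\<Sum>i\<in>UNIV. x $ i *\<^sub>R axis i 1)"
    by (simp add: basis_expansion flip: scalar_mult_eq_scaleR)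
  have "m x x = m (\<Sum>i\<in>UNIV. x $ i *\<^sub>R axis i 1) (\<Sum>i\<in>UNIV. x $ i *\<^sub>R axis i 1)"
    by (subst (1 2) x) (rule refl)
  also have "\<dots> = (\<Sum>(i, j)\<in>UNIV \<times> UNIV. m (x $ i *\<^sub>R axis i 1) (x $ j *\<^sub>R axis j 1))"
    by (rule bilinear_sum[OF assms])
  also have "\<dots> = (\<Sum>i\<in>UNIV. \<Sum>j\<in>UNIV. x $ i * (x $ j * m (axis i 1) (axis j 1)))"
    by (simp add: sum.cartesian_product[symmetric] bilinear_lmul[OF assms] bilinear_rmul[OF assms] mult.left_commute
      del: UNIV_Times_UNIV)
  also have "\<dots> = x \<bullet> ((\<chi> i j. m (axis i 1) (axis j 1)) *v x)"
    by (simp add: inner_vec_def matrix_vector_mult_def sum_distrib_left mult_ac)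
  finally show ?thesis by simp
qed

text \<open>Coordinate maps have arbitrary values outside their chart domain; extension by 0
  replaces them by Borel maps on the whole space.\<close>

lemma chart_borel_measurable:
  fixes f :: "'a::topological_space \<Rightarrow> 'b::{topological_space, zero}"
  assumes "open U" "continuous_on U f"
  shows "(\<lambda>x. if x \<in> U then f x else 0) \<in> borel_measurable borel"
proof -
  have "U \<in> sets borel" using assms by auto
  moreover have "f \<in> borel_measurable (restrict_space borel U)"
    using assms by (intro borel_measurable_continuous_on_restrict)
  ultimately show ?thesis
    by (subst measurable_If_restrict_space_iff) auto
qed

definition volume_density ::
  "('m, real ^ 'n) chart set \<Rightarrow> ('m, real ^ 'n) metric \<Rightarrow> ('m, real ^ 'n) chart \<Rightarrow> real ^ 'n \<Rightarrow> real" where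
  "volume_density A g c y =
     sqrt (det (\<chi> i j. metric_coeff A g c (chart_inv c y) (axis i 1) (axis j 1)))"

context
  fixes A :: "('m::{second_countable_topology,t2_space}, real ^ 'n) chart set"
    and g :: "('m, real ^ 'n) metric" and c :: "('m, real ^ 'n) chart"
  assumes M: "riemannian_manifold A g" and c: "c \<in> A"
begin

lemma chart_facts:
  shows "open (fst c)" "open (snd c ` fst c)" "continuous_on (fst c) (snd c)"
    "continuous_on (snd c ` fst c) (chart_inv c)" "\<And>x. x \<in> fst c \<Longrightarrow> chart_inv c (snd c x) = x"
    "inj_on (snd c) (fst c)" "\<And>y. y \<in> snd c ` fst c \<Longrightarrow> chart_inv c y \<in> fst c"
    "\<And>y. y \<in> snd c ` fst c \<Longrightarrow> snd c (chart_inv c y) = y"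
proof -
  have h: "open (fst c) \<and> open (snd c ` fst c) \<and> homeomorphism (fst c) (snd c ` fst c) (snd c) (chart_inv c)"
    using M c by (auto simp: riemannian_manifold_def smooth_manifold_def)
  then show "open (fst c)" "open (snd c ` fst c)" "continuous_on (fst c) (snd c)"
    "continuous_on (snd c ` fst c) (chart_inv c)" "\<And>x. x \<in> fst c \<Longrightarrow> chart_inv c (snd c x) = x"
    "\<And>y. y \<in> snd c ` fst c \<Longrightarrow> chart_inv c y \<in> fst c"
    "\<And>y. y \<in> snd c ` fst c \<Longrightarrow> snd c (chart_inv c y) = y"
    by (auto simp: homeomorphism_def)
  then show "inj_on (snd c) (fst c)" by (metis inj_onI)
qed

lemma volume_density_continuous: "continuous_on (snd c ` fst c) (volume_density A g c)"
proof -
  have "continuous_on (snd c ` fst c) (\<lambda>y. metric_coeff A g c (chart_inv c y) u v)" for u v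
  proof -
    have "smooth_on (snd c ` fst c) (\<lambda>y. metric_coeff A g c (chart_inv c y) u v)"
      using M c by (auto simp: riemannian_manifold_def)
    then have "Ck_on 0 (snd c ` fst c) (\<lambda>y. metric_coeff A g c (chart_inv c y) u v)"
      unfolding smooth_on_def by blast
    then show ?thesis by simp
  qed
  then show ?thesis unfolding volume_density_def
    by (intro continuous_on_real_sqrt continuous_on_det) simp
qed

lemma volume_density_pos:
  assumes "y \<in> snd c ` fst c"
  shows "volume_density A g c y > 0"
proof -
  have x: "chart_inv c y \<in> fst c" by (rule chart_facts(7)[OF assms])
  then have bl: "bilinear (metric_coeff A g c (chart_inv c y))"
    and pos: "\<And>u. u \<noteq> 0 \<Longrightarrow> metric_coeff A g c (chart_inv c y) u u > 0"
    using M c by (auto simp: riemannian_manifold_def)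
  show ?thesis unfolding volume_density_def
    by (subst real_sqrt_gt_0_iff, rule det_pos_def) (simp add: inner_bilinear_matrix[OF bl] pos)
qed

end

context
  fixes A :: "('m::{second_countable_topology,t2_space}, real ^ 'n) chart set"
    and g :: "('m, real ^ 'n) metric" and vol :: "'m measure" and c :: "('m, real ^ 'n) chart"
  assumes M: "riemannian_manifold A g" and vol: "is_riemannian_volume A g vol" and c: "c \<in> A"
begin

lemma sets_vol: "sets vol = sets borel" "space vol = UNIV"
  using vol sets_eq_imp_space_eq[of vol borel] by (auto simp: is_riemannian_volume_def)

lemma emeasure_vol_chart:
  assumes "E \<in> sets borel" "E \<subseteq> fst c"
  shows "emeasure vol E = (\<integral>\<^sup>+ y\<in>snd c ` E. ennreal (volume_density A g c y) \<partial>lborel)"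
  using vol c assms unfolding is_riemannian_volume_def volume_density_def by blast

text \<open>\<open>is_riemannian_volume\<close> prescribes only the measures of Borel sets inside a
  chart. The passage to integrands goes through an equality of measures: the image of the volume on
  \<open>K\<close> is a weighted Lebesgue measure.\<close>

lemma chart_nn_integral:
  assumes K: "compact K" "K \<subseteq> fst c" and [measurable]: "v \<in> borel_measurable borel"
  shows "(\<integral>\<^sup>+ x. indicator K x * v (snd c x) \<partial>vol) =
     (\<integral>\<^sup>+ y. indicator (snd c ` K) y * ennreal (volume_density A g c y) * v y \<partial>lborel)"
proof -
  note [simp, measurable_cong] = sets_vol
  define \<kappa> where "\<kappa> x = (if x \<in> fst c then snd c x else 0)" for x
  have \<kappa>m [measurable]: "\<kappa> \<in> borel_measurable borel"
    unfolding \<kappa>_def by (rule chart_borel_measurable) (use chart_facts[OF M c] in auto)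
  have [measurable]: "K \<in> sets borel" using K by (simp add: borel_compact)
  have "compact (snd c ` K)"
    by (rule compact_continuous_image[OF continuous_on_subset[OF chart_facts(3)[OF M c] K(2)] K(1)])
  then have [measurable]: "snd c ` K \<in> sets borel" by (rule borel_compact)
  define w where "w y = (if y \<in> snd c ` fst c then volume_density A g c y else 0)" for y
  have [measurable]: "w \<in> borel_measurable borel"
    unfolding w_def by (rule chart_borel_measurable) (use chart_facts[OF M c] volume_density_continuous[OF M c] in auto)
  have w: "indicator (snd c ` K) y * ennreal (volume_density A g c y) = indicator (snd c ` K) y * ennreal (w y)" for y
    using K by (auto simp: w_def indicator_def)
  have eq: "distr (density vol (indicator K)) borel \<kappa> =
     density lborel (\<lambda>y. indicator (snd c ` K) y * ennreal (w y))" (is "?L = ?R")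
  proof (rule measure_eqI)
    fix B assume "B \<in> sets ?L"
    then have [measurable]: "B \<in> sets borel" by simp
    have [measurable]: "\<kappa> -` B \<in> sets borel"
      by (rule measurable_sets_borel[OF \<kappa>m]) measurable
    have E: "K \<inter> \<kappa> -` B \<in> sets borel" by measurable
    have im: "snd c ` (K \<inter> \<kappa> -` B) = snd c ` K \<inter> B"
      using K(2) by (auto simp: \<kappa>_def)
    have "emeasure ?L B = emeasure (density vol (indicator K)) (\<kappa> -` B)"
      by (subst emeasure_distr) auto
    also have "\<dots> = emeasure vol (K \<inter> \<kappa> -` B)"
      by (subst emeasure_density) (auto simp: measurable_sets_borel indicator_inter_arith[symmetric] intro!: nn_integral_indicator)
    also have "\<dots> = (\<integral>\<^sup>+ y\<in>snd c ` K \<inter> B. ennreal (volume_density A g c y) \<partial>lborel)"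
      using emeasure_vol_chart[OF E] K(2) im by auto
    also have "\<dots> = (\<integral>\<^sup>+ y. indicator (snd c ` K) y * ennreal (w y) * indicator B y \<partial>lborel)"
      by (intro nn_integral_cong) (use K in \<open>auto simp: w_def indicator_def\<close>)
    also have "\<dots> = emeasure ?R B"
      by (subst emeasure_density) auto
    finally show "emeasure ?L B = emeasure ?R B" .
  qed simp
  have "(\<integral>\<^sup>+ x. indicator K x * v (snd c x) \<partial>vol) = (\<integral>\<^sup>+ x. indicator K x * v (\<kappa> x) \<partial>vol)"
    using K(2) by (intro nn_integral_cong) (auto simp: \<kappa>_def indicator_def)
  also have "\<dots> = (\<integral>\<^sup>+ x. v (\<kappa> x) \<partial>density vol (indicator K))"
    by (subst nn_integral_density) auto
  also have "\<dots> = (\<integral>\<^sup>+ y. v y \<partial>?L)"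
    by (subst nn_integral_distr) auto
  also have "\<dots> = (\<integral>\<^sup>+ y. indicator (snd c ` K) y * ennreal (w y) * v y \<partial>lborel)"
    unfolding eq by (subst nn_integral_density) auto
  finally show ?thesis by (simp add: w)
qed

text \<open>Absence of atoms is what makes the diagonal a null set of the product measure.\<close>

lemma emeasure_vol_singleton:
  assumes "x \<in> fst c"
  shows "emeasure vol {x} = 0"
proof -
  have "emeasure vol {x} = (\<integral>\<^sup>+ y\<in>{snd c x}. ennreal (volume_density A g c y) \<partial>lborel)"
    using emeasure_vol_chart[of "{x}"] assms by auto
  also have "\<dots> = integral\<^sup>N lborel (\<lambda>_::real ^ 'n. 0)"
  proof (rule nn_integral_cong_AE)
    have "AE y in lborel. y \<noteq> snd c x" by (rule AE_lborel_singleton)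
    then show "AE y in lborel. ennreal (volume_density A g c y) * indicator {snd c x} y = 0"
      by eventually_elim simp
  qed
  finally show ?thesis by simp
qed

text \<open>The volume density is continuous and positive, so on a compact part of the chart it lies
  between positive constants, and normalised volume and Lebesgue measure are comparable in both
  directions.\<close>

lemma chart_compare:
  assumes \<pi>: "\<pi> = uniform_measure vol UNIV" "prob_space \<pi>" and K: "compact K" "K \<subseteq> fst c"
  obtains C :: real where "C > 0"
    "\<And>v. v \<in> borel_measurable borel \<Longrightarrow>
       (\<integral>\<^sup>+ x. indicator K x * v (snd c x) \<partial>\<pi>) \<le> ennreal C * (\<integral>\<^sup>+ y. v y \<partial>lborel)"
    "\<And>v. v \<in> borel_measurable borel \<Longrightarrow>
       (\<integral>\<^sup>+ y. indicator (snd c ` K) y * v y \<partial>lborel) \<le> ennreal C * (\<integral>\<^sup>+ x. indicator K x * v (snd c x) \<partial>\<pi>)"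
proof -
  note [simp, measurable_cong] = sets_vol
  have one: "emeasure \<pi> UNIV = 1"
    using prob_space.emeasure_space_1[OF \<pi>(2)] by (simp add: \<pi>(1))
  \<comment> \<open>For total volume 0 or \<infinity> this quotient would be 0; so a probability
    measure \<pi> forces the volume to be positive and finite.\<close>
  have "emeasure \<pi> UNIV = emeasure vol UNIV / emeasure vol UNIV"
    unfolding \<pi>(1) by (subst emeasure_uniform_measure) auto
  with one have V: "emeasure vol UNIV \<noteq> 0" "emeasure vol UNIV \<noteq> \<infinity>"
    by (auto simp: divide_ennreal_def ennreal_inverse_top ennreal_mult_eq_top_iff split: if_splits)
  define V where "V = enn2real (emeasure vol UNIV)"
  have V': "emeasure vol UNIV = ennreal V" "V > 0"
    using V unfolding V_def by (auto simp: ennreal_enn2real_if enn2real_positive_iff less_top zero_less_iff_neq_zero)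
  have comp: "compact (snd c ` K)"
    by (rule compact_continuous_image[OF continuous_on_subset[OF chart_facts(3)[OF M c] K(2)] K(1)])
  have cont: "continuous_on (snd c ` K) (volume_density A g c)"
    using volume_density_continuous[OF M c] by (rule continuous_on_subset) (use K in auto)
  have [measurable]: "K \<in> sets borel" using K by (simp add: borel_compact)
  have [measurable]: "snd c ` K \<in> sets borel" using comp by (rule borel_compact)
  obtain a b where ab: "0 < a" "a \<le> b" "\<And>y. y \<in> snd c ` K \<Longrightarrow> a \<le> volume_density A g c y \<and> volume_density A g c y \<le> b"
  proof (cases "K = {}")
    case True
    then show ?thesis using that[of 1 1] by auto
  next
    case False
    then have ne: "snd c ` K \<noteq> {}" by simp
    obtain y1 y2 where y: "y1 \<in> snd c ` K" "\<And>y. y \<in> snd c ` K \<Longrightarrow> volume_density A g c y1 \<le> volume_density A g c y"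
      "y2 \<in> snd c ` K" "\<And>y. y \<in> snd c ` K \<Longrightarrow> volume_density A g c y \<le> volume_density A g c y2"
      using continuous_attains_inf[OF comp ne cont] continuous_attains_sup[OF comp ne cont] by blast
    have "0 < volume_density A g c y1" using y(1) K(2) by (intro volume_density_pos[OF M c]) auto
    with y show ?thesis using that[of "volume_density A g c y1" "volume_density A g c y2"] by auto
  qed
  \<comment> \<open>\<open>b / V\<close> bounds the density of \<pi> in the chart from above,
    \<open>V / a\<close> bounds its reciprocal.\<close>
  define C where "C = max (b / V) (V / a)"
  have "C > 0" using ab V' by (auto simp: C_def less_max_iff_disj)
  have \<pi>int: "(\<integral>\<^sup>+ x. indicator K x * v (snd c x) \<partial>\<pi>) =
     (\<integral>\<^sup>+ y. indicator (snd c ` K) y * ennreal (volume_density A g c y) * v y \<partial>lborel) / ennreal V"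
    if [measurable]: "v \<in> borel_measurable borel" for v
  proof -
    have m: "(\<lambda>x. indicator K x * v (snd c x)) \<in> borel_measurable borel"
    proof -
      have [measurable]: "(\<lambda>x. if x \<in> fst c then snd c x else 0) \<in> borel_measurable borel"
        by (rule chart_borel_measurable) (use chart_facts[OF M c] in auto)
      have "(\<lambda>x. indicator K x * v (snd c x)) = (\<lambda>x. indicator K x * v (if x \<in> fst c then snd c x else 0))"
        using K(2) by (auto simp: fun_eq_iff indicator_def)
      also have "\<dots> \<in> borel_measurable borel" by measurable
      finally show ?thesis .
    qed
    show ?thesis unfolding \<pi>(1)
      using m by (subst nn_integral_uniform_measure) (auto simp: V'(1) chart_nn_integral[OF K that])
  qed
  show thesis
  proof (rule that[OF \<open>C > 0\<close>])
    fix v :: "real ^ 'n \<Rightarrow> ennreal" assume v [measurable]: "v \<in> borel_measurable borel"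
    have "(\<integral>\<^sup>+ x. indicator K x * v (snd c x) \<partial>\<pi>) \<le> (\<integral>\<^sup>+ y. ennreal b * v y \<partial>lborel) / ennreal V"
      unfolding \<pi>int[OF v]
      by (intro divide_right_mono_ennreal nn_integral_mono) (use ab in \<open>auto simp: indicator_def intro!: mult_right_mono ennreal_leI\<close>)
    also have "\<dots> = ennreal (b / V) * (\<integral>\<^sup>+ y. v y \<partial>lborel)"
      using V' ab by (simp add: nn_integral_cmult divide_ennreal_def divide_inverse ennreal_mult' inverse_ennreal mult_ac)
    also have "\<dots> \<le> ennreal C * (\<integral>\<^sup>+ y. v y \<partial>lborel)"
      by (intro mult_right_mono ennreal_leI) (auto simp: C_def)
    finally show "(\<integral>\<^sup>+ x. indicator K x * v (snd c x) \<partial>\<pi>) \<le> ennreal C * (\<integral>\<^sup>+ y. v y \<partial>lborel)" .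
    have "ennreal (a / V) * (\<integral>\<^sup>+ y. indicator (snd c ` K) y * v y \<partial>lborel) =
       (\<integral>\<^sup>+ y. ennreal a * (indicator (snd c ` K) y * v y) \<partial>lborel) / ennreal V"
      using V' ab by (simp add: nn_integral_cmult divide_ennreal_def divide_inverse ennreal_mult' inverse_ennreal mult_ac)
    also have "\<dots> \<le> (\<integral>\<^sup>+ x. indicator K x * v (snd c x) \<partial>\<pi>)"
      unfolding \<pi>int[OF v]
      by (intro divide_right_mono_ennreal nn_integral_mono) (use ab in \<open>auto simp: indicator_def intro!: mult_right_mono ennreal_leI\<close>)
    finally have le: "ennreal (a / V) * (\<integral>\<^sup>+ y. indicator (snd c ` K) y * v y \<partial>lborel) \<le> \<dots>" .
    have "(\<integral>\<^sup>+ y. indicator (snd c ` K) y * v y \<partial>lborel) =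
        ennreal (V / a) * (ennreal (a / V) * (\<integral>\<^sup>+ y. indicator (snd c ` K) y * v y \<partial>lborel))"
      using V' ab by (simp add: mult.assoc[symmetric] ennreal_mult'[symmetric])
    also have "\<dots> \<le> ennreal (V / a) * (\<integral>\<^sup>+ x. indicator K x * v (snd c x) \<partial>\<pi>)"
      by (intro mult_left_mono le) simp
    also have "\<dots> \<le> ennreal C * (\<integral>\<^sup>+ x. indicator K x * v (snd c x) \<partial>\<pi>)"
      by (intro mult_right_mono ennreal_leI) (auto simp: C_def)
    finally show "(\<integral>\<^sup>+ y. indicator (snd c ` K) y * v y \<partial>lborel) \<le> ennreal C * (\<integral>\<^sup>+ x. indicator K x * v (snd c x) \<partial>\<pi>)" .
  qed
qed

end

section \<open>Approximation of Sobolev functions by step functions\<close>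

lemma integral_le_of_nn_integral_le:
  fixes f :: "'a \<Rightarrow> real"
  assumes "f \<in> borel_measurable N" "\<And>x. 0 \<le> f x" "0 \<le> r" "(\<integral>\<^sup>+ x. ennreal (f x) \<partial>N) \<le> ennreal r"
  shows "integrable N f" "(LINT x|N. f x) \<le> r"
proof -
  show i: "integrable N f"
  proof (rule integrableI_bounded)
    show "(\<integral>\<^sup>+ x. ennreal (norm (f x)) \<partial>N) < \<infinity>"
      using assms(2,4) by (simp add: abs_of_nonneg) (metis ennreal_less_top order_le_less_trans)
  qed fact
  have "ennreal (LINT x|N. f x) \<le> ennreal r"
    using assms(2,4) by (subst nn_integral_eq_integral[OF i, symmetric]) auto
  then show "(LINT x|N. f x) \<le> r" using assms(3) by (simp add: ennreal_le_iff)
qed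

lemma square_sum_le_card:
  fixes x :: "'i \<Rightarrow> real"
  shows "(\<Sum>i\<in>I. x i)\<^sup>2 \<le> real (card I) * (\<Sum>i\<in>I. (x i)\<^sup>2)"
  using sum_squared_le_sum_of_squares[of x I] by (simp add: mult.commute)

text \<open>All values of \<open>cell_index\<close> are extensional on \<open>Basis\<close>; hence
  the indices of the cells that meet a bounded set lie in a finite set of this form.\<close>

definition cell_indices :: "nat \<Rightarrow> nat \<Rightarrow> ('a::euclidean_space \<Rightarrow> int) set" where
  "cell_indices R M = Basis \<rightarrow>\<^sub>E {- int (R * M) .. int (R * M)}"

lemma finite_cell_indices: "finite (cell_indices R M)"
  unfolding cell_indices_def by (intro finite_PiE) auto

text \<open>The intersection with the support of the partition function keeps the set inside the
  chart domain, where the coordinate map is meaningful.\<close>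

definition chart_cell ::
  "('m::topological_space, 'b::euclidean_space) chart \<times> ('m \<Rightarrow> real) \<Rightarrow> nat \<Rightarrow> ('b \<Rightarrow> int) \<Rightarrow> 'm set" where
  "chart_cell p M k = {x \<in> closure {x. snd p x \<noteq> 0}. snd (fst p) x \<in> cell M k}"

definition chart_energy :: "('m, 'b::euclidean_space) chart \<times> ('m \<Rightarrow> real) \<Rightarrow> real \<Rightarrow> ('m \<Rightarrow> real) \<Rightarrow> real" where
  "chart_energy p s \<phi> =
     (LINT \<xi>|lborel. (1 + (norm \<xi>)\<^sup>2) powr s * (norm (fourier (local_part (fst p) (snd p) \<phi>) \<xi>))\<^sup>2)"

lemma chart_energy_nonneg: "chart_energy p s \<phi> \<ge> 0"
  unfolding chart_energy_def by (intro integral_nonneg_AE) auto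

lemma sobolev_norm_square: "(sobolev_norm PU s \<phi>)\<^sup>2 = (\<Sum>p\<in>PU. chart_energy p s \<phi>)"
proof -
  have "(\<Sum>(c, \<rho>)\<in>PU. (LINT \<xi>|lborel. (1 + (norm \<xi>)\<^sup>2) powr s * (norm (fourier (local_part c \<rho> \<phi>) \<xi>))\<^sup>2)) =
     (\<Sum>p\<in>PU. chart_energy p s \<phi>)"
    by (simp add: chart_energy_def case_prod_unfold)
  then show ?thesis unfolding sobolev_norm_def by (simp add: sum_nonneg chart_energy_nonneg)
qed

lemma chart_partition_facts:
  assumes "chart_partition A PU" "p \<in> PU"
  shows "fst p \<in> A" "continuous_on UNIV (snd p)" "\<And>x. 0 \<le> snd p x" "\<And>x. snd p x \<le> 1"
    "closure {x. snd p x \<noteq> 0} \<subseteq> fst (fst p)"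
proof -
  have p: "\<forall>(c, \<rho>)\<in>PU. c \<in> A \<and> smooth_function A \<rho> \<and> (\<forall>x. 0 \<le> \<rho> x) \<and> closure {x. \<rho> x \<noteq> 0} \<subseteq> fst c"
    and fin: "finite PU" and one: "\<And>x. (\<Sum>(c, \<rho>)\<in>PU. \<rho> x) = 1"
    using assms by (auto simp: chart_partition_def)
  then show "fst p \<in> A" "\<And>x. 0 \<le> snd p x" "closure {x. snd p x \<noteq> 0} \<subseteq> fst (fst p)"
    using assms(2) by (auto simp only: case_prod_unfold)
  have "Ck_map 0 A {(UNIV, id)} (snd p)" using p assms(2) by (auto simp: smooth_function_def)
  then show "continuous_on UNIV (snd p)" by (simp add: Ck_map_def)
  fix x
  have "snd p x \<le> (\<Sum>p\<in>PU. snd p x)"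
    by (rule member_le_sum) (use p fin assms(2) in auto)
  also have "\<dots> = 1" using one[of x] by (simp add: case_prod_unfold)
  finally show "snd p x \<le> 1" .
qed

lemma chart_cell_measurable:
  fixes A :: "('m::{second_countable_topology,t2_space}, real ^ 'n) chart set"
  assumes M: "riemannian_manifold A g" and PU: "chart_partition A PU" "p \<in> PU"
  shows "chart_cell p M k \<in> sets borel"
proof -
  note pf = chart_partition_facts[OF PU]
  note cf = chart_facts[OF M pf(1)]
  have [measurable]: "(\<lambda>x. if x \<in> fst (fst p) then snd (fst p) x else 0) \<in> borel_measurable borel"
    by (rule chart_borel_measurable) (use cf in auto)
  have "chart_cell p M k = closure {x. snd p x \<noteq> 0} \<inter>
     {x \<in> space borel. (if x \<in> fst (fst p) then snd (fst p) x else 0) \<in> cell M k}"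
    using pf(5) by (auto simp: chart_cell_def)
  also have "\<dots> \<in> sets borel" by measurable
  finally show ?thesis .
qed

text \<open>The product of observable and partition function is read in the chart, averaged over
  grid cells there, and pulled back; \<open>chart_compare\<close> transfers the L2 norms both ways.
  The constants depend on the chart alone, neither on the grid nor on the observable.\<close>

lemma chart_approximation:
  fixes A :: "('m::{second_countable_topology,t2_space}, real ^ 'n) chart set"
  assumes M: "riemannian_manifold A g" "compact (UNIV :: 'm set)"
    and vol: "is_riemannian_volume A g vol" "\<pi> = uniform_measure vol UNIV" "prob_space \<pi>"
    and PU: "chart_partition A PU" "p \<in> PU" and \<sigma>: "0 \<le> \<sigma>" "\<sigma> \<le> 1" "\<sigma> \<le> s"
  shows "\<exists>C R. 0 \<le> C \<and> (\<forall>m\<ge>1. \<forall>\<phi>\<in>sobolev_space PU \<pi> s. \<exists>a.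
     (\<forall>k. (a k)\<^sup>2 \<le> real m ^ CARD('n) * chart_energy p s \<phi>) \<and>
     integrable \<pi> (\<lambda>x. (snd p x * \<phi> x - (\<Sum>k\<in>cell_indices R m. a k * indicator (chart_cell p m k) x))\<^sup>2) \<and>
     (LINT x|\<pi>. (snd p x * \<phi> x - (\<Sum>k\<in>cell_indices R m. a k * indicator (chart_cell p m k) x))\<^sup>2)
       \<le> C * real m powr (- 2 * \<sigma>) * chart_energy p s \<phi>)"
proof -
  obtain c \<rho> where p: "p = (c, \<rho>)" by (cases p)
  note pf = chart_partition_facts[OF PU, unfolded p, simplified]
  note cf = chart_facts[OF M(1) pf(1)]
  define K where "K = closure {x. \<rho> x \<noteq> 0}"
  have K: "compact K" "K \<subseteq> fst c"
    using pf(5) compact_Int_closed[OF M(2), of K] by (auto simp: K_def)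
  have \<rho>0: "\<rho> x = 0" if "x \<notin> K" for x
    using that closure_subset[of "{x. \<rho> x \<noteq> 0}"] by (auto simp: K_def)
  have sets\<pi>: "sets \<pi> = sets borel" using sets_vol[OF M(1) vol(1) pf(1)] by (simp add: vol(2))
  note [measurable_cong] = sets\<pi>
  have [measurable]: "K \<in> sets borel" using K by (simp add: borel_compact)
  have comp: "compact (snd c ` K)"
    by (rule compact_continuous_image[OF continuous_on_subset[OF cf(3) K(2)] K(1)])
  then have [measurable]: "snd c ` K \<in> sets borel" by (rule borel_compact)
  obtain C where C: "C > 0"
    "\<And>v. v \<in> borel_measurable borel \<Longrightarrow>
       (\<integral>\<^sup>+ x. indicator K x * v (snd c x) \<partial>\<pi>) \<le> ennreal C * (\<integral>\<^sup>+ y. v y \<partial>lborel)"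
    "\<And>v. v \<in> borel_measurable borel \<Longrightarrow>
       (\<integral>\<^sup>+ y. indicator (snd c ` K) y * v y \<partial>lborel) \<le> ennreal C * (\<integral>\<^sup>+ x. indicator K x * v (snd c x) \<partial>\<pi>)"
    by (rule chart_compare[OF M(1) vol(1) pf(1) vol(2,3) K]) (rule that)
  obtain r where r: "\<And>y. y \<in> snd c ` K \<Longrightarrow> norm y \<le> r"
    using compact_imp_bounded[OF comp] by (auto simp: bounded_iff)
  \<comment> \<open>The coordinate image of the support is compact, so only cells with index entries
    up to \<open>R * m\<close> in modulus can meet it.\<close>
  define R where "R = nat \<lceil>r\<rceil>"
  have R: "\<bar>y \<bullet> b\<bar> \<le> real R" if "y \<in> snd c ` K" "b \<in> Basis" for y b
  proof -
    have "\<bar>y \<bullet> b\<bar> \<le> norm y" using that by (intro Basis_le_norm)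
    also have "\<dots> \<le> real R" using r[OF that(1)] unfolding R_def by linarith
    finally show ?thesis .
  qed
  define C' where "C' = C * (2 ^ CARD('n) * 4 * real CARD('n) powr (2 * \<sigma>))"
  have "\<exists>a. (\<forall>k. (a k)\<^sup>2 \<le> real m ^ CARD('n) * chart_energy p s \<phi>) \<and>
     integrable \<pi> (\<lambda>x. (snd p x * \<phi> x - (\<Sum>k\<in>cell_indices R m. a k * indicator (chart_cell p m k) x))\<^sup>2) \<and>
     (LINT x|\<pi>. (snd p x * \<phi> x - (\<Sum>k\<in>cell_indices R m. a k * indicator (chart_cell p m k) x))\<^sup>2)
       \<le> C' * real m powr (- 2 * \<sigma>) * chart_energy p s \<phi>"
    if m: "m \<ge> 1" and \<phi>: "\<phi> \<in> sobolev_space PU \<pi> s" for m \<phi>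
  proof -
    have \<phi>m [measurable]: "\<phi> \<in> borel_measurable borel" and \<phi>2: "integrable \<pi> (\<lambda>x. (\<phi> x)\<^sup>2)"
      and S: "integrable lborel (\<lambda>\<xi>. (1 + (norm \<xi>)\<^sup>2) powr s * (norm (fourier (local_part c \<rho> \<phi>) \<xi>))\<^sup>2)"
      using \<phi> PU(2) by (auto simp: sobolev_space_def p)
    define u where "u = local_part c \<rho> \<phi>"
    have [measurable]: "\<rho> \<in> borel_measurable borel" using pf(2) by (rule borel_measurable_continuous_onI)
    have um [measurable]: "u \<in> borel_measurable borel"
    proof -
      have [measurable]: "snd c ` fst c \<in> sets borel" using cf(2) by auto
      have [measurable]: "chart_inv c \<in> restrict_space borel (snd c ` fst c) \<rightarrow>\<^sub>M borel"
        by (rule borel_measurable_continuous_on_restrict) (rule cf(4))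
      show ?thesis unfolding u_def local_part_def[abs_def]
        by (subst measurable_If_restrict_space_iff) auto
    qed
    have u\<kappa>: "u (snd c x) = \<rho> x * \<phi> x" if "x \<in> fst c" for x
      using that cf(5) by (simp add: u_def local_part_def)
    have u0: "u y = 0" if "y \<notin> snd c ` K" for y
    proof (cases "y \<in> snd c ` fst c")
      case True
      then have "chart_inv c y \<notin> K" using that cf(8)[OF True] by (metis imageI)
      then show ?thesis by (simp add: u_def local_part_def \<rho>0)
    qed (simp add: u_def local_part_def)
    have "(\<integral>\<^sup>+ y. ennreal ((u y)\<^sup>2) \<partial>lborel) = (\<integral>\<^sup>+ y. indicator (snd c ` K) y * ennreal ((u y)\<^sup>2) \<partial>lborel)"
      by (intro nn_integral_cong) (use u0 in \<open>auto simp: indicator_def\<close>)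
    also have "\<dots> \<le> ennreal C * (\<integral>\<^sup>+ x. indicator K x * ennreal ((u (snd c x))\<^sup>2) \<partial>\<pi>)"
      by (rule C(3)) measurable
    also have "\<dots> \<le> ennreal C * (\<integral>\<^sup>+ x. ennreal ((\<phi> x)\<^sup>2) \<partial>\<pi>)"
    proof (intro mult_left_mono nn_integral_mono)
      fix x
      have "(\<rho> x)\<^sup>2 \<le> 1" using pf(3,4)[of x] by (simp add: power_le_one)
      then have "(\<rho> x * \<phi> x)\<^sup>2 \<le> (\<phi> x)\<^sup>2"
        unfolding power_mult_distrib by (rule mult_left_le_one_le[rotated 2]) auto
      then show "indicator K x * ennreal ((u (snd c x))\<^sup>2) \<le> ennreal ((\<phi> x)\<^sup>2)"
        using u\<kappa>[of x] K(2) by (auto simp: indicator_def intro: ennreal_leI)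
    qed simp
    also have "\<dots> < \<infinity>"
      using \<phi>2 by (simp add: nn_integral_eq_integral ennreal_mult_less_top)
    finally have u2: "integrable lborel (\<lambda>y. (u y)\<^sup>2)"
      by (intro integrableI_bounded) auto
    \<comment> \<open>The Fourier lemmas ask for L1 as well as L2. Here L1 follows from L2 because
      \<open>u\<close> vanishes off a set of finite measure.\<close>
    have u1: "integrable lborel u"
    proof (rule Bochner_Integration.integrable_bound)
      have "emeasure lborel (snd c ` K) < \<infinity>"
        using comp by (intro emeasure_bounded_finite compact_imp_bounded)
      then show "integrable lborel (\<lambda>y. indicat_real (snd c ` K) y + (u y)\<^sup>2)"
        using u2 by (simp add: integrable_indicator_iff)
      show "AE y in lborel. norm (u y) \<le> norm (indicat_real (snd c ` K) y + (u y)\<^sup>2)"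
      proof (intro AE_I2)
        fix y
        have "\<bar>t\<bar> \<le> 1 + t\<^sup>2" for t :: real
          using zero_le_power2[of "\<bar>t\<bar> - 1"] by (simp add: power2_diff)
        then show "norm (u y) \<le> norm (indicat_real (snd c ` K) y + (u y)\<^sup>2)"
          using u0[of y] by (cases "y \<in> snd c ` K") auto
      qed
    qed (use um in simp)
    note S = S[folded u_def]
    have T: "chart_energy p s \<phi> = (LINT \<xi>|lborel. (1 + (norm \<xi>)\<^sup>2) powr s * (norm (fourier u \<xi>))\<^sup>2)"
      by (simp add: chart_energy_def p u_def)
    define a where "a = cell_average m u"
    have abd: "(a k)\<^sup>2 \<le> real m ^ CARD('n) * chart_energy p s \<phi>" for k
    proof -
      have "(a k)\<^sup>2 \<le> real m ^ DIM(real ^ 'n) * (LINT x|lborel. (u x)\<^sup>2)"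
        unfolding a_def by (rule cell_average_bound[OF m um u2])
      also have "\<dots> \<le> real m ^ DIM(real ^ 'n) * chart_energy p s \<phi>"
        unfolding T using \<sigma> by (intro mult_left_mono sobolev_L2_le[OF u1 u2 _ S]) auto
      finally show ?thesis by simp
    qed
    define q where "q y = (u y - (\<Sum>k\<in>cell_indices R m. a k * indicator (cell m k) y))\<^sup>2" for y
    have [measurable]: "q \<in> borel_measurable borel" unfolding q_def by measurable
    define G where "G x = (\<rho> x * \<phi> x - (\<Sum>k\<in>cell_indices R m. a k * indicator (chart_cell p m k) x))\<^sup>2" for x
    have [measurable]: "chart_cell p m k \<in> sets borel" for k
      by (rule chart_cell_measurable[OF M(1) PU])
    have Gm: "G \<in> borel_measurable borel" unfolding G_def by measurable
    \<comment> \<open>Off \<open>K\<close> both the observable piece and all pulled back cells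
      vanish. The indicator of the image keeps \<open>q\<close> from being compared with the cell
      average at points outside it, where the finite sum may miss the cell.\<close>
    have Gq: "ennreal (G x) = indicator K x * ennreal (indicator (snd c ` K) (snd c x) * q (snd c x))" for x
    proof (cases "x \<in> K")
      case True
      then have "indicator (chart_cell p m k) x = (indicator (cell m k) (snd c x) :: real)" for k
        by (simp add: chart_cell_def p K_def indicator_def)
      with True K(2) show ?thesis by (auto simp: G_def q_def u\<kappa>)
    next
      case False
      then have "indicator (chart_cell p m k) x = (0 :: real)" for k
        by (simp add: chart_cell_def p K_def indicator_def)
      with False show ?thesis by (simp add: G_def \<rho>0)
    qed
    \<comment> \<open>The cells partition the space, so on the image of \<open>K\<close> exactly one
      term of the sum survives.\<close>
    have qle: "indicator (snd c ` K) y * q y \<le> (u y - cell_average m u (cell_index m y))\<^sup>2" for y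
    proof (cases "y \<in> snd c ` K")
      case True
      have idx: "cell_index m y \<in> cell_indices R m"
        unfolding cell_indices_def by (rule cell_index_bounded[OF m R[OF True]])
      have "(\<Sum>k\<in>cell_indices R m. a k * indicator (cell m k) y) = (\<Sum>k\<in>{cell_index m y}. a k * indicator (cell m k) y)"
        by (rule sum.mono_neutral_right) (use idx in \<open>auto simp: finite_cell_indices cell_def indicator_def\<close>)
      also have "\<dots> = a (cell_index m y)" by (simp add: cell_def)
      finally show ?thesis using True by (simp add: q_def a_def)
    qed simp
    have "(\<integral>\<^sup>+ x. ennreal (G x) \<partial>\<pi>) \<le> ennreal C * (\<integral>\<^sup>+ y. ennreal (indicator (snd c ` K) y * q y) \<partial>lborel)"
      unfolding Gq by (rule C(2)) measurable
    also have "\<dots> \<le> ennreal C * (\<integral>\<^sup>+ y. ennreal ((u y - cell_average m u (cell_index m y))\<^sup>2) \<partial>lborel)"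
      by (intro mult_left_mono nn_integral_mono ennreal_leI qle) simp
    also have "\<dots> \<le> ennreal C * ennreal (2 ^ DIM(real ^ 'n) * 4 * real DIM(real ^ 'n) powr (2 * \<sigma>) * real m powr (- 2 * \<sigma>) *
       chart_energy p s \<phi>)"
      unfolding T by (intro mult_left_mono cell_average_L2_error[OF m u1 u2 \<sigma> S]) simp
    also have "\<dots> = ennreal (C' * real m powr (- 2 * \<sigma>) * chart_energy p s \<phi>)"
      using C(1) chart_energy_nonneg[of p s \<phi>]
      by (subst ennreal_mult[symmetric]) (auto simp: C'_def mult_ac)
    finally have "(\<integral>\<^sup>+ x. ennreal (G x) \<partial>\<pi>) \<le> ennreal (C' * real m powr (- 2 * \<sigma>) * chart_energy p s \<phi>)" .
    note le = this
    have G0: "0 \<le> G x" for x by (simp add: G_def)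
    have r0: "0 \<le> C' * real m powr (- 2 * \<sigma>) * chart_energy p s \<phi>"
      using C(1) chart_energy_nonneg[of p s \<phi>] by (simp add: C'_def)
    have "G \<in> borel_measurable \<pi>"
      using Gm measurable_cong_sets[OF sets\<pi> refl] by blast
    note Gi = integral_le_of_nn_integral_le[OF this G0 r0 le]
    show ?thesis
      using abd Gi unfolding G_def p fst_conv snd_conv by (intro exI[of _ a] conjI allI)
  qed
  note main = this
  show ?thesis
  proof (intro exI[of _ C'] exI[of _ R] conjI allI impI ballI)
    show "0 \<le> C'" using C by (simp add: C'_def)
  qed (rule main)
qed

lemma chart_cell_card_bound:
  assumes "m \<ge> 1"
  shows "real (card (cell_indices R m :: (real ^ 'n \<Rightarrow> int) set)) \<le> (2 * real R + 1) ^ CARD('n) * real m ^ CARD('n)"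
  using card_cell_indices[OF assms, where 'a="real ^ 'n", of R] by (simp add: cell_indices_def)

text \<open>The growth of the number of sets is prescribed, and the rate of the L2 error is whatever
  the grid width then allows. The sets \<open>E n i\<close> are common to all observables; only the
  coefficients vary with \<phi>.\<close>

lemma sobolev_approximation:
  fixes A :: "('m::{second_countable_topology,t2_space}, real ^ 'n) chart set" and b :: real
  assumes M: "riemannian_manifold A g" "compact (UNIV :: 'm set)"
    and vol: "is_riemannian_volume A g vol" "\<pi> = uniform_measure vol UNIV" "prob_space \<pi>"
    and PU: "chart_partition A PU" and s: "s > 0" and b: "b > 1"
  obtains C \<theta> :: real and I :: "nat \<Rightarrow> ((('m, real ^ 'n) chart \<times> ('m \<Rightarrow> real)) \<times> (real ^ 'n \<Rightarrow> int)) set"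
    and E :: "nat \<Rightarrow> (('m, real ^ 'n) chart \<times> ('m \<Rightarrow> real)) \<times> (real ^ 'n \<Rightarrow> int) \<Rightarrow> 'm set"
  where "C \<ge> 1" "0 < \<theta>" "\<theta> < 1" "\<And>n. finite (I n)" "\<And>n. real (card (I n)) \<le> C * b ^ n"
    "\<And>n i. i \<in> I n \<Longrightarrow> E n i \<in> sets borel"
    "\<And>\<phi> n. \<phi> \<in> sobolev_space PU \<pi> s \<Longrightarrow> \<exists>a. (\<forall>i\<in>I n. \<bar>a i\<bar> \<le> C * b ^ n * sobolev_norm PU s \<phi>) \<and>
       integrable \<pi> (\<lambda>x. (\<phi> x - (\<Sum>i\<in>I n. a i * indicator (E n i) x))\<^sup>2) \<and>
       (LINT x|\<pi>. (\<phi> x - (\<Sum>i\<in>I n. a i * indicator (E n i) x))\<^sup>2) \<le> C * \<theta> ^ n * (sobolev_norm PU s \<phi>)\<^sup>2"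
proof -
  \<comment> \<open>Averages over cells cannot exploit smoothness beyond order 1 in
    \<open>sobolev_translate_le\<close>.\<close>
  define \<sigma> where "\<sigma> = min s 1"
  have \<sigma>: "0 < \<sigma>" "0 \<le> \<sigma>" "\<sigma> \<le> 1" "\<sigma> \<le> s" using s by (auto simp: \<sigma>_def)
  have fin: "finite PU" and one: "\<And>x. (\<Sum>p\<in>PU. snd p x) = 1"
    using PU by (auto simp: chart_partition_def case_prod_unfold)
  have "\<forall>p\<in>PU. \<exists>CR. 0 \<le> fst CR \<and> (\<forall>m\<ge>1. \<forall>\<phi>\<in>sobolev_space PU \<pi> s. \<exists>a.
     (\<forall>k. (a k)\<^sup>2 \<le> real m ^ CARD('n) * chart_energy p s \<phi>) \<and>
     integrable \<pi> (\<lambda>x. (snd p x * \<phi> x - (\<Sum>k\<in>cell_indices (snd CR) m. a k * indicator (chart_cell p m k) x))\<^sup>2) \<and>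
     (LINT x|\<pi>. (snd p x * \<phi> x - (\<Sum>k\<in>cell_indices (snd CR) m. a k * indicator (chart_cell p m k) x))\<^sup>2)
       \<le> fst CR * real m powr (- 2 * \<sigma>) * chart_energy p s \<phi>)"
    using chart_approximation[OF M vol PU _ \<sigma>(2-4)] by simp
  from bchoice[OF this] obtain CR where
    CR0: "\<And>p. p \<in> PU \<Longrightarrow> 0 \<le> fst (CR p)" and
    CR: "\<And>p m \<phi>. p \<in> PU \<Longrightarrow> m \<ge> 1 \<Longrightarrow> \<phi> \<in> sobolev_space PU \<pi> s \<Longrightarrow> \<exists>a.
     (\<forall>k. (a k)\<^sup>2 \<le> real m ^ CARD('n) * chart_energy p s \<phi>) \<and>
     integrable \<pi> (\<lambda>x. (snd p x * \<phi> x - (\<Sum>k\<in>cell_indices (snd (CR p)) m. a k * indicator (chart_cell p m k) x))\<^sup>2) \<and>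
     (LINT x|\<pi>. (snd p x * \<phi> x - (\<Sum>k\<in>cell_indices (snd (CR p)) m. a k * indicator (chart_cell p m k) x))\<^sup>2)
       \<le> fst (CR p) * real m powr (- 2 * \<sigma>) * chart_energy p s \<phi>"
    by blast
  define d where "d = CARD('n)"
  have d: "d > 0" by (simp add: d_def)
  \<comment> \<open>A grid of width \<open>1 / m\<close> has of the order of \<open>m ^ d\<close>
    cells, so \<open>m\<close> grows like the \<open>d\<close>-th root of
    \<open>b ^ n\<close>.\<close>
  define B where "B = b powr (1 / real d)"
  have B: "B > 1" unfolding B_def using b d by (intro gr_one_powr) auto
  have Bd: "B ^ d = b" using b d by (simp add: B_def powr_realpow[symmetric] powr_powr)
  define m where "m n = nat \<lceil>B ^ n\<rceil>" for n
  have Bn: "B ^ n \<ge> 1" for n using B by simp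
  \<comment> \<open>Rounding up at most doubles a number that is at least 1.\<close>
  have m: "m n \<ge> 1" "B ^ n \<le> real (m n)" "real (m n) \<le> 2 * B ^ n" for n
    using Bn[of n] unfolding m_def by linarith+
  have md: "real (m n) ^ d \<le> 2 ^ d * b ^ n" for n
  proof -
    have "real (m n) ^ d \<le> (2 * B ^ n) ^ d" using m by (intro power_mono) auto
    also have "\<dots> = 2 ^ d * (B ^ d) ^ n" by (simp add: power_mult_distrib power_mult[symmetric] mult.commute)
    finally show ?thesis by (simp add: Bd)
  qed
  define \<theta> where "\<theta> = B powr (- 2 * \<sigma>)"
  have \<theta>: "0 < \<theta>" "\<theta> < 1" unfolding \<theta>_def using B \<sigma> by (auto intro: powr_less_one)
  have m\<theta>: "real (m n) powr (- 2 * \<sigma>) \<le> \<theta> ^ n" for n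
  proof -
    have "real (m n) powr (- 2 * \<sigma>) \<le> (B ^ n) powr (- 2 * \<sigma>)"
      using m[of n] Bn[of n] \<sigma> by (intro powr_mono2') auto
    also have "\<dots> = \<theta> ^ n" using B by (simp add: \<theta>_def powr_realpow[symmetric] powr_powr mult.commute)
    finally show ?thesis .
  qed
  define I where "I n = Sigma PU (\<lambda>p. cell_indices (snd (CR p)) (m n) :: (real ^ 'n \<Rightarrow> int) set)" for n
  define E where "E n i = chart_cell (fst i) (m n) (snd i)"
    for n and i :: "(('m, real ^ 'n) chart \<times> ('m \<Rightarrow> real)) \<times> (real ^ 'n \<Rightarrow> int)"
  \<comment> \<open>\<open>C1\<close> counts cells over all charts, \<open>C2\<close> collects the
    chart errors with the Cauchy-Schwarz factor \<open>card PU\<close>; the summand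
    \<open>2 ^ d\<close> of \<open>C\<close> serves the coefficients.\<close>
  define C1 where "C1 = (\<Sum>p\<in>PU. (2 * real (snd (CR p)) + 1) ^ d * 2 ^ d)"
  define C2 where "C2 = real (card PU) * (\<Sum>p\<in>PU. fst (CR p))"
  define C where "C = 2 ^ d + C1 + C2"
  have C1: "C1 \<ge> 0" and C2: "C2 \<ge> 0" unfolding C1_def C2_def using CR0 by (auto intro!: sum_nonneg mult_nonneg_nonneg)
  have C: "1 \<le> C" "2 ^ d \<le> C" "C1 \<le> C" "C2 \<le> C"
    using C1 C2 one_le_power[of "2::real" d] unfolding C_def by linarith+
  have card: "real (card (I n)) \<le> C * b ^ n" for n
  proof -
    have "real (card (I n)) = (\<Sum>p\<in>PU. real (card (cell_indices (snd (CR p)) (m n) :: (real ^ 'n \<Rightarrow> int) set)))"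
      unfolding I_def using fin by (simp add: card_SigmaI finite_cell_indices)
    also have "\<dots> \<le> (\<Sum>p\<in>PU. (2 * real (snd (CR p)) + 1) ^ d * (2 ^ d * b ^ n))"
    proof (rule sum_mono)
      fix p
      have "real (card (cell_indices (snd (CR p)) (m n) :: (real ^ 'n \<Rightarrow> int) set)) \<le> (2 * real (snd (CR p)) + 1) ^ d * real (m n) ^ d"
        unfolding d_def by (rule chart_cell_card_bound[OF m(1)])
      also have "\<dots> \<le> (2 * real (snd (CR p)) + 1) ^ d * (2 ^ d * b ^ n)"
        using md by (intro mult_left_mono) auto
      finally show "real (card (cell_indices (snd (CR p)) (m n) :: (real ^ 'n \<Rightarrow> int) set)) \<le> \<dots>" .
    qed
    also have "\<dots> = C1 * b ^ n" unfolding C1_def sum_distrib_right by (simp add: mult.assoc)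
    also have "\<dots> \<le> C * b ^ n" using C b by (intro mult_right_mono) auto
    finally show ?thesis .
  qed
  have finI: "finite (I n)" for n unfolding I_def using fin by (auto simp: finite_cell_indices)
  have Em: "E n i \<in> sets borel" if "i \<in> I n" for n i
    using that unfolding E_def I_def by (auto intro!: chart_cell_measurable[OF M(1) PU])
  have approx: "\<exists>a. (\<forall>i\<in>I n. \<bar>a i\<bar> \<le> C * b ^ n * sobolev_norm PU s \<phi>) \<and>
       integrable \<pi> (\<lambda>x. (\<phi> x - (\<Sum>i\<in>I n. a i * indicator (E n i) x))\<^sup>2) \<and>
       (LINT x|\<pi>. (\<phi> x - (\<Sum>i\<in>I n. a i * indicator (E n i) x))\<^sup>2) \<le> C * \<theta> ^ n * (sobolev_norm PU s \<phi>)\<^sup>2"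
    if \<phi>: "\<phi> \<in> sobolev_space PU \<pi> s" for \<phi> n
  proof -
    define H where "H = sobolev_norm PU s \<phi>"
    have H: "H \<ge> 0" unfolding H_def sobolev_norm_def
      by (auto intro!: real_sqrt_ge_zero sum_nonneg integral_nonneg_AE)
    have T: "chart_energy p s \<phi> \<le> H\<^sup>2" if "p \<in> PU" for p
      unfolding H_def sobolev_norm_square
      by (rule member_le_sum) (use that fin chart_energy_nonneg in auto)
    have "\<forall>p\<in>PU. \<exists>a. (\<forall>k. (a k)\<^sup>2 \<le> real (m n) ^ d * chart_energy p s \<phi>) \<and>
     integrable \<pi> (\<lambda>x. (snd p x * \<phi> x - (\<Sum>k\<in>cell_indices (snd (CR p)) (m n). a k * indicator (chart_cell p (m n) k) x))\<^sup>2) \<and>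
     (LINT x|\<pi>. (snd p x * \<phi> x - (\<Sum>k\<in>cell_indices (snd (CR p)) (m n). a k * indicator (chart_cell p (m n) k) x))\<^sup>2)
       \<le> fst (CR p) * real (m n) powr (- 2 * \<sigma>) * chart_energy p s \<phi>"
      unfolding d_def using CR[OF _ m(1) \<phi>] by blast
    from bchoice[OF this] obtain a where
      a: "\<And>p k. p \<in> PU \<Longrightarrow> (a p k)\<^sup>2 \<le> real (m n) ^ d * chart_energy p s \<phi>" and
      ai: "\<And>p. p \<in> PU \<Longrightarrow> integrable \<pi> (\<lambda>x. (snd p x * \<phi> x - (\<Sum>k\<in>cell_indices (snd (CR p)) (m n). a p k * indicator (chart_cell p (m n) k) x))\<^sup>2)" and
      ae: "\<And>p. p \<in> PU \<Longrightarrow> (LINT x|\<pi>. (snd p x * \<phi> x - (\<Sum>k\<in>cell_indices (snd (CR p)) (m n). a p k * indicator (chart_cell p (m n) k) x))\<^sup>2)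
       \<le> fst (CR p) * real (m n) powr (- 2 * \<sigma>) * chart_energy p s \<phi>"
      by blast
    define X where "X p x = snd p x * \<phi> x - (\<Sum>k\<in>cell_indices (snd (CR p)) (m n). a p k * indicator (chart_cell p (m n) k) x)" for p x
    note ai = ai[folded X_def] and ae = ae[folded X_def]
    define a' where "a' i = a (fst i) (snd i)" for i
    have bn: "1 \<le> 2 ^ d * b ^ n"
      using b mult_mono[of 1 "2 ^ d" 1 "b ^ n"] by simp
    have coef: "\<bar>a' i\<bar> \<le> C * b ^ n * H" if "i \<in> I n" for i
    proof -
      from that have p: "fst i \<in> PU" by (auto simp: I_def)
      have "(a' i)\<^sup>2 \<le> real (m n) ^ d * chart_energy (fst i) s \<phi>" unfolding a'_def by (rule a[OF p])
      also have "\<dots> \<le> (2 ^ d * b ^ n) * H\<^sup>2"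
        using md T[OF p] chart_energy_nonneg[of "fst i" s \<phi>] bn by (intro mult_mono) auto
      \<comment> \<open>Taking the root would give only half the exponent of \<open>b\<close>; the
        base is at least 1, so squaring it gives a weaker bound that has the form of the
        claim.\<close>
      also have "\<dots> \<le> (2 ^ d * b ^ n)\<^sup>2 * H\<^sup>2"
        using bn by (intro mult_right_mono self_le_power) auto
      finally have "\<bar>a' i\<bar>\<^sup>2 \<le> (2 ^ d * b ^ n * H)\<^sup>2" by (simp add: power_mult_distrib)
      then have "\<bar>a' i\<bar> \<le> 2 ^ d * b ^ n * H"
        using bn H by (intro power2_le_imp_le[of "\<bar>a' i\<bar>"]) auto
      also have "\<dots> \<le> C * b ^ n * H" using C H b by (intro mult_right_mono) auto
      finally show ?thesis .
    qed
    \<comment> \<open>As the partition functions add up to 1, the global error is the sum of the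
      errors in the charts.\<close>
    have sumX: "\<phi> x - (\<Sum>i\<in>I n. a' i * indicator (E n i) x) = (\<Sum>p\<in>PU. X p x)" for x
    proof -
      have "(\<Sum>i\<in>I n. a' i * indicator (E n i) x) =
         (\<Sum>p\<in>PU. \<Sum>k\<in>cell_indices (snd (CR p)) (m n). a p k * indicator (chart_cell p (m n) k) x)"
        unfolding I_def a'_def E_def using fin
        by (subst sum.Sigma) (auto simp: finite_cell_indices case_prod_unfold)
      moreover have "\<phi> x = (\<Sum>p\<in>PU. snd p x * \<phi> x)" using one[of x] by (simp add: sum_distrib_right[symmetric])
      ultimately show ?thesis unfolding X_def sum_subtractf by simp
    qed
    have X2: "integrable \<pi> (\<lambda>x. real (card PU) * (\<Sum>p\<in>PU. (X p x)\<^sup>2))"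
      using ai by (intro integrable_mult_right Bochner_Integration.integrable_sum) auto
    have le: "(\<Sum>p\<in>PU. X p x)\<^sup>2 \<le> real (card PU) * (\<Sum>p\<in>PU. (X p x)\<^sup>2)" for x
      by (rule square_sum_le_card)
    have [measurable]: "\<phi> \<in> borel_measurable borel" using \<phi> by (simp add: sobolev_space_def)
    have sets\<pi>: "sets \<pi> = sets borel"
      using vol by (simp add: is_riemannian_volume_def)
    have meas: "(\<lambda>x. (\<phi> x - (\<Sum>i\<in>I n. a' i * indicator (E n i) x))\<^sup>2) \<in> borel_measurable \<pi>"
      unfolding measurable_cong_sets[OF sets\<pi> refl]
      by (intro borel_measurable_power borel_measurable_diff borel_measurable_sum borel_measurable_times
          borel_measurable_const borel_measurable_indicator Em \<open>\<phi> \<in> borel_measurable borel\<close>)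
    have int: "integrable \<pi> (\<lambda>x. (\<phi> x - (\<Sum>i\<in>I n. a' i * indicator (E n i) x))\<^sup>2)"
      by (rule Bochner_Integration.integrable_bound[OF X2 meas])
        (use le in \<open>auto simp: sumX intro!: AE_I2 order.trans[OF _ abs_ge_self]\<close>)
    have "(LINT x|\<pi>. (\<phi> x - (\<Sum>i\<in>I n. a' i * indicator (E n i) x))\<^sup>2) \<le> (LINT x|\<pi>. real (card PU) * (\<Sum>p\<in>PU. (X p x)\<^sup>2))"
      by (rule integral_mono[OF int X2]) (simp add: sumX le)
    also have "\<dots> = real (card PU) * (\<Sum>p\<in>PU. LINT x|\<pi>. (X p x)\<^sup>2)"
      using ai by simp
    also have "\<dots> \<le> real (card PU) * (\<Sum>p\<in>PU. fst (CR p) * (\<theta> ^ n * H\<^sup>2))"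
    proof (intro mult_left_mono sum_mono)
      fix p assume p: "p \<in> PU"
      have "(LINT x|\<pi>. (X p x)\<^sup>2) \<le> fst (CR p) * (real (m n) powr (- 2 * \<sigma>) * chart_energy p s \<phi>)"
        using ae[OF p] by (simp add: mult.assoc)
      also have "\<dots> \<le> fst (CR p) * (\<theta> ^ n * H\<^sup>2)"
        using CR0[OF p] m\<theta>[of n] T[OF p] chart_energy_nonneg[of p s \<phi>] \<theta>
        by (intro mult_left_mono mult_mono) auto
      finally show "(LINT x|\<pi>. (X p x)\<^sup>2) \<le> fst (CR p) * (\<theta> ^ n * H\<^sup>2)" .
    qed simp
    also have "\<dots> = C2 * (\<theta> ^ n * H\<^sup>2)" unfolding C2_def by (simp add: sum_distrib_right mult.assoc)
    also have "\<dots> \<le> C * (\<theta> ^ n * H\<^sup>2)" using C \<theta> by (intro mult_right_mono) auto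
    finally have "(LINT x|\<pi>. (\<phi> x - (\<Sum>i\<in>I n. a' i * indicator (E n i) x))\<^sup>2) \<le> C * \<theta> ^ n * H\<^sup>2"
      by (simp add: mult.assoc)
    with coef int show ?thesis unfolding H_def by (intro exI[of _ a'] conjI ballI)
  qed
  show thesis
    by (rule that[OF C(1) \<theta> finI card Em approx])
qed

section \<open>The two-point process\<close>

text \<open>
  \<open>F\<close> need not map into \<open>space N\<close>: a single noise value may map two points to the same point, so the two-point
  kernel is the distribution of a map that may leave \<open>off_diagonal\<close>.
\<close>

lemma emeasure_distr_partial:
  assumes "\<And>B. B \<in> sets N \<Longrightarrow> F -` B \<inter> space M \<in> sets M" "B \<in> sets N"
  shows "emeasure (distr M N F) B = emeasure M (F -` B \<inter> space M)"
  unfolding distr_def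
proof (rule emeasure_measure_of_sigma)
  show "positive (sets N) (\<lambda>B. emeasure M (F -` B \<inter> space M))"
    by (auto simp: positive_def)
  show "countably_additive (sets N) (\<lambda>B. emeasure M (F -` B \<inter> space M))"
  proof (rule countably_additiveI)
    fix X :: "nat \<Rightarrow> _" assume X: "range X \<subseteq> sets N" "disjoint_family X"
    have "(\<Sum>i. emeasure M (F -` X i \<inter> space M)) = emeasure M (\<Union>i. F -` X i \<inter> space M)"
    proof (rule suminf_emeasure)
      have "F -` X i \<inter> space M \<in> sets M" for i
        using X(1) by (intro assms(1)) auto
      then show "range (\<lambda>i. F -` X i \<inter> space M) \<subseteq> sets M" by auto
      show "disjoint_family (\<lambda>i. F -` X i \<inter> space M)"
        using X(2) unfolding disjoint_family_on_def by blast
    qed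
    then show "(\<Sum>i. emeasure M (F -` X i \<inter> space M)) = emeasure M (F -` \<Union> (range X) \<inter> space M)"
      by (simp add: vimage_UN)
  qed
next
  show "sigma_algebra (space N) (sets N)" by (rule sets.sigma_algebra_axioms)
qed (rule assms(2))

section \<open>Geometric ergodicity with an unbounded weight\<close>

lemma geometrically_ergodicE:
  assumes "geometrically_ergodic X V Q \<mu>"
  obtains C \<gamma> where "markov_kernel X Q" "\<And>x. x \<in> space X \<Longrightarrow> 1 \<le> V x" "stationary X Q \<mu>"
    "\<And>\<nu>. stationary X Q \<nu> \<Longrightarrow> \<nu> = \<mu>" "0 < C" "0 < \<gamma>" "\<gamma> < 1"
    "\<And>h. h \<in> borel_measurable X \<Longrightarrow> bdd_above ((\<lambda>x. \<bar>h x\<bar> / V x) ` space X) \<Longrightarrow> integrable \<mu> h"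
    "\<And>h x n. h \<in> borel_measurable X \<Longrightarrow> bdd_above ((\<lambda>x. \<bar>h x\<bar> / V x) ` space X) \<Longrightarrow> x \<in> space X \<Longrightarrow> 1 \<le> n \<Longrightarrow>
      \<bar>(LINT y|kernel_pow X Q n x. h y) - (LINT y|\<mu>. h y)\<bar> \<le> C * V x * weighted_norm X V h * \<gamma> ^ n"
proof -
  from assms obtain C \<gamma> where *: "markov_kernel X Q" "\<forall>x\<in>space X. 1 \<le> V x" "stationary X Q \<mu>"
    "\<forall>\<nu>. stationary X Q \<nu> \<longrightarrow> \<nu> = \<mu>" "0 < C" "0 < \<gamma>" "\<gamma> < 1"
    and **: "\<forall>h\<in>borel_measurable X. bdd_above ((\<lambda>x. \<bar>h x\<bar> / V x) ` space X) \<longrightarrow>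
          integrable \<mu> h \<and>
          (\<forall>x\<in>space X. \<forall>n\<ge>1. integrable (kernel_pow X Q n x) h \<and>
             \<bar>(LINT y|kernel_pow X Q n x. h y) - (LINT y|\<mu>. h y)\<bar>
               \<le> C * V x * weighted_norm X V h * \<gamma> ^ n)"
    unfolding geometrically_ergodic_def by (elim conjE exE)
  show thesis
  proof (rule that[OF *(1) bspec[OF *(2)] *(3) mp[OF spec[OF *(4)]] *(5-7)])
    fix h :: "'a \<Rightarrow> real" assume h: "h \<in> borel_measurable X" "bdd_above ((\<lambda>x. \<bar>h x\<bar> / V x) ` space X)"
    note *** = mp[OF bspec[OF ** h(1)] h(2)]
    from *** show "integrable \<mu> h" ..
    fix x and n :: nat assume x: "x \<in> space X" and n: "1 \<le> n"
    show "\<bar>(LINT y|kernel_pow X Q n x. h y) - (LINT y|\<mu>. h y)\<bar> \<le> C * V x * weighted_norm X V h * \<gamma> ^ n"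
      by (rule conjunct2[OF mp[OF spec[OF bspec[OF conjunct2[OF ***] x]] n]])
  qed assumption+
qed

text \<open>
  \<open>V\<close> is not assumed to be measurable, so its integral is replaced by a bound for all measurable functions
  below it.  If there were none, the supremum of a sequence of such functions would not be integrable.
\<close>

lemma geometrically_ergodic_integral_bounded:
  assumes ge: "geometrically_ergodic X V Q \<mu>"
  shows "\<exists>B\<ge>0. \<forall>h\<in>borel_measurable X. (\<forall>x\<in>space X. 0 \<le> h x \<and> h x \<le> V x) \<longrightarrow> (LINT x|\<mu>. h x) \<le> B"
proof (rule ccontr)
  assume neg: "\<not> ?thesis"
  obtain C \<gamma> where V1: "\<And>x. x \<in> space X \<Longrightarrow> 1 \<le> V x" and st: "stationary X Q \<mu>"
    and int: "\<And>h. h \<in> borel_measurable X \<Longrightarrow> bdd_above ((\<lambda>x. \<bar>h x\<bar> / V x) ` space X) \<Longrightarrow> integrable \<mu> h"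
    by (rule geometrically_ergodicE[OF ge]) (rule that)
  from st have sets\<mu>: "sets \<mu> = sets X" by (simp add: stationary_def)
  have sp: "space \<mu> = space X" using sets\<mu> by (rule sets_eq_imp_space_eq)
  have "\<forall>k::nat. \<exists>h. h \<in> borel_measurable X \<and> (\<forall>x\<in>space X. 0 \<le> h x \<and> h x \<le> V x) \<and> real k < (LINT x|\<mu>. h x)"
  proof
    fix k :: nat
    show "\<exists>h. h \<in> borel_measurable X \<and> (\<forall>x\<in>space X. 0 \<le> h x \<and> h x \<le> V x) \<and> real k < (LINT x|\<mu>. h x)"
    proof (rule ccontr)
      assume "\<not> ?thesis"
      then have "\<forall>h\<in>borel_measurable X. (\<forall>x\<in>space X. 0 \<le> h x \<and> h x \<le> V x) \<longrightarrow> (LINT x|\<mu>. h x) \<le> real k"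
        by (meson not_le)
      with neg show False by (meson of_nat_0_le_iff)
    qed
  qed
  then obtain h where h: "\<And>k. h k \<in> borel_measurable X"
    "\<And>k x. x \<in> space X \<Longrightarrow> 0 \<le> h k x" "\<And>k x. x \<in> space X \<Longrightarrow> h k x \<le> V x"
    and big: "\<And>k. real k < (LINT x|\<mu>. h k x)"
    by metis
  define G where "G x = (SUP k. h k x)" for x
  have bdd: "bdd_above (range (\<lambda>k. h k x))" if "x \<in> space X" for x
    by (rule bdd_aboveI2[where M="V x"]) (rule h(3)[OF that])
  have Gm: "G \<in> borel_measurable X"
    unfolding G_def by (rule borel_measurable_cSUP) (use h bdd in auto)
  have hG: "h k x \<le> G x" if "x \<in> space X" for k x
    unfolding G_def by (rule cSUP_upper) (use bdd[OF that] in auto)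
  have GV: "G x \<le> V x" if "x \<in> space X" for x
    unfolding G_def by (rule cSUP_least) (use h that in auto)
  have Gint: "integrable \<mu> G"
  proof (rule int[OF Gm], rule bdd_aboveI2)
    fix x assume x: "x \<in> space X"
    have "0 \<le> G x" using h(2)[OF x, of 0] hG[OF x, of 0] by linarith
    then show "\<bar>G x\<bar> / V x \<le> 1" using GV[OF x] V1[OF x] by simp
  qed
  have hint: "integrable \<mu> (h k)" for k
  proof (rule int[OF h(1)], rule bdd_aboveI2)
    fix x assume x: "x \<in> space X"
    show "\<bar>h k x\<bar> / V x \<le> 1" using h(2,3)[OF x, of k] V1[OF x] by simp
  qed
  obtain k :: nat where "(LINT x|\<mu>. G x) < real k" using reals_Archimedean2 by blast
  moreover have "(LINT x|\<mu>. h k x) \<le> (LINT x|\<mu>. G x)"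
    by (rule integral_mono[OF hint Gint]) (simp add: hG sp)
  ultimately show False using big[of k] by linarith
qed

text \<open>The measure-theoretic core of the setting. Geometry enters the later argument through an
  approximation property of the observables, which \<open>sobolev_approximation\<close>
  supplies.\<close>

locale volume_preserving_rds =
  fixes P0 :: "'w measure" and f :: "'w \<Rightarrow> 'm::{second_countable_topology,t2_space} \<Rightarrow> 'm" and \<pi> :: "'m measure"
  assumes prob_P0: "prob_space P0" and prob_\<pi>: "prob_space \<pi>"
    and space_P0 [simp]: "space P0 = UNIV" and sets_\<pi> [simp, measurable_cong]: "sets \<pi> = sets borel"
    and f_measurable: "(\<lambda>(s, x). f s x) \<in> P0 \<Otimes>\<^sub>M borel \<rightarrow>\<^sub>M borel"
    and f_preserving: "AE s in P0. distr \<pi> borel (f s) = \<pi>"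
    and \<pi>_singleton: "emeasure \<pi> {x} = 0"
begin

sublocale P0: prob_space P0 by (rule prob_P0)
sublocale \<pi>: prob_space \<pi> by (rule prob_\<pi>)
sublocale S: sequence_space P0 ..
sublocale \<pi>\<pi>: pair_prob_space \<pi> \<pi> ..

abbreviation "\<Omega> \<equiv> noise P0"

lemma noise_eq: "\<Omega> = S.S"
  by (simp add: noise_def)

sublocale \<Omega>: prob_space \<Omega>
  unfolding noise_eq by (rule S.prob_space_axioms)

lemma space_\<pi> [simp]: "space \<pi> = UNIV"
  using sets_eq_imp_space_eq[OF sets_\<pi>] by simp

lemma f_measurable' [measurable (raw)]:
  assumes "a \<in> N \<rightarrow>\<^sub>M P0" "b \<in> N \<rightarrow>\<^sub>M borel"
  shows "(\<lambda>x. f (a x) (b x)) \<in> N \<rightarrow>\<^sub>M borel"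
  using measurable_compose[OF measurable_Pair[OF assms] f_measurable] by simp

lemma rds_measurable: "(\<lambda>(\<omega>, x). rds f n \<omega> x) \<in> \<Omega> \<Otimes>\<^sub>M borel \<rightarrow>\<^sub>M borel"
proof (induction n)
  case (Suc n)
  have [measurable]: "(\<lambda>p. rds f n (fst p) (snd p)) \<in> \<Omega> \<Otimes>\<^sub>M borel \<rightarrow>\<^sub>M borel"
    using Suc by (simp add: case_prod_unfold)
  have [measurable]: "(\<lambda>p. fst p n) \<in> \<Omega> \<Otimes>\<^sub>M (borel :: 'm measure) \<rightarrow>\<^sub>M P0"
    unfolding noise_eq by measurable
  show ?case by (simp add: case_prod_unfold comp_def)
qed (simp add: case_prod_unfold)

lemma rds_measurable' [measurable (raw)]:
  assumes "a \<in> N \<rightarrow>\<^sub>M \<Omega>" "b \<in> N \<rightarrow>\<^sub>M borel"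
  shows "(\<lambda>x. rds f n (a x) (b x)) \<in> N \<rightarrow>\<^sub>M borel"
  using measurable_compose[OF measurable_Pair[OF assms] rds_measurable] by simp

lemma space_noise [simp]: "space \<Omega> = UNIV"
  by (simp add: noise_eq space_PiM)

lemma f_measurable1: "f s \<in> borel \<rightarrow>\<^sub>M borel"
  by (rule f_measurable'[of "\<lambda>_. s" borel "\<lambda>x. x"]) auto

lemma rds_measurable1: "rds f n \<omega> \<in> borel \<rightarrow>\<^sub>M borel"
  by (rule rds_measurable'[of "\<lambda>_. \<omega>" borel "\<lambda>x. x"]) auto

lemma rds_cong: "(\<And>i. i < n \<Longrightarrow> \<omega> i = \<omega>' i) \<Longrightarrow> rds f n \<omega> = rds f n \<omega>'"
  by (induction n) auto

lemma rds_preserving: "AE \<omega> in \<Omega>. \<forall>n. distr \<pi> borel (rds f n \<omega>) = \<pi>"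
proof -
  have "AE \<omega> in \<Omega>. distr \<pi> borel (f (\<omega> i)) = \<pi>" for i
    unfolding noise_eq using f_preserving
    by (rule S.AE_component[rotated]) simp
  then have "AE \<omega> in \<Omega>. \<forall>i. distr \<pi> borel (f (\<omega> i)) = \<pi>"
    by (simp add: AE_all_countable)
  then show ?thesis
  proof (eventually_elim, intro allI)
    fix \<omega> :: "nat \<Rightarrow> 'w" and n assume pres: "\<forall>i. distr \<pi> borel (f (\<omega> i)) = \<pi>"
    show "distr \<pi> borel (rds f n \<omega>) = \<pi>"
    proof (induction n)
      case 0
      then show ?case using distr_id2[of borel \<pi>] by (simp add: id_def)
    next
      case (Suc n)
      have "distr \<pi> borel (rds f (Suc n) \<omega>) = distr (distr \<pi> borel (rds f n \<omega>)) borel (f (\<omega> n))"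
        by (subst distr_distr) (simp_all add: f_measurable1 rds_measurable1)
      then show ?case using Suc pres by (simp del: rds.simps)
    qed
  qed
qed

text \<open>This is the independence of the last increment from the previous ones: splicing the
  first \<open>n\<close> entries of one noise sequence with a second, independent sequence does not
  change the law.\<close>

lemma nn_integral_rds_Suc:
  assumes [measurable]: "h \<in> borel_measurable (borel \<Otimes>\<^sub>M borel)"
  shows "(\<integral>\<^sup>+ \<omega>. h (rds f (Suc n) \<omega> x, rds f (Suc n) \<omega> y) \<partial>\<Omega>) =
    (\<integral>\<^sup>+ \<omega>. (\<integral>\<^sup>+ s. h (f s (rds f n \<omega> x), f s (rds f n \<omega> y)) \<partial>P0) \<partial>\<Omega>)"
proof -
  have [measurable]: "(\<lambda>\<omega>. \<omega> i) \<in> \<Omega> \<rightarrow>\<^sub>M P0" for i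
    unfolding noise_eq by measurable
  have cs: "(\<lambda>(\<omega>, \<omega>'). comb_seq n \<omega> \<omega>') \<in> \<Omega> \<Otimes>\<^sub>M \<Omega> \<rightarrow>\<^sub>M \<Omega>"
    unfolding noise_eq by (rule measurable_comb_seq)
  \<comment> \<open>Entry \<open>n\<close> of the spliced sequence is entry 0 of the second one,
    while the first \<open>n\<close> maps read only entries below \<open>n\<close>.\<close>
  have r: "rds f n (comb_seq n \<omega> \<omega>') = rds f n \<omega>" "comb_seq n \<omega> \<omega>' n = \<omega>' 0" for \<omega> \<omega>' :: "nat \<Rightarrow> 'w"
    by (auto intro!: rds_cong simp: comb_seq_def)
  have "(\<integral>\<^sup>+ \<omega>. h (rds f (Suc n) \<omega> x, rds f (Suc n) \<omega> y) \<partial>\<Omega>) =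
     (\<integral>\<^sup>+ \<omega>. h (f (\<omega> n) (rds f n \<omega> x), f (\<omega> n) (rds f n \<omega> y)) \<partial>distr (\<Omega> \<Otimes>\<^sub>M \<Omega>) \<Omega> (\<lambda>(\<omega>, \<omega>'). comb_seq n \<omega> \<omega>'))"
    unfolding noise_eq S.PiM_comb_seq by simp
  also have "\<dots> = (\<integral>\<^sup>+ p. h (f (snd p 0) (rds f n (fst p) x), f (snd p 0) (rds f n (fst p) y)) \<partial>(\<Omega> \<Otimes>\<^sub>M \<Omega>))"
    by (subst nn_integral_distr[OF cs]) (measurable, simp add: case_prod_unfold r)
  also have "\<dots> = (\<integral>\<^sup>+ \<omega>. (\<integral>\<^sup>+ \<omega>'. h (f (\<omega>' 0) (rds f n \<omega> x), f (\<omega>' 0) (rds f n \<omega> y)) \<partial>\<Omega>) \<partial>\<Omega>)"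
    by (subst \<Omega>.nn_integral_fst[symmetric]) simp_all
  also have "\<dots> = (\<integral>\<^sup>+ \<omega>. (\<integral>\<^sup>+ s. h (f s (rds f n \<omega> x), f s (rds f n \<omega> y)) \<partial>P0) \<partial>\<Omega>)"
  proof (rule nn_integral_cong)
    fix \<omega> assume "\<omega> \<in> space \<Omega>"
    have "(\<integral>\<^sup>+ s. h (f s (rds f n \<omega> x), f s (rds f n \<omega> y)) \<partial>P0) =
       (\<integral>\<^sup>+ s. h (f s (rds f n \<omega> x), f s (rds f n \<omega> y)) \<partial>distr \<Omega> P0 (\<lambda>\<omega>'. \<omega>' 0))"
      unfolding noise_eq by (subst S.PiM_component) auto
    also have "\<dots> = (\<integral>\<^sup>+ \<omega>'. h (f (\<omega>' 0) (rds f n \<omega> x), f (\<omega>' 0) (rds f n \<omega> y)) \<partial>\<Omega>)"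
      by (subst nn_integral_distr) auto
    finally show "(\<integral>\<^sup>+ \<omega>'. h (f (\<omega>' 0) (rds f n \<omega> x), f (\<omega>' 0) (rds f n \<omega> y)) \<partial>\<Omega>) =
       (\<integral>\<^sup>+ s. h (f s (rds f n \<omega> x), f s (rds f n \<omega> y)) \<partial>P0)" ..
  qed
  finally show ?thesis .
qed

end

section \<open>Iterates of the two-point kernel\<close>

lemma off_diagonal_open: "open (off_diagonal :: ('m::t2_space \<times> 'm) set)"
proof -
  have eq: "off_diagonal = - {z. \<exists>x::'m. z = (x, x)}" by (auto simp: off_diagonal_def)
  show ?thesis unfolding eq by (intro open_Compl closed_diagonal)
qed

lemma off_diagonal_borel_sets:
  fixes B :: "('m::t2_space \<times> 'm) set"
  shows "B \<in> sets off_diagonal_borel \<longleftrightarrow> B \<subseteq> off_diagonal \<and> B \<in> sets borel"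
  unfolding off_diagonal_borel_def by (subst sets_restrict_space_iff) (auto simp: off_diagonal_open)

lemma space_off_diagonal_borel [simp]: "space off_diagonal_borel = off_diagonal"
  by (simp add: off_diagonal_borel_def space_restrict_space)

context volume_preserving_rds
begin

lemma borel_pair: "(borel :: ('m \<times> 'm) measure) = borel \<Otimes>\<^sub>M borel"
  by (rule borel_prod[symmetric])

abbreviation "K2 \<equiv> two_point_kernel P0 f"

definition pair_map :: "nat \<Rightarrow> 'm \<times> 'm \<Rightarrow> (nat \<Rightarrow> 'w) \<Rightarrow> 'm \<times> 'm" where
  "pair_map n z \<omega> = (rds f n \<omega> (fst z), rds f n \<omega> (snd z))"

lemma pair_map_measurable [measurable (raw)]:
  assumes [measurable]: "a \<in> N \<rightarrow>\<^sub>M borel" "b \<in> N \<rightarrow>\<^sub>M \<Omega>"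
  shows "(\<lambda>x. pair_map n (a x) (b x)) \<in> N \<rightarrow>\<^sub>M borel"
proof -
  have [measurable]: "a \<in> N \<rightarrow>\<^sub>M borel \<Otimes>\<^sub>M borel" using assms(1) by (simp add: borel_pair)
  have "(\<lambda>x. (rds f n (b x) (fst (a x)), rds f n (b x) (snd (a x)))) \<in> N \<rightarrow>\<^sub>M borel \<Otimes>\<^sub>M borel"
    by measurable
  then show ?thesis by (simp add: pair_map_def borel_pair)
qed

definition step :: "'w \<Rightarrow> 'm \<times> 'm \<Rightarrow> 'm \<times> 'm" where
  "step s z = (f s (fst z), f s (snd z))"

lemma step_measurable [measurable (raw)]:
  assumes [measurable]: "a \<in> N \<rightarrow>\<^sub>M borel" "b \<in> N \<rightarrow>\<^sub>M P0"
  shows "(\<lambda>x. step (b x) (a x)) \<in> N \<rightarrow>\<^sub>M borel"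
proof -
  have [measurable]: "a \<in> N \<rightarrow>\<^sub>M borel \<Otimes>\<^sub>M borel" using assms(1) by (simp add: borel_pair)
  have "(\<lambda>x. (f (b x) (fst (a x)), f (b x) (snd (a x)))) \<in> N \<rightarrow>\<^sub>M borel \<Otimes>\<^sub>M borel"
    by measurable
  then show ?thesis by (simp add: step_def borel_pair)
qed

lemma emeasure_K2:
  assumes B: "B \<in> sets off_diagonal_borel"
  shows "emeasure (K2 z) B = (\<integral>\<^sup>+ s. indicator B (step s z) \<partial>P0)"
proof -
  have m: "(\<lambda>s. step s z) -` B \<inter> space P0 \<in> sets P0" if "B \<in> sets off_diagonal_borel" for B
    by (rule measurable_sets[of _ P0 borel]) (use that in \<open>auto simp: off_diagonal_borel_sets\<close>)
  have "K2 z = distr P0 off_diagonal_borel (\<lambda>s. step s z)"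
    by (simp add: two_point_kernel_def step_def case_prod_unfold)
  then have "emeasure (K2 z) B = emeasure P0 ((\<lambda>s. step s z) -` B \<inter> space P0)"
    using emeasure_distr_partial[OF m B] by simp
  also have "\<dots> = (\<integral>\<^sup>+ s. indicator ((\<lambda>s. step s z) -` B \<inter> space P0) s \<partial>P0)"
    by (rule nn_integral_indicator[symmetric]) (rule m[OF B])
  also have "\<dots> = (\<integral>\<^sup>+ s. indicator B (step s z) \<partial>P0)"
    by (intro nn_integral_cong) (auto simp: indicator_def)
  finally show ?thesis .
qed

text \<open>The induction has to carry the total mass along: the law of the pair is restricted to
  \<open>off_diagonal\<close>, and mass 1 says that nothing was lost by the restriction. The mass is
  preserved because the kernel is Markov on that space.\<close>

lemma kernel_pow_two_point:
  assumes mk: "markov_kernel off_diagonal_borel K2" and z: "z \<in> off_diagonal"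
  shows "prob_space (kernel_pow off_diagonal_borel K2 n z) \<and>
    kernel_pow off_diagonal_borel K2 n z = restrict_space (distr \<Omega> borel (pair_map n z)) off_diagonal"
proof (induction n)
  have offb: "(off_diagonal :: ('m \<times> 'm) set) \<in> sets borel" by (intro borel_open off_diagonal_open)
  case 0
  have T: "pair_map 0 z = (\<lambda>_. z)" by (simp add: pair_map_def fun_eq_iff)
  have "return off_diagonal_borel z = restrict_space (distr \<Omega> borel (pair_map 0 z)) off_diagonal"
  proof (rule measure_eqI)
    show "sets (return off_diagonal_borel z) = sets (restrict_space (distr \<Omega> borel (pair_map 0 z)) off_diagonal)"
      by (simp add: off_diagonal_borel_def sets_restrict_space)
    fix B assume "B \<in> sets (return off_diagonal_borel z)"
    then have B: "B \<subseteq> off_diagonal" "B \<in> sets borel" "B \<in> sets off_diagonal_borel"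
      by (auto simp: off_diagonal_borel_sets)
    then show "emeasure (return off_diagonal_borel z) B = emeasure (restrict_space (distr \<Omega> borel (pair_map 0 z)) off_diagonal) B"
      using offb by (simp add: emeasure_restrict_space T emeasure_distr \<Omega>.emeasure_space_1 indicator_def)
  qed
  moreover have "prob_space (return off_diagonal_borel z)"
    using z by (intro prob_space_return) simp
  ultimately show ?case by simp
next
  have offb: "(off_diagonal :: ('m \<times> 'm) set) \<in> sets borel" by (intro borel_open off_diagonal_open)
  case (Suc n)
  let ?\<kappa> = "kernel_pow off_diagonal_borel K2 n z" and ?\<nu> = "distr \<Omega> borel (pair_map n z)"
  have \<kappa>: "prob_space ?\<kappa>" "?\<kappa> = restrict_space ?\<nu> off_diagonal" using Suc by auto
  have sets\<kappa>: "sets ?\<kappa> = sets off_diagonal_borel"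
    unfolding \<kappa>(2) by (simp add: off_diagonal_borel_def sets_restrict_space)
  then have space\<kappa>: "space ?\<kappa> = off_diagonal" using sets_eq_imp_space_eq[OF sets\<kappa>] by simp
  have K2m: "K2 \<in> ?\<kappa> \<rightarrow>\<^sub>M prob_algebra off_diagonal_borel"
    using mk unfolding markov_kernel_def measurable_cong_sets[OF sets\<kappa> refl] .
  then have K2m': "K2 \<in> ?\<kappa> \<rightarrow>\<^sub>M subprob_algebra off_diagonal_borel" by (rule measurable_prob_algebraD)
  have ne: "space ?\<kappa> \<noteq> {}" using space\<kappa> z by auto
  have pm [measurable]: "pair_map n z \<in> \<Omega> \<rightarrow>\<^sub>M borel" for n
    by (rule pair_map_measurable[of "\<lambda>_. z"]) auto
  \<comment> \<open>Almost surely the two trajectories have not met by time \<open>n\<close>; this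
    removes the indicator of \<open>off_diagonal\<close> in the computation below.\<close>
  have AE_off: "AE \<omega> in \<Omega>. pair_map n z \<omega> \<in> off_diagonal"
  proof -
    have "emeasure ?\<kappa> off_diagonal = 1" using prob_space.emeasure_space_1[OF \<kappa>(1)] space\<kappa> by simp
    then have "emeasure \<Omega> {\<omega> \<in> space \<Omega>. pair_map n z \<omega> \<in> off_diagonal} = 1"
      unfolding \<kappa>(2) using offb by (simp add: emeasure_restrict_space emeasure_distr vimage_def)
    moreover have "{\<omega> \<in> space \<Omega>. pair_map n z \<omega> \<in> off_diagonal} \<in> sets \<Omega>"
      using measurable_sets[OF pm offb] by (simp add: vimage_def)
    ultimately show ?thesis by (rule \<Omega>.AE_I_eq_1)
  qed
  have pr: "prob_space (kernel_pow off_diagonal_borel K2 (Suc n) z)"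
  proof -
    interpret \<kappa>: prob_space ?\<kappa> by (rule \<kappa>(1))
    show ?thesis unfolding kernel_pow.simps
      by (rule \<kappa>.prob_space_bind[OF _ K2m'])
        (use measurable_space[OF K2m] in \<open>auto simp: space_prob_algebra\<close>)
  qed
  have setsS: "sets (kernel_pow off_diagonal_borel K2 (Suc n) z) = sets off_diagonal_borel"
    using sets_bind[OF sets_kernel[OF K2m'] ne] by simp
  have "kernel_pow off_diagonal_borel K2 (Suc n) z = restrict_space (distr \<Omega> borel (pair_map (Suc n) z)) off_diagonal"
  proof (rule measure_eqI)
    show "sets (kernel_pow off_diagonal_borel K2 (Suc n) z) = sets (restrict_space (distr \<Omega> borel (pair_map (Suc n) z)) off_diagonal)"
      unfolding setsS by (simp add: off_diagonal_borel_def sets_restrict_space)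
    fix B assume "B \<in> sets (kernel_pow off_diagonal_borel K2 (Suc n) z)"
    then have B: "B \<subseteq> off_diagonal" "B \<in> sets borel" "B \<in> sets off_diagonal_borel"
      unfolding setsS by (auto simp: off_diagonal_borel_sets)
    note [measurable] = B(2)
    have "emeasure (kernel_pow off_diagonal_borel K2 (Suc n) z) B = (\<integral>\<^sup>+ w. emeasure (K2 w) B \<partial>?\<kappa>)"
      unfolding kernel_pow.simps by (rule emeasure_bind[OF ne K2m' B(3)])
    also have "\<dots> = (\<integral>\<^sup>+ w. (\<integral>\<^sup>+ s. indicator B (step s w) \<partial>P0) \<partial>restrict_space ?\<nu> off_diagonal)"
      unfolding emeasure_K2[OF B(3)] \<kappa>(2) ..
    also have "\<dots> = (\<integral>\<^sup>+ w. (\<integral>\<^sup>+ s. indicator B (step s w) \<partial>P0) * indicator off_diagonal w \<partial>?\<nu>)"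
      using offb by (subst nn_integral_restrict_space) auto
    also have "\<dots> = (\<integral>\<^sup>+ \<omega>. (\<integral>\<^sup>+ s. indicator B (step s (pair_map n z \<omega>)) \<partial>P0) * indicator off_diagonal (pair_map n z \<omega>) \<partial>\<Omega>)"
      using offb by (subst nn_integral_distr) auto
    also have "\<dots> = (\<integral>\<^sup>+ \<omega>. (\<integral>\<^sup>+ s. indicator B (step s (pair_map n z \<omega>)) \<partial>P0) \<partial>\<Omega>)"
      by (rule nn_integral_cong_AE) (use AE_off in \<open>auto elim!: eventually_mono\<close>)
    also have "\<dots> = (\<integral>\<^sup>+ \<omega>. indicator B (pair_map (Suc n) z \<omega>) \<partial>\<Omega>)"
      using nn_integral_rds_Suc[of "indicator B" n "fst z" "snd z"] B(2)
      by (simp add: pair_map_def step_def borel_pair)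
    also have "\<dots> = emeasure \<Omega> (pair_map (Suc n) z -` B \<inter> space \<Omega>)"
    proof -
      have "pair_map (Suc n) z -` B \<inter> space \<Omega> \<in> sets \<Omega>"
        by (rule measurable_sets[of _ \<Omega> borel]) auto
      from nn_integral_indicator[OF this] show ?thesis by (simp add: indicator_vimage)
    qed
    also have "\<dots> = emeasure (restrict_space (distr \<Omega> borel (pair_map (Suc n) z)) off_diagonal) B"
      using B offb by (simp add: emeasure_restrict_space emeasure_distr)
    finally show "emeasure (kernel_pow off_diagonal_borel K2 (Suc n) z) B =
      emeasure (restrict_space (distr \<Omega> borel (pair_map (Suc n) z)) off_diagonal) B" .
  qed
  with pr show ?case by blast
qed

end

section \<open>The product measure off the diagonal\<close>

context volume_preserving_rds
begin

text \<open>The product measure has to live on the state space of the two-point kernel. The removed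
  diagonal has measure 0 because its sections are single points, so integrals do not change.\<close>

definition pair_law :: "('m \<times> 'm) measure" where
  "pair_law = restrict_space (\<pi> \<Otimes>\<^sub>M \<pi>) off_diagonal"

lemma sets_\<pi>\<pi> [simp, measurable_cong]: "sets (\<pi> \<Otimes>\<^sub>M \<pi>) = sets borel"
proof -
  have "sets (\<pi> \<Otimes>\<^sub>M \<pi>) = sets (borel \<Otimes>\<^sub>M borel)" by (rule sets_pair_measure_cong) simp_all
  then show ?thesis by (simp add: borel_pair)
qed

lemma off_diagonal_borel_set [measurable]: "(off_diagonal :: ('m \<times> 'm) set) \<in> sets borel"
  by (intro borel_open off_diagonal_open)

lemma off_diagonal_pair_set: "off_diagonal \<inter> space (\<pi> \<Otimes>\<^sub>M \<pi>) \<in> sets (\<pi> \<Otimes>\<^sub>M \<pi>)"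
proof (rule sets.Int)
  show "off_diagonal \<in> sets (\<pi> \<Otimes>\<^sub>M \<pi>)"
    unfolding sets_\<pi>\<pi> by (rule off_diagonal_borel_set)
qed (rule sets.top)

lemma AE_off_diagonal: "AE z in \<pi> \<Otimes>\<^sub>M \<pi>. z \<in> off_diagonal"
proof -
  have c: "- off_diagonal \<in> sets (\<pi> \<Otimes>\<^sub>M \<pi>)"
    unfolding sets_\<pi>\<pi> by (intro borel_comp off_diagonal_borel_set)
  have "emeasure (\<pi> \<Otimes>\<^sub>M \<pi>) (- off_diagonal) = (\<integral>\<^sup>+ x. emeasure \<pi> (Pair x -` (- off_diagonal)) \<partial>\<pi>)"
    by (rule \<pi>.emeasure_pair_measure_alt[OF c])
  also have "\<dots> = (\<integral>\<^sup>+ x. 0 \<partial>\<pi>)"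
  proof (rule nn_integral_cong)
    fix x :: 'm
    have "Pair x -` (- off_diagonal) = {x}" by (auto simp: off_diagonal_def)
    then show "emeasure \<pi> (Pair x -` (- off_diagonal)) = 0" by (simp add: \<pi>_singleton)
  qed
  finally have "emeasure (\<pi> \<Otimes>\<^sub>M \<pi>) (- off_diagonal) = 0" by simp
  then show ?thesis by (intro AE_I[OF _ _ c]) auto
qed

lemma sets_pair_law [simp]: "sets pair_law = sets off_diagonal_borel"
  unfolding pair_law_def off_diagonal_borel_def by (rule sets_restrict_space_cong[OF sets_\<pi>\<pi>])

lemma space_pair_law [simp]: "space pair_law = off_diagonal"
  using sets_eq_imp_space_eq[OF sets_pair_law] by simp

lemma nn_integral_pair_law:
  assumes [measurable]: "h \<in> borel_measurable borel"
  shows "(\<integral>\<^sup>+ z. h z \<partial>pair_law) = (\<integral>\<^sup>+ z. h z \<partial>(\<pi> \<Otimes>\<^sub>M \<pi>))"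
proof -
  have "(\<integral>\<^sup>+ z. h z \<partial>pair_law) = (\<integral>\<^sup>+ z. h z * indicator off_diagonal z \<partial>(\<pi> \<Otimes>\<^sub>M \<pi>))"
    unfolding pair_law_def by (rule nn_integral_restrict_space[OF off_diagonal_pair_set])
  also have "\<dots> = (\<integral>\<^sup>+ z. h z \<partial>(\<pi> \<Otimes>\<^sub>M \<pi>))"
    by (rule nn_integral_cong_AE) (use AE_off_diagonal in \<open>auto elim!: eventually_mono\<close>)
  finally show ?thesis .
qed

lemma integral_pair_law:
  fixes h :: "'m \<times> 'm \<Rightarrow> real"
  assumes [measurable]: "h \<in> borel_measurable borel"
  shows "(LINT z|pair_law. h z) = (LINT z|(\<pi> \<Otimes>\<^sub>M \<pi>). h z)"
proof -
  have "(LINT z|pair_law. h z) = (LINT z|(\<pi> \<Otimes>\<^sub>M \<pi>). indicator off_diagonal z *\<^sub>R h z)"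
    unfolding pair_law_def by (rule integral_restrict_space[OF off_diagonal_pair_set])
  also have "\<dots> = (LINT z|(\<pi> \<Otimes>\<^sub>M \<pi>). h z)"
    by (rule integral_cong_AE) (use AE_off_diagonal in \<open>auto elim!: eventually_mono\<close>)
  finally show ?thesis .
qed

lemma prob_space_pair_law: "prob_space pair_law"
proof
  have "emeasure pair_law (space pair_law) = (\<integral>\<^sup>+ z. 1 \<partial>pair_law)" by simp
  also have "\<dots> = (\<integral>\<^sup>+ z. 1 \<partial>(\<pi> \<Otimes>\<^sub>M \<pi>))" by (rule nn_integral_pair_law) simp
  also have "\<dots> = 1" using \<pi>\<pi>.emeasure_space_1 by simp
  finally show "emeasure pair_law (space pair_law) = 1" .
qed

text \<open>The same map acts on both coordinates; Fubini's theorem allows the invariance of \<pi>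
  to be used in one coordinate at a time. The null set may depend on \<open>h\<close>, which is
  harmless after integration over the noise.\<close>

lemma nn_integral_step_invariant:
  assumes [measurable]: "h \<in> borel_measurable borel"
  shows "AE s in P0. (\<integral>\<^sup>+ z. h (step s z) \<partial>(\<pi> \<Otimes>\<^sub>M \<pi>)) = (\<integral>\<^sup>+ z. h z \<partial>(\<pi> \<Otimes>\<^sub>M \<pi>))"
  using f_preserving
proof eventually_elim
  fix s assume pres: "distr \<pi> borel (f s) = \<pi>"
  have [measurable]: "h \<in> borel_measurable (\<pi> \<Otimes>\<^sub>M \<pi>)"
    unfolding measurable_cong_sets[OF sets_\<pi>\<pi> refl] by (rule assms)
  have [measurable]: "f s \<in> borel \<rightarrow>\<^sub>M borel" by (rule f_measurable1)
  have hp: "(\<lambda>y. h (a, y)) \<in> borel_measurable borel" for a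
    using measurable_Pair2[OF \<open>h \<in> borel_measurable (\<pi> \<Otimes>\<^sub>M \<pi>)\<close>, of a] by (simp cong: measurable_cong_sets)
  have inv: "(\<integral>\<^sup>+ x. k (f s x) \<partial>\<pi>) = (\<integral>\<^sup>+ x. k x \<partial>\<pi>)" if "k \<in> borel_measurable borel" for k :: "'m \<Rightarrow> ennreal"
  proof -
    have "(\<integral>\<^sup>+ x. k x \<partial>\<pi>) = (\<integral>\<^sup>+ x. k x \<partial>distr \<pi> borel (f s))" by (simp add: pres)
    also have "\<dots> = (\<integral>\<^sup>+ x. k (f s x) \<partial>\<pi>)" using that by (intro nn_integral_distr) auto
    finally show ?thesis ..
  qed
  have sm: "(\<lambda>z. h (step s z)) \<in> borel_measurable (\<pi> \<Otimes>\<^sub>M \<pi>)"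
    unfolding measurable_cong_sets[OF sets_\<pi>\<pi> refl]
    by (rule measurable_compose[OF step_measurable[of "\<lambda>z. z" borel "\<lambda>_. s"] assms]) auto
  have "(\<integral>\<^sup>+ z. h (step s z) \<partial>(\<pi> \<Otimes>\<^sub>M \<pi>)) = (\<integral>\<^sup>+ x. (\<integral>\<^sup>+ y. h (f s x, f s y) \<partial>\<pi>) \<partial>\<pi>)"
    by (subst \<pi>.nn_integral_fst[OF sm, symmetric]) (simp add: step_def)
  also have "\<dots> = (\<integral>\<^sup>+ x. (\<integral>\<^sup>+ y. h (f s x, y) \<partial>\<pi>) \<partial>\<pi>)"
    by (simp add: inv[OF hp])
  also have "\<dots> = (\<integral>\<^sup>+ x. (\<integral>\<^sup>+ y. h (x, y) \<partial>\<pi>) \<partial>\<pi>)"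
  proof (rule inv[of "\<lambda>x. \<integral>\<^sup>+ y. h (x, y) \<partial>\<pi>"])
    have "(\<lambda>x. \<integral>\<^sup>+ y. h (x, y) \<partial>\<pi>) \<in> borel_measurable \<pi>" by measurable
    then show "(\<lambda>x. \<integral>\<^sup>+ y. h (x, y) \<partial>\<pi>) \<in> borel_measurable borel" by (simp cong: measurable_cong_sets)
  qed
  also have "\<dots> = (\<integral>\<^sup>+ z. h z \<partial>(\<pi> \<Otimes>\<^sub>M \<pi>))"
    by (rule \<pi>.nn_integral_fst) measurable
  finally show "(\<integral>\<^sup>+ z. h (step s z) \<partial>(\<pi> \<Otimes>\<^sub>M \<pi>)) = (\<integral>\<^sup>+ z. h z \<partial>(\<pi> \<Otimes>\<^sub>M \<pi>))" .
qed

text \<open>Almost every noise value preserves the product measure, hence so does the average over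
  the noise. Uniqueness then identifies the stationary measure in the ergodicity assumption.\<close>

lemma stationary_pair_law:
  assumes mk: "markov_kernel off_diagonal_borel K2"
  shows "stationary off_diagonal_borel K2 pair_law"
  unfolding stationary_def
proof (intro conjI sets_pair_law prob_space_pair_law)
  interpret PL: prob_space pair_law by (rule prob_space_pair_law)
  interpret PP: pair_sigma_finite P0 "\<pi> \<Otimes>\<^sub>M \<pi>" ..
  have "K2 \<in> pair_law \<rightarrow>\<^sub>M prob_algebra off_diagonal_borel"
    using mk unfolding markov_kernel_def measurable_cong_sets[OF sets_pair_law refl] .
  then have K2m: "K2 \<in> pair_law \<rightarrow>\<^sub>M subprob_algebra off_diagonal_borel" by (rule measurable_prob_algebraD)
  have ne: "space pair_law \<noteq> {}" by (rule PL.not_empty)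
  show "pair_law \<bind> K2 = pair_law"
  proof (rule measure_eqI)
    show sb: "sets (pair_law \<bind> K2) = sets pair_law"
      using sets_bind[OF sets_kernel[OF K2m] ne] by simp
    fix B assume "B \<in> sets (pair_law \<bind> K2)"
    then have B: "B \<subseteq> off_diagonal" "B \<in> sets borel" "B \<in> sets off_diagonal_borel"
      unfolding sb by (auto simp: off_diagonal_borel_sets)
    note [measurable] = B(2)
    have "emeasure (pair_law \<bind> K2) B = (\<integral>\<^sup>+ w. emeasure (K2 w) B \<partial>pair_law)"
      by (rule emeasure_bind[OF ne K2m B(3)])
    also have "\<dots> = (\<integral>\<^sup>+ w. (\<integral>\<^sup>+ s. indicator B (step s w) \<partial>P0) \<partial>pair_law)"
      unfolding emeasure_K2[OF B(3)] ..
    also have "\<dots> = (\<integral>\<^sup>+ w. (\<integral>\<^sup>+ s. indicator B (step s w) \<partial>P0) \<partial>(\<pi> \<Otimes>\<^sub>M \<pi>))"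
      by (rule nn_integral_pair_law) measurable
    also have "\<dots> = (\<integral>\<^sup>+ s. (\<integral>\<^sup>+ w. indicator B (step s w) \<partial>(\<pi> \<Otimes>\<^sub>M \<pi>)) \<partial>P0)"
      by (rule PP.Fubini') measurable
    also have "\<dots> = (\<integral>\<^sup>+ s. (\<integral>\<^sup>+ w. indicator B w \<partial>(\<pi> \<Otimes>\<^sub>M \<pi>)) \<partial>P0)"
      by (rule nn_integral_cong_AE, rule nn_integral_step_invariant) measurable
    also have "\<dots> = (\<integral>\<^sup>+ w. indicator B w \<partial>(\<pi> \<Otimes>\<^sub>M \<pi>))"
      using P0.emeasure_space_1 by simp
    also have "\<dots> = (\<integral>\<^sup>+ w. indicator B w \<partial>pair_law)"
      by (rule nn_integral_pair_law[symmetric]) measurable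
    also have "\<dots> = emeasure pair_law B"
      using B(3) by simp
    finally show "emeasure (pair_law \<bind> K2) B = emeasure pair_law B" .
  qed
qed

text \<open>The pair stays off the diagonal almost surely, so the restriction in
  \<open>kernel_pow_two_point\<close> does not affect integrals.\<close>

lemma integral_kernel_pow:
  fixes h :: "'m \<times> 'm \<Rightarrow> real"
  assumes mk: "markov_kernel off_diagonal_borel K2" and z: "z \<in> off_diagonal"
    and [measurable]: "h \<in> borel_measurable borel"
  shows "(LINT w|kernel_pow off_diagonal_borel K2 n z. h w) = (LINT \<omega>|\<Omega>. h (pair_map n z \<omega>))"
proof -
  let ?\<nu> = "distr \<Omega> borel (pair_map n z)"
  have pm [measurable]: "pair_map n z \<in> \<Omega> \<rightarrow>\<^sub>M borel"
    by (rule pair_map_measurable[of "\<lambda>_. z"]) auto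
  note kp = kernel_pow_two_point[OF mk z, of n]
  then have "emeasure (restrict_space ?\<nu> off_diagonal) (space (restrict_space ?\<nu> off_diagonal)) = 1"
    by (metis prob_space.emeasure_space_1)
  then have "emeasure ?\<nu> off_diagonal = 1"
    by (simp add: space_restrict_space emeasure_restrict_space)
  then have "AE w in ?\<nu>. w \<in> off_diagonal"
    using prob_space.AE_I_eq_1[OF \<Omega>.prob_space_distr[OF pm], of "\<lambda>w. w \<in> off_diagonal"] by simp
  then have AE: "AE w in ?\<nu>. indicator off_diagonal w *\<^sub>R h w = h w"
    by eventually_elim simp
  have "(LINT w|kernel_pow off_diagonal_borel K2 n z. h w) = (LINT w|?\<nu>. indicator off_diagonal w *\<^sub>R h w)"
    unfolding conjunct2[OF kp] by (rule integral_restrict_space) simp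
  also have "\<dots> = (LINT w|?\<nu>. h w)"
    by (rule integral_cong_AE[OF _ _ AE]) measurable
  also have "\<dots> = (LINT \<omega>|\<Omega>. h (pair_map n z \<omega>))"
    by (rule integral_distr) measurable
  finally show ?thesis .
qed

end

section \<open>Second moments of correlations\<close>

context volume_preserving_rds
begin

definition correlation :: "('m \<Rightarrow> real) \<Rightarrow> ('m \<Rightarrow> real) \<Rightarrow> nat \<Rightarrow> (nat \<Rightarrow> 'w) \<Rightarrow> real" where
  "correlation \<phi> \<psi> n \<omega> = (LINT x|\<pi>. \<phi> x * \<psi> (rds f n \<omega> x))"

lemma correlation_measurable [measurable]:
  assumes [measurable]: "\<phi> \<in> borel_measurable borel" "\<psi> \<in> borel_measurable borel"
  shows "correlation \<phi> \<psi> n \<in> borel_measurable \<Omega>"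
  unfolding correlation_def by measurable

lemma integrable_bounded_\<pi>:
  fixes h :: "'m \<Rightarrow> real"
  assumes "h \<in> borel_measurable borel" "\<And>x. \<bar>h x\<bar> \<le> c"
  shows "integrable \<pi> h"
  using assms by (intro \<pi>.integrable_const_bound[of h c]) (auto cong: measurable_cong_sets)

text \<open>The square of an integral is a double integral over two initial points driven by the
  same noise; this is how the two-point motion enters.\<close>

lemma correlation_square:
  assumes [measurable]: "\<phi> \<in> borel_measurable borel" "\<psi> \<in> borel_measurable borel"
    and bd: "\<And>x. \<bar>\<phi> x\<bar> \<le> 1" "\<And>x. \<bar>\<psi> x\<bar> \<le> 1"
  shows "(correlation \<phi> \<psi> n \<omega>)\<^sup>2 =
    (LINT z|(\<pi> \<Otimes>\<^sub>M \<pi>). \<phi> (fst z) * \<phi> (snd z) * (\<psi> (fst (pair_map n z \<omega>)) * \<psi> (snd (pair_map n z \<omega>))))"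
proof -
  have [measurable]: "rds f n \<omega> \<in> borel \<rightarrow>\<^sub>M borel" by (rule rds_measurable1)
  define k where "k x = \<phi> x * \<psi> (rds f n \<omega> x)" for x
  have [measurable]: "k \<in> borel_measurable borel" unfolding k_def by measurable
  have kb: "\<bar>k x\<bar> \<le> 1" for x
    using mult_mono[OF bd(1)[of x] bd(2)[of "rds f n \<omega> x"]] by (simp add: k_def abs_mult)
  have ki: "integrable \<pi> k" by (rule integrable_bounded_\<pi>) (use kb in auto)
  have kk: "integrable (\<pi> \<Otimes>\<^sub>M \<pi>) (\<lambda>z. k (fst z) * k (snd z))"
  proof (rule \<pi>\<pi>.integrable_const_bound[where B=1])
    show "AE z in \<pi> \<Otimes>\<^sub>M \<pi>. norm (k (fst z) * k (snd z)) \<le> 1"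
    proof (intro AE_I2)
      fix z :: "'m \<times> 'm"
      show "norm (k (fst z) * k (snd z)) \<le> 1"
        using mult_mono[OF kb[of "fst z"] kb[of "snd z"]] by (simp add: abs_mult)
    qed
    have km: "k \<in> borel_measurable \<pi>"
      unfolding measurable_cong_sets[OF sets_\<pi> refl] by measurable
    show "(\<lambda>z. k (fst z) * k (snd z)) \<in> borel_measurable (\<pi> \<Otimes>\<^sub>M \<pi>)"
      by (rule borel_measurable_times[OF measurable_compose[OF measurable_fst km] measurable_compose[OF measurable_snd km]])
  qed
  have "(correlation \<phi> \<psi> n \<omega>)\<^sup>2 = (LINT x|\<pi>. LINT y|\<pi>. k x * k y)"
    by (simp add: correlation_def k_def[symmetric] power2_eq_square)
  also have "\<dots> = (LINT z|(\<pi> \<Otimes>\<^sub>M \<pi>). k (fst z) * k (snd z))"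
    using \<pi>\<pi>.integral_fst'[OF kk] by simp
  finally show ?thesis by (simp add: k_def pair_map_def mult_ac)
qed

text \<open>Exchanging the integrals leaves the two-point semigroup applied to \<Psi>. The factor
  coming from \<phi> is at most 1 in modulus and is dropped, so in the decay estimate only \<psi>
  has to be centred.\<close>

lemma second_moment_bound:
  assumes [measurable]: "\<phi> \<in> borel_measurable borel" "\<psi> \<in> borel_measurable borel"
    and bd: "\<And>x. \<bar>\<phi> x\<bar> \<le> 1" "\<And>x. \<bar>\<psi> x\<bar> \<le> 1"
  defines "\<Psi> \<equiv> \<lambda>z. \<psi> (fst z) * \<psi> (snd z)"
  shows "(LINT \<omega>|\<Omega>. (correlation \<phi> \<psi> n \<omega>)\<^sup>2) \<le> (LINT z|pair_law. \<bar>LINT \<omega>|\<Omega>. \<Psi> (pair_map n z \<omega>)\<bar>)"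
    and "(\<lambda>z. LINT \<omega>|\<Omega>. \<Psi> (pair_map n z \<omega>)) \<in> borel_measurable borel"
proof -
  interpret Q: pair_prob_space \<Omega> "\<pi> \<Otimes>\<^sub>M \<pi>" ..
  define \<Phi> where "\<Phi> z = \<phi> (fst z) * \<phi> (snd z)" for z
  have [measurable]: "\<Phi> \<in> borel_measurable borel" "\<Psi> \<in> borel_measurable borel"
    unfolding \<Phi>_def \<Psi>_def borel_pair by measurable
  have Gm: "(\<lambda>z. LINT \<omega>|\<Omega>. \<Psi> (pair_map n z \<omega>)) \<in> borel_measurable borel"
    by (rule \<Omega>.borel_measurable_lebesgue_integral) (simp add: case_prod_unfold)
  then show "(\<lambda>z. LINT \<omega>|\<Omega>. \<Psi> (pair_map n z \<omega>)) \<in> borel_measurable borel" .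
  have \<Phi>b: "\<bar>\<Phi> z\<bar> \<le> 1" and \<Psi>b: "\<bar>\<Psi> z\<bar> \<le> 1" for z
    using mult_mono[OF bd(1)[of "fst z"] bd(1)[of "snd z"]] mult_mono[OF bd(2)[of "fst z"] bd(2)[of "snd z"]]
    by (simp_all add: \<Phi>_def \<Psi>_def abs_mult)
  have sndm: "snd \<in> \<Omega> \<Otimes>\<^sub>M (\<pi> \<Otimes>\<^sub>M \<pi>) \<rightarrow>\<^sub>M borel"
    using measurable_snd[of \<Omega> "\<pi> \<Otimes>\<^sub>M \<pi>"] by (simp only: measurable_cong_sets[OF refl sets_\<pi>\<pi>])
  have Fm: "(\<lambda>p. \<Phi> (snd p) * \<Psi> (pair_map n (snd p) (fst p))) \<in> borel_measurable (\<Omega> \<Otimes>\<^sub>M (\<pi> \<Otimes>\<^sub>M \<pi>))"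
    using measurable_compose[OF sndm \<open>\<Phi> \<in> borel_measurable borel\<close>]
      measurable_compose[OF pair_map_measurable[OF sndm measurable_fst] \<open>\<Psi> \<in> borel_measurable borel\<close>]
    by (rule borel_measurable_times)
  have Fi: "integrable (\<Omega> \<Otimes>\<^sub>M (\<pi> \<Otimes>\<^sub>M \<pi>)) (\<lambda>(\<omega>, z). \<Phi> z * \<Psi> (pair_map n z \<omega>))"
  proof (rule Q.integrable_const_bound[where B=1])
    show "AE p in \<Omega> \<Otimes>\<^sub>M (\<pi> \<Otimes>\<^sub>M \<pi>). norm (case p of (\<omega>, z) \<Rightarrow> \<Phi> z * \<Psi> (pair_map n z \<omega>)) \<le> 1"
    proof (intro AE_I2, clarsimp)
      fix \<omega> and a b
      show "\<bar>\<Phi> (a, b) * \<Psi> (pair_map n (a, b) \<omega>)\<bar> \<le> 1"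
        using mult_mono[OF \<Phi>b[of "(a, b)"] \<Psi>b[of "pair_map n (a, b) \<omega>"]] by (simp add: abs_mult)
    qed
  qed (use Fm in \<open>simp add: case_prod_unfold\<close>)
  have "(LINT \<omega>|\<Omega>. (correlation \<phi> \<psi> n \<omega>)\<^sup>2) = (LINT \<omega>|\<Omega>. LINT z|(\<pi> \<Otimes>\<^sub>M \<pi>). \<Phi> z * \<Psi> (pair_map n z \<omega>))"
    by (simp add: correlation_square[OF assms(1-4)] \<Phi>_def \<Psi>_def)
  also have "\<dots> = (LINT z|(\<pi> \<Otimes>\<^sub>M \<pi>). LINT \<omega>|\<Omega>. \<Phi> z * \<Psi> (pair_map n z \<omega>))"
    by (rule Q.Fubini_integral[OF Fi, symmetric])
  also have "\<dots> = (LINT z|(\<pi> \<Otimes>\<^sub>M \<pi>). \<Phi> z * (LINT \<omega>|\<Omega>. \<Psi> (pair_map n z \<omega>)))"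
    by simp
  also have "\<dots> \<le> (LINT z|(\<pi> \<Otimes>\<^sub>M \<pi>). \<bar>LINT \<omega>|\<Omega>. \<Psi> (pair_map n z \<omega>)\<bar>)"
  proof (rule integral_mono)
    have le1: "\<bar>LINT \<omega>|\<Omega>. \<Psi> (pair_map n z \<omega>)\<bar> \<le> 1" for z
    proof -
      have "\<bar>LINT \<omega>|\<Omega>. \<Psi> (pair_map n z \<omega>)\<bar> \<le> (LINT \<omega>|\<Omega>. \<bar>\<Psi> (pair_map n z \<omega>)\<bar>)" by (rule integral_abs_bound)
      also have "\<dots> \<le> (LINT \<omega>|\<Omega>. 1)"
        by (rule integral_mono_AE') (use \<Psi>b in auto)
      finally show ?thesis using \<Omega>.prob_space by simp
    qed
    have Gm': "(\<lambda>z. LINT \<omega>|\<Omega>. \<Psi> (pair_map n z \<omega>)) \<in> borel_measurable (\<pi> \<Otimes>\<^sub>M \<pi>)"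
      unfolding measurable_cong_sets[OF sets_\<pi>\<pi> refl] by (rule Gm)
    have \<Phi>m: "\<Phi> \<in> borel_measurable (\<pi> \<Otimes>\<^sub>M \<pi>)"
      unfolding measurable_cong_sets[OF sets_\<pi>\<pi> refl] by measurable
    have Gi: "integrable (\<pi> \<Otimes>\<^sub>M \<pi>) (\<lambda>z. LINT \<omega>|\<Omega>. \<Psi> (pair_map n z \<omega>))"
      by (rule \<pi>\<pi>.integrable_const_bound[where B=1, OF _ Gm']) (use le1 in auto)
    then show "integrable (\<pi> \<Otimes>\<^sub>M \<pi>) (\<lambda>z. \<bar>LINT \<omega>|\<Omega>. \<Psi> (pair_map n z \<omega>)\<bar>)" by (rule integrable_abs)
    fix z
    have "\<bar>\<Phi> z * (LINT \<omega>|\<Omega>. \<Psi> (pair_map n z \<omega>))\<bar> \<le> \<bar>LINT \<omega>|\<Omega>. \<Psi> (pair_map n z \<omega>)\<bar>" for z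
      using mult_right_mono[OF \<Phi>b[of z], of "\<bar>LINT \<omega>|\<Omega>. \<Psi> (pair_map n z \<omega>)\<bar>"] by (simp add: abs_mult)
    note b = this
    show "integrable (\<pi> \<Otimes>\<^sub>M \<pi>) (\<lambda>z. \<Phi> z * (LINT \<omega>|\<Omega>. \<Psi> (pair_map n z \<omega>)))"
      by (rule Bochner_Integration.integrable_bound[OF Gi borel_measurable_times[OF \<Phi>m Gm']]) (use b in auto)
    show "\<Phi> z * (LINT \<omega>|\<Omega>. \<Psi> (pair_map n z \<omega>)) \<le> \<bar>LINT \<omega>|\<Omega>. \<Psi> (pair_map n z \<omega>)\<bar>"
      using b[of z] by linarith
  qed
  also have "\<dots> = (LINT z|pair_law. \<bar>LINT \<omega>|\<Omega>. \<Psi> (pair_map n z \<omega>)\<bar>)"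
    by (rule integral_pair_law[symmetric]) (use Gm in measurable)
  finally show "(LINT \<omega>|\<Omega>. (correlation \<phi> \<psi> n \<omega>)\<^sup>2) \<le> (LINT z|pair_law. \<bar>LINT \<omega>|\<Omega>. \<Psi> (pair_map n z \<omega>)\<bar>)" .
qed

lemma correlation_bound:
  assumes [measurable]: "\<phi> \<in> borel_measurable borel" "\<psi> \<in> borel_measurable borel"
    and bd: "\<And>x. \<bar>\<phi> x\<bar> \<le> 1" "\<And>x. \<bar>\<psi> x\<bar> \<le> 1"
  shows "\<bar>correlation \<phi> \<psi> n \<omega>\<bar> \<le> 1"
proof -
  have "\<bar>correlation \<phi> \<psi> n \<omega>\<bar> \<le> (LINT x|\<pi>. \<bar>\<phi> x * \<psi> (rds f n \<omega> x)\<bar>)"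
    unfolding correlation_def by (rule integral_abs_bound)
  also have "\<dots> \<le> (LINT x|\<pi>. 1)"
  proof (rule integral_mono')
    fix x
    show "\<bar>\<phi> x * \<psi> (rds f n \<omega> x)\<bar> \<le> 1"
      using mult_mono[OF bd(1)[of x] bd(2)[of "rds f n \<omega> x"]] by (simp add: abs_mult)
  qed auto
  also have "\<dots> = 1" using \<pi>.prob_space by simp
  finally show ?thesis .
qed

text \<open>Since 1 \<le> V, the bounded function \<Psi> has weighted norm at most 1, and its mean
  under the stationary measure is the square of the mean of \<psi>, hence 0. So the semigroup makes
  it decay at a rate proportional to \<open>V\<close>, and integration over \<open>pair_law\<close>
  turns this into a uniform rate.\<close>

lemma second_moment_decay:
  assumes ge: "geometrically_ergodic off_diagonal_borel V K2 \<mu>"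
  obtains C \<gamma> where "C \<ge> 1" "0 < \<gamma>" "\<gamma> < 1"
    "\<And>n. \<forall>\<phi>\<in>borel_measurable borel. \<forall>\<psi>\<in>borel_measurable borel. (\<forall>x. \<bar>\<phi> x\<bar> \<le> 1) \<longrightarrow>
      (\<forall>x. \<bar>\<psi> x\<bar> \<le> 1) \<longrightarrow> (LINT x|\<pi>. \<psi> x) = 0 \<longrightarrow> (LINT \<omega>|\<Omega>. (correlation \<phi> \<psi> n \<omega>)\<^sup>2) \<le> C * \<gamma> ^ n"
proof -
  obtain C0 \<gamma> where mk: "markov_kernel off_diagonal_borel K2"
    and V1: "\<And>z. z \<in> space off_diagonal_borel \<Longrightarrow> 1 \<le> V z"
    and uniq: "\<And>\<nu>. stationary off_diagonal_borel K2 \<nu> \<Longrightarrow> \<nu> = \<mu>" and C0: "0 < C0" and \<gamma>: "0 < \<gamma>" "\<gamma> < 1"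
    and est: "\<And>h z n. h \<in> borel_measurable off_diagonal_borel \<Longrightarrow>
      bdd_above ((\<lambda>x. \<bar>h x\<bar> / V x) ` space off_diagonal_borel) \<Longrightarrow> z \<in> space off_diagonal_borel \<Longrightarrow> 1 \<le> n \<Longrightarrow>
      \<bar>(LINT y|kernel_pow off_diagonal_borel K2 n z. h y) - (LINT y|\<mu>. h y)\<bar>
        \<le> C0 * V z * weighted_norm off_diagonal_borel V h * \<gamma> ^ n"
    by (rule geometrically_ergodicE[OF ge]) (rule that)
  have \<mu>: "\<mu> = pair_law" using uniq[OF stationary_pair_law[OF mk]] ..
  obtain B where B: "B \<ge> 0" and B': "\<forall>h\<in>borel_measurable off_diagonal_borel.
     (\<forall>z\<in>off_diagonal. 0 \<le> h z \<and> h z \<le> V z) \<longrightarrow> (LINT z|pair_law. h z) \<le> B"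
    using geometrically_ergodic_integral_bounded[OF ge] unfolding \<mu> space_off_diagonal_borel by blast
  have Bint: "\<And>h. h \<in> borel_measurable off_diagonal_borel \<Longrightarrow>
     (\<And>z. z \<in> off_diagonal \<Longrightarrow> 0 \<le> h z \<and> h z \<le> V z) \<Longrightarrow> (LINT z|pair_law. h z) \<le> B"
    using B' by blast
  define C where "C = max 1 (C0 * B)"
  have "(LINT \<omega>|\<Omega>. (correlation \<phi> \<psi> n \<omega>)\<^sup>2) \<le> C * \<gamma> ^ n"
    if [measurable]: "\<phi> \<in> borel_measurable borel" "\<psi> \<in> borel_measurable borel"
      and bd: "\<And>x. \<bar>\<phi> x\<bar> \<le> 1" "\<And>x. \<bar>\<psi> x\<bar> \<le> 1" and mean: "(LINT x|\<pi>. \<psi> x) = 0" for \<phi> \<psi> n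
  proof (cases "n = 0")
    case True
    \<comment> \<open>The ergodicity estimate starts at \<open>n = 1\<close>; time 0 is covered by
      the trivial bound and the 1 in the maximum defining \<open>C\<close>.\<close>
    have "(LINT \<omega>|\<Omega>. (correlation \<phi> \<psi> n \<omega>)\<^sup>2) \<le> (LINT \<omega>|\<Omega>. 1)"
      by (rule integral_mono') (use correlation_bound[OF that(1,2) bd, of n] in \<open>auto simp: abs_square_le_1\<close>)
    also have "\<dots> \<le> C" using \<Omega>.prob_space by (simp add: C_def)
    finally show ?thesis using True by simp
  next
    case False
    define \<Psi> where "\<Psi> z = \<psi> (fst z) * \<psi> (snd z)" for z
    define G where "G z = \<bar>LINT \<omega>|\<Omega>. \<Psi> (pair_map n z \<omega>)\<bar>" for z
    have \<Psi>m: "\<Psi> \<in> borel_measurable borel" unfolding \<Psi>_def borel_pair by measurable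
    then have \<Psi>m': "\<Psi> \<in> borel_measurable off_diagonal_borel"
      unfolding off_diagonal_borel_def by (rule measurable_restrict_space1)
    have \<Psi>b: "\<bar>\<Psi> z\<bar> \<le> 1" for z
      using mult_mono[OF bd(2)[of "fst z"] bd(2)[of "snd z"]] by (simp add: \<Psi>_def abs_mult)
    have ratio: "\<bar>\<Psi> z\<bar> / V z \<le> 1" if "z \<in> off_diagonal" for z
      using V1[of z] \<Psi>b[of z] that by simp
    have bdd: "bdd_above ((\<lambda>x. \<bar>\<Psi> x\<bar> / V x) ` space off_diagonal_borel)"
      by (rule bdd_aboveI2[where M=1]) (simp add: ratio)
    have \<Psi>0: "(LINT z|\<mu>. \<Psi> z) = 0"
    proof -
      have "(LINT z|\<mu>. \<Psi> z) = (LINT z|(\<pi> \<Otimes>\<^sub>M \<pi>). \<Psi> z)"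
        unfolding \<mu> by (rule integral_pair_law[OF \<Psi>m])
      also have "\<dots> = (LINT x|\<pi>. LINT y|\<pi>. \<Psi> (x, y))"
      proof (rule \<pi>\<pi>.integral_fst'[symmetric], rule \<pi>\<pi>.integrable_const_bound[where B=1])
        show "\<Psi> \<in> borel_measurable (\<pi> \<Otimes>\<^sub>M \<pi>)"
          unfolding measurable_cong_sets[OF sets_\<pi>\<pi> refl] by (rule \<Psi>m)
      qed (use \<Psi>b in auto)
      also have "\<dots> = 0" by (simp add: \<Psi>_def mean)
      finally show ?thesis .
    qed
    have Gle: "G z \<le> C0 * V z * \<gamma> ^ n" if z: "z \<in> off_diagonal" for z
    proof -
      have wn: "weighted_norm off_diagonal_borel V \<Psi> \<le> 1"
        unfolding weighted_norm_def by (rule cSUP_least) (use z ratio in auto)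
      have "G z \<le> C0 * V z * weighted_norm off_diagonal_borel V \<Psi> * \<gamma> ^ n"
        using est[OF \<Psi>m' bdd, of z n] z False
        by (simp add: G_def \<Psi>0 integral_kernel_pow[OF mk z \<Psi>m])
      also have "\<dots> \<le> C0 * V z * 1 * \<gamma> ^ n"
        using wn C0 V1[of z] z \<gamma> by (intro mult_right_mono mult_left_mono) auto
      finally show ?thesis by simp
    qed
    note sm = second_moment_bound[OF that(1,2) bd, of n, folded \<Psi>_def]
    have Gm: "G \<in> borel_measurable borel"
      unfolding G_def using sm(2) by (intro borel_measurable_abs) (simp add: \<Psi>_def)
    have pos: "C0 * \<gamma> ^ n > 0" using C0 \<gamma> by simp
    \<comment> \<open>After division by the rate, \<open>G\<close> is a measurable function below
      \<open>V\<close>, so its integral is at most \<open>B\<close>.\<close>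
    have "(LINT z|pair_law. G z / (C0 * \<gamma> ^ n)) \<le> B"
    proof (rule Bint)
      show "(\<lambda>z. G z / (C0 * \<gamma> ^ n)) \<in> borel_measurable off_diagonal_borel"
        unfolding off_diagonal_borel_def using Gm by (intro measurable_restrict_space1) auto
      fix z :: "'m \<times> 'm" assume "z \<in> off_diagonal"
      from Gle[OF this] pos show "0 \<le> G z / (C0 * \<gamma> ^ n) \<and> G z / (C0 * \<gamma> ^ n) \<le> V z"
        by (simp add: G_def divide_le_eq mult_ac)
    qed
    then have "(LINT z|pair_law. G z) \<le> C0 * B * \<gamma> ^ n"
      using pos by (simp add: divide_le_eq mult_ac)
    also have "\<dots> \<le> C * \<gamma> ^ n" using \<gamma> by (intro mult_right_mono) (auto simp: C_def)
    finally show ?thesis using sm(1) by (simp add: G_def \<Psi>_def)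
  qed
  note main = this
  show thesis
  proof (rule that[OF _ \<gamma>])
    show "1 \<le> C" by (simp add: C_def)
  qed (use main in blast)
qed

end

section \<open>Quenched decay of correlations\<close>

text \<open>Either of the bounds \<open>a\<close> and \<open>b\<close> may be 0, so the optimal
  weight in the arithmetic-geometric mean inequality is formed from \<open>a + e\<close> and
  \<open>b + e\<close>, and \<open>e\<close> tends to 0 afterwards.\<close>

lemma cauchy_schwarz_integral:
  fixes g h :: "'a \<Rightarrow> real"
  assumes [measurable]: "g \<in> borel_measurable N" "h \<in> borel_measurable N"
    and g: "integrable N (\<lambda>x. (g x)\<^sup>2)" "(LINT x|N. (g x)\<^sup>2) \<le> a\<^sup>2" "0 \<le> a"
    and h: "integrable N (\<lambda>x. (h x)\<^sup>2)" "(LINT x|N. (h x)\<^sup>2) \<le> b\<^sup>2" "0 \<le> b"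
  shows "\<bar>LINT x|N. g x * h x\<bar> \<le> a * b"
proof -
  have *: "\<bar>LINT x|N. g x * h x\<bar> \<le> (a + e) * (b + e)" if e: "e > 0" for e
  proof -
    define t where "t = (b + e) / (a + e)"
    have t: "t > 0" using e g h by (simp add: t_def add_nonneg_pos)
    have ae: "a + e > 0" "b + e > 0" using e g(3) h(3) by auto
    have le: "\<bar>g x * h x\<bar> \<le> t / 2 * (g x)\<^sup>2 + 1 / (2 * t) * (h x)\<^sup>2" for x
    proof -
      have "0 \<le> (t * \<bar>g x\<bar> - \<bar>h x\<bar>)\<^sup>2 / (2 * t)" using t by simp
      also have "(t * \<bar>g x\<bar> - \<bar>h x\<bar>)\<^sup>2 = t\<^sup>2 * (g x)\<^sup>2 - 2 * t * \<bar>g x * h x\<bar> + (h x)\<^sup>2"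
        by (simp add: power2_diff abs_mult power_mult_distrib)
      also have "\<dots> / (2 * t) = t / 2 * (g x)\<^sup>2 + 1 / (2 * t) * (h x)\<^sup>2 - \<bar>g x * h x\<bar>"
        using t by (simp add: add_divide_distrib diff_divide_distrib power2_eq_square)
      finally show ?thesis by simp
    qed
    have "\<bar>LINT x|N. g x * h x\<bar> \<le> (LINT x|N. \<bar>g x * h x\<bar>)" by (rule integral_abs_bound)
    also have "\<dots> \<le> (LINT x|N. t / 2 * (g x)\<^sup>2 + 1 / (2 * t) * (h x)\<^sup>2)"
      by (rule integral_mono'[OF _ le]) (use g h t in auto)
    also have "\<dots> = t / 2 * (LINT x|N. (g x)\<^sup>2) + 1 / (2 * t) * (LINT x|N. (h x)\<^sup>2)"
      using g h by simp
    also have "\<dots> \<le> t / 2 * (a + e)\<^sup>2 + 1 / (2 * t) * (b + e)\<^sup>2"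
    proof -
      have "a\<^sup>2 \<le> (a + e)\<^sup>2" "b\<^sup>2 \<le> (b + e)\<^sup>2" using e g h by (auto intro: power_mono)
      then show ?thesis using t g(2) h(2) by (intro add_mono mult_left_mono) auto
    qed
    also have "\<dots> = (a + e) * (b + e)"
    proof -
      have "d / c / 2 * c\<^sup>2 + 1 / (2 * (d / c)) * d\<^sup>2 = c * d" if "c > 0" "d > 0" for c d :: real
        using that by (simp add: field_simps power2_eq_square)
      from this[OF ae] show ?thesis unfolding t_def .
    qed
    finally show ?thesis .
  qed
  have "((\<lambda>e. (a + e) * (b + e)) \<longlongrightarrow> (a + 0) * (b + 0)) (at_right 0)"
    by (intro tendsto_intros)
  moreover have "eventually (\<lambda>e. \<bar>LINT x|N. g x * h x\<bar> \<le> (a + e) * (b + e)) (at_right 0)"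
    using * by (auto simp: eventually_at_right_less intro: eventually_mono[OF eventually_at_right_less])
  ultimately have "\<bar>LINT x|N. g x * h x\<bar> \<le> (a + 0) * (b + 0)"
    by (intro tendsto_lowerbound) auto
  then show ?thesis by simp
qed

lemma (in prob_space) abs_expectation_le_L2:
  fixes r :: "'a \<Rightarrow> real"
  assumes "r \<in> borel_measurable M" "integrable M (\<lambda>x. (r x)\<^sup>2)" "(LINT x|M. (r x)\<^sup>2) \<le> a\<^sup>2" "0 \<le> a"
  shows "\<bar>LINT x|M. r x\<bar> \<le> a"
  using cauchy_schwarz_integral[of r M "\<lambda>_. 1" a 1] assms prob_space by simp

lemma (in prob_space) integrable_of_square_integrable:
  fixes r :: "'a \<Rightarrow> real"
  assumes "r \<in> borel_measurable M" "integrable M (\<lambda>x. (r x)\<^sup>2)"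
  shows "integrable M r"
  using integrable_mult_L2[of r M "\<lambda>_. 1"] assms by simp

text \<open>With the step functions \<open>g\<close> and \<open>h\<close> the integrand is the
  product for \<open>g\<close> and \<open>h\<close>, plus two mixed terms, minus the product of the
  errors. The step functions are not centred, so the product of their means appears besides the
  centred correlations of indicators. Together with the product of the errors it accounts for the
  term \<open>2 * \<rho> * \<rho>'\<close>.\<close>

lemma (in prob_space) abs_correlation_split:
  fixes \<phi> \<psi> r r' :: "'a \<Rightarrow> real" and E :: "'i \<Rightarrow> 'a set"
  assumes T [measurable]: "T \<in> M \<rightarrow>\<^sub>M M" and pres: "distr M M T = M"
    and [measurable]: "\<phi> \<in> borel_measurable M" "\<psi> \<in> borel_measurable M"
    and \<phi>2: "integrable M (\<lambda>x. (\<phi> x)\<^sup>2)" "(LINT x|M. (\<phi> x)\<^sup>2) \<le> F\<^sup>2" "0 \<le> F"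
    and \<psi>2: "integrable M (\<lambda>x. (\<psi> x)\<^sup>2)" "(LINT x|M. (\<psi> x)\<^sup>2) \<le> G\<^sup>2" "0 \<le> G"
    and mean: "(LINT x|M. \<phi> x) = 0" "(LINT x|M. \<psi> x) = 0"
    and I: "finite I" and E: "\<And>i. i \<in> I \<Longrightarrow> E i \<in> sets M"
    and a: "\<And>i. i \<in> I \<Longrightarrow> \<bar>a i\<bar> \<le> A" and a': "\<And>i. i \<in> I \<Longrightarrow> \<bar>a' i\<bar> \<le> A'" and A: "0 \<le> A" "0 \<le> A'"
    and r_def: "\<And>x. r x = \<phi> x - (\<Sum>i\<in>I. a i * indicator (E i) x)"
    and r'_def: "\<And>x. r' x = \<psi> x - (\<Sum>i\<in>I. a' i * indicator (E i) x)"
    and r: "integrable M (\<lambda>x. (r x)\<^sup>2)" "(LINT x|M. (r x)\<^sup>2) \<le> \<rho>\<^sup>2" "0 \<le> \<rho>"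
    and r': "integrable M (\<lambda>x. (r' x)\<^sup>2)" "(LINT x|M. (r' x)\<^sup>2) \<le> \<rho>'\<^sup>2" "0 \<le> \<rho>'"
  shows "\<bar>LINT x|M. \<phi> x * \<psi> (T x)\<bar> \<le>
    A * A' * (\<Sum>(i, j)\<in>I \<times> I. \<bar>LINT x|M. indicator (E i) x * (indicator (E j) (T x) - measure M (E j))\<bar>)
      + 2 * \<rho> * \<rho>' + F * \<rho>' + \<rho> * G"
proof -
  have Em: "indicat_real (E i) \<in> borel_measurable M" if "i \<in> I" for i using E[OF that] by simp
  have rm [measurable]: "r \<in> borel_measurable M" "r' \<in> borel_measurable M"
    unfolding r_def r'_def
    by (intro borel_measurable_diff borel_measurable_sum borel_measurable_times borel_measurable_const Em; simp)+
  have comp_int: "integrable M (\<lambda>x. k (T x))" and comp: "(LINT x|M. k (T x)) = (LINT x|M. k x)"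
    if "integrable M k" for k :: "'a \<Rightarrow> real"
  proof -
    have km: "k \<in> borel_measurable M" using that by simp
    have "integrable (distr M M T) k" using that by (simp add: pres)
    then show "integrable M (\<lambda>x. k (T x))" using km by (subst (asm) integrable_distr_eq) auto
    show "(LINT x|M. k (T x)) = (LINT x|M. k x)"
      using integral_distr[OF T km] by (simp add: pres)
  qed
  note \<psi>T = comp_int[OF \<psi>2(1)] and r'T = comp_int[OF r'(1)]
  define g where "g x = (\<Sum>i\<in>I. a i * indicator (E i) x)" for x
  define h where "h x = (\<Sum>i\<in>I. a' i * indicator (E i) x)" for x
  have i1: "integrable M (\<lambda>x. \<phi> x * \<psi> (T x))" "integrable M (\<lambda>x. \<phi> x * r' (T x))"
    "integrable M (\<lambda>x. r x * \<psi> (T x))" "integrable M (\<lambda>x. r x * r' (T x))"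
    by (intro integrable_mult_L2 \<phi>2 r \<psi>T r'T; measurable)+
  have b: "\<bar>LINT x|M. \<phi> x * r' (T x)\<bar> \<le> F * \<rho>'" "\<bar>LINT x|M. r x * \<psi> (T x)\<bar> \<le> \<rho> * G"
    "\<bar>LINT x|M. r x * r' (T x)\<bar> \<le> \<rho> * \<rho>'"
    by (intro cauchy_schwarz_integral \<phi>2 r \<psi>T r'T \<psi>2 r'; (measurable)?; simp add: comp[OF \<psi>2(1)] comp[OF r'(1)] \<psi>2 r')+
  have Eint: "integrable M (\<lambda>x. indicat_real (E i) x)" if "i \<in> I" for i
    using E[OF that] by (simp add: integrable_indicator_iff emeasure_finite less_top[symmetric])
  have sq: "(indicat_real S y)\<^sup>2 = indicat_real S y" for S and y :: 'a
    by (simp add: indicator_def)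
  have EEint: "integrable M (\<lambda>x. indicat_real (E i) x * indicator (E j) (T x))" if "i \<in> I" "j \<in> I" for i j
  proof (rule integrable_mult_L2)
    show "integrable M (\<lambda>x. (indicat_real (E j) (T x))\<^sup>2)"
      unfolding sq by (rule comp_int[OF Eint[OF that(2)]])
    show "integrable M (\<lambda>x. (indicat_real (E i) x)\<^sup>2)"
      unfolding sq by (rule Eint[OF that(1)])
    show "indicat_real (E i) \<in> borel_measurable M" by (rule Em[OF that(1)])
    show "(\<lambda>x. indicat_real (E j) (T x)) \<in> borel_measurable M"
      by (rule measurable_compose[OF T Em[OF that(2)]])
  qed
  have Z: "(LINT x|M. indicator (E i) x * (indicator (E j) (T x) - measure M (E j))) =
      (LINT x|M. indicat_real (E i) x * indicator (E j) (T x)) - measure M (E i) * measure M (E j)"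
    if "i \<in> I" "j \<in> I" for i j
    using EEint[OF that] Eint[OF that(1)] E[OF that(1)] by (simp add: right_diff_distrib)
  have gint: "(LINT x|M. g x) = (\<Sum>i\<in>I. a i * measure M (E i))"
    unfolding g_def using Eint E by (subst Bochner_Integration.integral_sum) auto
  have hint: "(LINT x|M. h x) = (\<Sum>i\<in>I. a' i * measure M (E i))"
    unfolding h_def using Eint E by (subst Bochner_Integration.integral_sum) auto
  \<comment> \<open>The observable is centred, so the mean of the step function is minus the mean of
    the error, which its L2 norm bounds.\<close>
  have g0: "\<bar>LINT x|M. g x\<bar> \<le> \<rho>"
  proof -
    have "(LINT x|M. g x) = (LINT x|M. \<phi> x - r x)" by (simp add: r_def g_def)
    also have "\<dots> = - (LINT x|M. r x)"
      using mean integrable_of_square_integrable[OF _ \<phi>2(1)] integrable_of_square_integrable[OF _ r(1)] by simp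
    finally show ?thesis using abs_expectation_le_L2[OF _ r] by simp
  qed
  have h0: "\<bar>LINT x|M. h x\<bar> \<le> \<rho>'"
  proof -
    have "(LINT x|M. h x) = (LINT x|M. \<psi> x - r' x)" by (simp add: r'_def h_def)
    also have "\<dots> = - (LINT x|M. r' x)"
      using mean integrable_of_square_integrable[OF _ \<psi>2(1)] integrable_of_square_integrable[OF _ r'(1)] by simp
    finally show ?thesis using abs_expectation_le_L2[OF _ r'] by simp
  qed
  define Z where "Z i j = (LINT x|M. indicator (E i) x * (indicator (E j) (T x) - measure M (E j)))" for i j
  have Zv: "Z i j = (LINT x|M. indicat_real (E i) x * indicator (E j) (T x)) - measure M (E i) * measure M (E j)"
    if "i \<in> I" "j \<in> I" for i j
    unfolding Z_def by (rule Z[OF that])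
  have gh: "(\<lambda>x. g x * h (T x)) = (\<lambda>x. \<Sum>i\<in>I. \<Sum>j\<in>I. a i * a' j * (indicat_real (E i) x * indicator (E j) (T x)))"
    by (simp add: fun_eq_iff g_def h_def sum_product mult_ac)
  have "(LINT x|M. g x * h (T x)) = (\<Sum>i\<in>I. \<Sum>j\<in>I. a i * a' j * (LINT x|M. indicat_real (E i) x * indicator (E j) (T x)))"
    unfolding gh using EEint
    by (subst Bochner_Integration.integral_sum, (intro Bochner_Integration.integrable_sum integrable_mult_right; simp), 
        intro sum.cong refl, subst Bochner_Integration.integral_sum) auto
  also have "\<dots> = (\<Sum>i\<in>I. \<Sum>j\<in>I. a i * a' j * Z i j + (a i * measure M (E i)) * (a' j * measure M (E j)))"
    by (intro sum.cong refl) (simp add: Zv algebra_simps)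
  also have "\<dots> = (\<Sum>i\<in>I. \<Sum>j\<in>I. a i * a' j * Z i j) + (LINT x|M. g x) * (LINT x|M. h x)"
    unfolding gint hint sum_product by (simp add: sum.distrib)
  finally have ghint: "(LINT x|M. g x * h (T x)) = \<dots>" .
  have "\<bar>\<Sum>i\<in>I. \<Sum>j\<in>I. a i * a' j * Z i j\<bar> \<le> (\<Sum>i\<in>I. \<Sum>j\<in>I. A * A' * \<bar>Z i j\<bar>)"
  proof -
    have "\<bar>\<Sum>i\<in>I. \<Sum>j\<in>I. a i * a' j * Z i j\<bar> \<le> (\<Sum>i\<in>I. \<bar>\<Sum>j\<in>I. a i * a' j * Z i j\<bar>)" by (rule sum_abs)
    also have "\<dots> \<le> (\<Sum>i\<in>I. \<Sum>j\<in>I. \<bar>a i * a' j * Z i j\<bar>)" by (intro sum_mono sum_abs)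
    also have "\<dots> \<le> (\<Sum>i\<in>I. \<Sum>j\<in>I. A * A' * \<bar>Z i j\<bar>)"
      unfolding abs_mult by (intro sum_mono mult_right_mono mult_mono a a') (use A in auto)
    finally show ?thesis .
  qed
  also have "\<dots> = A * A' * (\<Sum>(i, j)\<in>I \<times> I. \<bar>Z i j\<bar>)"
    by (simp add: sum.cartesian_product sum_distrib_left case_prod_unfold)
  finally have main: "\<bar>\<Sum>i\<in>I. \<Sum>j\<in>I. a i * a' j * Z i j\<bar> \<le> A * A' * (\<Sum>(i, j)\<in>I \<times> I. \<bar>Z i j\<bar>)" .
  have ghi: "integrable M (\<lambda>x. g x * h (T x))"
    unfolding gh using EEint by (intro Bochner_Integration.integrable_sum integrable_mult_right) auto
  \<comment> \<open>The mixed terms keep the full observables and count the product of the errors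
    once too often, whence the subtraction.\<close>
  have "(LINT x|M. \<phi> x * \<psi> (T x)) = (LINT x|M. g x * h (T x) + \<phi> x * r' (T x) + r x * \<psi> (T x) - r x * r' (T x))"
    by (intro Bochner_Integration.integral_cong refl) (simp add: r_def r'_def g_def[symmetric] h_def[symmetric] algebra_simps)
  also have "\<dots> = (LINT x|M. g x * h (T x)) + (LINT x|M. \<phi> x * r' (T x)) + (LINT x|M. r x * \<psi> (T x)) - (LINT x|M. r x * r' (T x))"
    using ghi i1 by simp
  finally have split: "(LINT x|M. \<phi> x * \<psi> (T x)) = \<dots>" .
  have "\<bar>(LINT x|M. g x) * (LINT x|M. h x)\<bar> \<le> \<rho> * \<rho>'"
    unfolding abs_mult using g0 h0 r(3) by (intro mult_mono) auto
  then show ?thesis using main b unfolding split ghint Z_def by linarith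
qed

section \<open>Moments of correlation sums and a dominating random variable\<close>

context volume_preserving_rds
begin

text \<open>At most \<open>m\<^sup>2\<close> terms, each bounded by 1, give a deterministic bound
  \<open>m\<^sup>2\<close> for \<open>W\<close>. All but two of the \<open>k + 2\<close> factors are
  estimated by it; the remaining square goes through Cauchy-Schwarz to the second moments, each at
  most \<open>e\<close>. So a higher moment costs powers of \<open>m\<close> but keeps the
  rate.\<close>

lemma correlation_sum_moment:
  assumes decay: "\<forall>\<phi>\<in>borel_measurable borel. \<forall>\<psi>\<in>borel_measurable borel. (\<forall>x. \<bar>\<phi> x\<bar> \<le> 1) \<longrightarrow>
      (\<forall>x. \<bar>\<psi> x\<bar> \<le> 1) \<longrightarrow> (LINT x|\<pi>. \<psi> x) = 0 \<longrightarrow> (LINT \<omega>|\<Omega>. (correlation \<phi> \<psi> n \<omega>)\<^sup>2) \<le> e"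
    and I: "finite I" "real (card I) \<le> m" and E: "\<And>i. i \<in> I \<Longrightarrow> E i \<in> sets borel" and e: "0 \<le> e"
  defines "W \<equiv> \<lambda>\<omega>. \<Sum>(i, j)\<in>I \<times> I. \<bar>correlation (indicator (E i)) (\<lambda>x. indicator (E j) x - measure \<pi> (E j)) n \<omega>\<bar>"
  shows "W \<in> borel_measurable \<Omega>" "\<And>\<omega>. 0 \<le> W \<omega>" "integrable \<Omega> (\<lambda>\<omega>. W \<omega> ^ (k + 2))"
    "(LINT \<omega>|\<Omega>. W \<omega> ^ (k + 2)) \<le> (m\<^sup>2) ^ (k + 2) * e"
proof -
  define Z where "Z i j = correlation (indicator (E i)) (\<lambda>x. indicator (E j) x - measure \<pi> (E j)) n" for i j
  have W: "W \<omega> = (\<Sum>p\<in>I \<times> I. \<bar>Z (fst p) (snd p) \<omega>\<bar>)" for \<omega>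
    by (simp add: W_def Z_def case_prod_unfold)
  have ind: "indicat_real (E i) \<in> borel_measurable borel" if "i \<in> I" for i using E[OF that] by simp
  have cen: "(\<lambda>x. indicat_real (E i) x - measure \<pi> (E i)) \<in> borel_measurable borel" if "i \<in> I" for i
    using ind[OF that] by (intro borel_measurable_diff) auto
  have b1: "\<bar>indicat_real (E i) x\<bar> \<le> 1" for i x by (simp add: indicator_def)
  have b2: "\<bar>indicat_real (E i) x - measure \<pi> (E i)\<bar> \<le> 1" for i x
  proof -
    have p: "0 \<le> measure \<pi> (E i)" "measure \<pi> (E i) \<le> 1" by (rule measure_nonneg, rule \<pi>.prob_le_1)
    moreover have "0 \<le> indicat_real (E i) x" "indicat_real (E i) x \<le> 1" by (simp_all add: indicator_def)
    ultimately show ?thesis by linarith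
  qed
  have mean: "(LINT x|\<pi>. indicat_real (E i) x - measure \<pi> (E i)) = 0" if "i \<in> I" for i
  proof -
    have "integrable \<pi> (indicat_real (E i))" by (rule integrable_bounded_\<pi>[OF ind[OF that] b1])
    then show ?thesis using \<pi>.prob_space by simp
  qed
  have Zm: "Z i j \<in> borel_measurable \<Omega>" if "i \<in> I" "j \<in> I" for i j
    unfolding Z_def by (rule correlation_measurable[OF ind[OF that(1)] cen[OF that(2)]])
  have Zb: "\<bar>Z i j \<omega>\<bar> \<le> 1" if "i \<in> I" "j \<in> I" for i j \<omega>
    unfolding Z_def by (rule correlation_bound[OF ind[OF that(1)] cen[OF that(2)] b1 b2])
  have Ze: "(LINT \<omega>|\<Omega>. (Z i j \<omega>)\<^sup>2) \<le> e" if "i \<in> I" "j \<in> I" for i j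
    unfolding Z_def
    using decay[rule_format, OF ind[OF that(1)] cen[OF that(2)] b1 b2 mean[OF that(2)]] .
  have Zi: "integrable \<Omega> (\<lambda>\<omega>. (Z i j \<omega>)\<^sup>2)" if "i \<in> I" "j \<in> I" for i j
    by (rule \<Omega>.integrable_const_bound[where B=1])
      (use Zb[OF that] Zm[OF that] in \<open>auto simp: abs_square_le_1\<close>)
  show Wm: "W \<in> borel_measurable \<Omega>"
    unfolding W[abs_def] by (intro borel_measurable_sum borel_measurable_abs Zm) auto
  show W0: "0 \<le> W \<omega>" for \<omega> unfolding W by (intro sum_nonneg) auto
  have m0: "0 \<le> m" using I(2) by linarith
  have card: "real (card (I \<times> I)) \<le> m\<^sup>2"
    using I m0 by (simp add: card_cartesian_product power2_eq_square mult_mono)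
  have Wb: "W \<omega> \<le> m\<^sup>2" for \<omega>
  proof -
    have "W \<omega> \<le> (\<Sum>p\<in>I \<times> I. 1)" unfolding W by (intro sum_mono Zb) auto
    also have "\<dots> = real (card (I \<times> I))" by simp
    finally show ?thesis using card by linarith
  qed
  define S where "S \<omega> = (\<Sum>p\<in>I \<times> I. (Z (fst p) (snd p) \<omega>)\<^sup>2)" for \<omega>
  have S0: "0 \<le> S \<omega>" for \<omega> unfolding S_def by (intro sum_nonneg) auto
  have Si: "integrable \<Omega> S" unfolding S_def by (intro Bochner_Integration.integrable_sum Zi) auto
  have W2: "(W \<omega>)\<^sup>2 \<le> m\<^sup>2 * S \<omega>" for \<omega>
  proof -
    have "(W \<omega>)\<^sup>2 \<le> (\<Sum>p\<in>I \<times> I. \<bar>Z (fst p) (snd p) \<omega>\<bar>\<^sup>2) * real (card (I \<times> I))"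
      unfolding W by (rule sum_squared_le_sum_of_squares)
    also have "\<dots> = real (card (I \<times> I)) * S \<omega>" by (simp add: S_def mult.commute)
    also have "\<dots> \<le> m\<^sup>2 * S \<omega>" using card S0 by (intro mult_right_mono) auto
    finally show ?thesis .
  qed
  have le: "W \<omega> ^ (k + 2) \<le> (m\<^sup>2) ^ k * (m\<^sup>2 * S \<omega>)" for \<omega>
    unfolding power_add using W0[of \<omega>] by (intro mult_mono power_mono Wb W2) auto
  have bi: "integrable \<Omega> (\<lambda>\<omega>. (m\<^sup>2) ^ k * (m\<^sup>2 * S \<omega>))" using Si by (intro integrable_mult_right)
  show Wi: "integrable \<Omega> (\<lambda>\<omega>. W \<omega> ^ (k + 2))"
  proof (rule Bochner_Integration.integrable_bound[OF bi borel_measurable_power[OF Wm]], intro AE_I2)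
    fix \<omega>
    show "norm (W \<omega> ^ (k + 2)) \<le> norm ((m\<^sup>2) ^ k * (m\<^sup>2 * S \<omega>))"
      using le[of \<omega>] W0[of \<omega>] S0[of \<omega>] by (simp add: abs_mult)
  qed
  have "(LINT \<omega>|\<Omega>. W \<omega> ^ (k + 2)) \<le> (LINT \<omega>|\<Omega>. (m\<^sup>2) ^ k * (m\<^sup>2 * S \<omega>))"
    by (rule integral_mono[OF Wi bi le])
  also have "\<dots> = (m\<^sup>2) ^ k * (m\<^sup>2 * (LINT \<omega>|\<Omega>. S \<omega>))" by simp
  also have "(LINT \<omega>|\<Omega>. S \<omega>) = (\<Sum>p\<in>I \<times> I. LINT \<omega>|\<Omega>. (Z (fst p) (snd p) \<omega>)\<^sup>2)"
    unfolding S_def by (rule Bochner_Integration.integral_sum) (auto intro: Zi)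
  also have "(m\<^sup>2) ^ k * (m\<^sup>2 * \<dots>) \<le> (m\<^sup>2) ^ k * (m\<^sup>2 * (m\<^sup>2 * e))"
  proof (intro mult_left_mono)
    have "(\<Sum>p\<in>I \<times> I. LINT \<omega>|\<Omega>. (Z (fst p) (snd p) \<omega>)\<^sup>2) \<le> (\<Sum>p\<in>I \<times> I. e)"
      by (intro sum_mono Ze) auto
    also have "\<dots> = real (card (I \<times> I)) * e" by simp
    also have "\<dots> \<le> m\<^sup>2 * e" using card e by (intro mult_right_mono)
    finally show "(\<Sum>p\<in>I \<times> I. LINT \<omega>|\<Omega>. (Z (fst p) (snd p) \<omega>)\<^sup>2) \<le> m\<^sup>2 * e" .
  qed auto
  also have "\<dots> = (m\<^sup>2) ^ (k + 2) * e" by (simp add: power_add power2_eq_square)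
  finally show "(LINT \<omega>|\<Omega>. W \<omega> ^ (k + 2)) \<le> (m\<^sup>2) ^ (k + 2) * e" .
qed

text \<open>\<open>D\<close> is the \<open>\<ell>\<^sup>r\<close> norm of the sequence.\<close>

lemma dominating_random_variable:
  fixes X :: "nat \<Rightarrow> (nat \<Rightarrow> 'w) \<Rightarrow> real" and q :: real
  assumes X: "\<And>n. X n \<in> borel_measurable \<Omega>" "\<And>n \<omega>. 0 \<le> X n \<omega>" "\<And>n. integrable \<Omega> (\<lambda>\<omega>. X n \<omega> ^ r)"
    and le: "\<And>n. (LINT \<omega>|\<Omega>. X n \<omega> ^ r) \<le> c * \<kappa> ^ n" and \<kappa>: "0 \<le> \<kappa>" "\<kappa> < 1" and c: "0 \<le> c"
    and r: "r > 0" and q: "0 < q" "q \<le> real r"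
  obtains D where "D \<in> borel_measurable \<Omega>" "\<And>\<omega>. 1 \<le> D \<omega>" "integrable \<Omega> (\<lambda>\<omega>. D \<omega> powr q)"
    "AE \<omega> in \<Omega>. \<forall>n. X n \<omega> \<le> D \<omega>"
proof -
  define R where "R \<omega> = (\<Sum>n. ennreal (X n \<omega> ^ r))" for \<omega>
  note [measurable] = X(1)
  have [measurable]: "R \<in> borel_measurable \<Omega>" unfolding R_def by measurable
  have "(\<integral>\<^sup>+ \<omega>. R \<omega> \<partial>\<Omega>) = (\<Sum>n. \<integral>\<^sup>+ \<omega>. ennreal (X n \<omega> ^ r) \<partial>\<Omega>)"
    unfolding R_def by (rule nn_integral_suminf) measurable
  also have "\<dots> \<le> (\<Sum>n. ennreal (c * \<kappa> ^ n))"
  proof (rule suminf_le)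
    fix n
    have "(\<integral>\<^sup>+ \<omega>. ennreal (X n \<omega> ^ r) \<partial>\<Omega>) = ennreal (LINT \<omega>|\<Omega>. X n \<omega> ^ r)"
      by (rule nn_integral_eq_integral[OF X(3)]) (use X(2) in auto)
    also have "\<dots> \<le> ennreal (c * \<kappa> ^ n)" by (rule ennreal_leI[OF le])
    finally show "(\<integral>\<^sup>+ \<omega>. ennreal (X n \<omega> ^ r) \<partial>\<Omega>) \<le> ennreal (c * \<kappa> ^ n)" .
  qed auto
  also have "\<dots> = ennreal (\<Sum>n. c * \<kappa> ^ n)"
    by (rule suminf_ennreal2) (use c \<kappa> in \<open>auto intro!: summable_mult summable_geometric\<close>)
  also have "\<dots> < \<infinity>" by simp
  finally have Rfin: "(\<integral>\<^sup>+ \<omega>. R \<omega> \<partial>\<Omega>) < \<infinity>" .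
  then have AEfin: "AE \<omega> in \<Omega>. R \<omega> \<noteq> \<infinity>" by (intro nn_integral_noteq_infinite) auto
  \<comment> \<open>Where the series diverges, a null set, \<open>enn2real\<close> returns 0;
    \<open>D\<close> is 1 there, and the domination fails at most on this set.\<close>
  define Q where "Q \<omega> = enn2real (R \<omega>)" for \<omega>
  have Q0: "0 \<le> Q \<omega>" for \<omega> by (simp add: Q_def)
  have [measurable]: "Q \<in> borel_measurable \<Omega>" unfolding Q_def by measurable
  have Qi: "integrable \<Omega> Q"
  proof (rule integrableI_bounded)
    have "(\<integral>\<^sup>+ \<omega>. ennreal (norm (Q \<omega>)) \<partial>\<Omega>) \<le> (\<integral>\<^sup>+ \<omega>. R \<omega> \<partial>\<Omega>)"
      by (intro nn_integral_mono) (simp add: Q_def ennreal_enn2real_if)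
    then show "(\<integral>\<^sup>+ \<omega>. ennreal (norm (Q \<omega>)) \<partial>\<Omega>) < \<infinity>" using Rfin by (rule order.strict_trans1)
  qed measurable
  \<comment> \<open>The summand 1 secures 1 \<le> D without harming integrability; then
    \<open>q \<le> real r\<close> lets the \<open>q\<close>-th power be bounded by the
    \<open>r\<close>-th.\<close>
  define D where "D \<omega> = root r (1 + Q \<omega>)" for \<omega>
  have D1: "1 \<le> D \<omega>" for \<omega>
    unfolding D_def using Q0[of \<omega>] r real_root_ge_1_iff by auto
  have Dr: "D \<omega> ^ r = 1 + Q \<omega>" for \<omega>
    unfolding D_def using Q0[of \<omega>] r by (intro real_root_pow_pos2) auto
  have [measurable]: "D \<in> borel_measurable \<Omega>"
    unfolding D_def by (intro borel_measurable_continuous_on[where f="root r"] continuous_intros) measurable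
  have Di: "integrable \<Omega> (\<lambda>\<omega>. D \<omega> powr q)"
  proof (rule Bochner_Integration.integrable_bound)
    show "integrable \<Omega> (\<lambda>\<omega>. 1 + Q \<omega>)" using Qi by simp
    show "AE \<omega> in \<Omega>. norm (D \<omega> powr q) \<le> norm (1 + Q \<omega>)"
    proof (intro AE_I2)
      fix \<omega>
      have "D \<omega> powr q \<le> D \<omega> powr real r" using D1[of \<omega>] q by (intro powr_mono) auto
      also have "\<dots> = 1 + Q \<omega>" using D1[of \<omega>] by (simp add: powr_realpow Dr)
      finally show "norm (D \<omega> powr q) \<le> norm (1 + Q \<omega>)" by simp
    qed
  qed measurable
  have "AE \<omega> in \<Omega>. \<forall>n. X n \<omega> \<le> D \<omega>"
    using AEfin
  proof (eventually_elim, intro allI)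
    fix \<omega> n assume fin: "R \<omega> \<noteq> \<infinity>"
    have "ennreal (X n \<omega> ^ r) = (\<Sum>i\<in>{n}. ennreal (X i \<omega> ^ r))" by simp
    also have "\<dots> \<le> R \<omega>" unfolding R_def by (rule sum_le_suminf) auto
    also have "\<dots> = ennreal (Q \<omega>)" using fin by (simp add: Q_def less_top)
    finally have "X n \<omega> ^ r \<le> Q \<omega>" using Q0[of \<omega>] by (simp add: ennreal_le_iff)
    also have "\<dots> \<le> D \<omega> ^ r" by (simp add: Dr)
    finally have "X n \<omega> ^ Suc (r - 1) \<le> D \<omega> ^ Suc (r - 1)" using r by simp
    then show "X n \<omega> \<le> D \<omega>" by (rule power_le_imp_le_base) (use D1[of \<omega>] in linarith)
  qed
  with D1 Di show thesis by (intro that) auto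
qed

end

section \<open>Assembly of the quenched bound for an abstract class of observables\<close>

context volume_preserving_rds
begin

text \<open>The approximation property is assumed for every \<open>b > 1\<close> because the rate
  that can be afforded is known only once \<gamma> and \<open>q\<close> are fixed. The error rate
  \<theta> may depend on \<open>b\<close>; it affects only \<alpha>, not the moment bound.\<close>

lemma quenched_decay:
  fixes H :: "('m \<Rightarrow> real) set" and N :: "('m \<Rightarrow> real) \<Rightarrow> real" and q :: real
  assumes ge: "geometrically_ergodic off_diagonal_borel V K2 \<mu>" and q: "q > 0"
    and Hm: "\<And>\<phi>. \<phi> \<in> H \<Longrightarrow> \<phi> \<in> borel_measurable borel" and H2: "\<And>\<phi>. \<phi> \<in> H \<Longrightarrow> integrable \<pi> (\<lambda>x. (\<phi> x)\<^sup>2)"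
    and N: "\<And>\<phi>. 0 \<le> N \<phi>"
    and approx: "\<And>b::real. b > 1 \<Longrightarrow> \<exists>C \<theta> (I :: nat \<Rightarrow> 'i set) E. 1 \<le> C \<and> 0 < \<theta> \<and> \<theta> < 1 \<and>
      (\<forall>n. finite (I n) \<and> real (card (I n)) \<le> C * b ^ n \<and> (\<forall>i\<in>I n. E n i \<in> sets borel)) \<and>
      (\<forall>\<phi>\<in>H. \<forall>n. \<exists>a. (\<forall>i\<in>I n. \<bar>a i\<bar> \<le> C * b ^ n * N \<phi>) \<and>
         integrable \<pi> (\<lambda>x. (\<phi> x - (\<Sum>i\<in>I n. a i * indicator (E n i) x))\<^sup>2) \<and>
         (LINT x|\<pi>. (\<phi> x - (\<Sum>i\<in>I n. a i * indicator (E n i) x))\<^sup>2) \<le> C * \<theta> ^ n * (N \<phi>)\<^sup>2)"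
  shows "\<exists>D \<alpha>. D \<in> borel_measurable \<Omega> \<and> (\<forall>\<omega>. 1 \<le> D \<omega>) \<and> integrable \<Omega> (\<lambda>\<omega>. \<bar>D \<omega>\<bar> powr q) \<and> (\<alpha>::real) > 0 \<and>
    (\<forall>\<phi>\<in>H. \<forall>\<psi>\<in>H. (LINT x|\<pi>. \<phi> x) = 0 \<longrightarrow> (LINT x|\<pi>. \<psi> x) = 0 \<longrightarrow>
      (AE \<omega> in \<Omega>. \<forall>n. \<bar>LINT x|\<pi>. \<phi> x * \<psi> (rds f n \<omega> x)\<bar> \<le> D \<omega> * exp (- \<alpha> * real n) * N \<phi> * N \<psi>))"
proof -
  obtain C2 \<gamma> where C2: "C2 \<ge> 1" and \<gamma>: "0 < \<gamma>" "\<gamma> < 1" and decay: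
    "\<And>n. \<forall>\<phi>\<in>borel_measurable borel. \<forall>\<psi>\<in>borel_measurable borel. (\<forall>x. \<bar>\<phi> x\<bar> \<le> 1) \<longrightarrow>
      (\<forall>x. \<bar>\<psi> x\<bar> \<le> 1) \<longrightarrow> (LINT x|\<pi>. \<psi> x) = 0 \<longrightarrow> (LINT \<omega>|\<Omega>. (correlation \<phi> \<psi> n \<omega>)\<^sup>2) \<le> C2 * \<gamma> ^ n"
    by (rule second_moment_decay[OF ge]) (rule that)
  define k where "k = nat \<lceil>q\<rceil>"
  \<comment> \<open>At least \<open>q\<close>, as the moment of order \<open>q\<close> is wanted,
    and of the form to which \<open>correlation_sum_moment\<close> applies.\<close>
  define r where "r = k + 2"
  have r: "r > 0" "q \<le> real r" unfolding r_def k_def using q by linarith+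
  \<comment> \<open>The moment of order \<open>r\<close> of \<open>X n\<close> grows by a factor of
    at most \<open>b ^ (5 * r)\<close> per step relative to the decay \<gamma>; this
    \<open>b\<close> makes that factor equal to \<open>\<gamma> powr (- 1 / 2)\<close>, so that
    \<kappa> is the square root of \<gamma>.\<close>
  define b where "b = \<gamma> powr (- 1 / (10 * real r))"
  have b: "b > 1"
  proof -
    have "0 < - 1 / (10 * real r) * ln \<gamma>" using \<gamma> r by (intro mult_neg_neg) auto
    then show ?thesis using \<gamma> by (simp add: b_def powr_def)
  qed
  define \<kappa> where "\<kappa> = b ^ (5 * r) * \<gamma>"
  have "b ^ (5 * r) = b powr real (5 * r)" using b by (intro powr_realpow[symmetric]) simp
  also have "\<dots> = \<gamma> powr (- 1 / 2)" unfolding b_def powr_powr using r by simp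
  finally have "b ^ (5 * r) = \<gamma> powr (- 1 / 2)" .
  then have "\<kappa> = \<gamma> powr (1 / 2)"
    using \<gamma> by (simp add: \<kappa>_def powr_mult_base mult.commute)
  then have \<kappa>: "0 \<le> \<kappa>" "\<kappa> < 1" using \<gamma> by (simp_all add: powr_half_sqrt)
  obtain C \<theta> and I :: "nat \<Rightarrow> 'i set" and E where C: "1 \<le> C" and \<theta>: "0 < \<theta>" "\<theta> < 1"
    and I: "\<And>n. finite (I n)" "\<And>n. real (card (I n)) \<le> C * b ^ n" and E: "\<And>n i. i \<in> I n \<Longrightarrow> E n i \<in> sets borel"
    and ap: "\<And>\<phi> n. \<phi> \<in> H \<Longrightarrow> \<exists>a. (\<forall>i\<in>I n. \<bar>a i\<bar> \<le> C * b ^ n * N \<phi>) \<and>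
         integrable \<pi> (\<lambda>x. (\<phi> x - (\<Sum>i\<in>I n. a i * indicator (E n i) x))\<^sup>2) \<and>
         (LINT x|\<pi>. (\<phi> x - (\<Sum>i\<in>I n. a i * indicator (E n i) x))\<^sup>2) \<le> C * \<theta> ^ n * (N \<phi>)\<^sup>2"
    using approx[OF b] by blast
  \<comment> \<open>The first bound lets the weight \<open>\<beta> ^ n\<close> be paid from the
    growth allowance \<open>b ^ n\<close>; the second keeps \<beta> below the reciprocal of the rate
    of the L2 approximation error.\<close>
  define \<beta> where "\<beta> = min b (1 / sqrt \<theta>)"
  have \<beta>: "\<beta> > 1" "\<beta> \<le> b" "\<beta> \<le> 1 / sqrt \<theta>" using b \<theta> by (auto simp: \<beta>_def)
  define \<alpha> where "\<alpha> = ln \<beta>"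
  have \<alpha>: "\<alpha> > 0" using \<beta> by (simp add: \<alpha>_def)
  have exp\<alpha>: "exp (- \<alpha> * real n) = 1 / \<beta> ^ n" for n
  proof -
    have "exp (- \<alpha> * real n) = inverse (exp \<alpha> ^ n)"
      by (simp add: exp_minus exp_of_nat_mult[symmetric] mult.commute)
    also have "exp \<alpha> = \<beta>" using \<beta> by (simp add: \<alpha>_def)
    finally show ?thesis by (simp add: inverse_eq_divide)
  qed
  define m where "m n = C * b ^ n" for n
  have m: "m n \<ge> 1" for n
    using mult_mono[of 1 C 1 "b ^ n"] C b by (simp add: m_def)
  define W where "W n \<omega> = (\<Sum>(i, j)\<in>I n \<times> I n. \<bar>correlation (indicator (E n i)) (\<lambda>x. indicator (E n j) x - measure \<pi> (E n j)) n \<omega>\<bar>)" for n \<omega>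
  have e: "0 \<le> C2 * \<gamma> ^ n" for n using C2 \<gamma> by simp
  have Im: "real (card (I n)) \<le> m n" for n using I(2) by (simp add: m_def)
  have Wm [measurable]: "W n \<in> borel_measurable \<Omega>" for n
    unfolding W_def r_def by (rule correlation_sum_moment(1)[where n=n and I="I n" and E="E n" and m="m n" and e="C2 * \<gamma> ^ n", OF decay I(1) Im E e])
  have W0: "0 \<le> W n \<omega>" for n \<omega>
    unfolding W_def r_def by (rule correlation_sum_moment(2)[where n=n and I="I n" and E="E n" and m="m n" and e="C2 * \<gamma> ^ n", OF decay I(1) Im E e])
  have Wi: "integrable \<Omega> (\<lambda>\<omega>. W n \<omega> ^ r)" for n
    unfolding W_def r_def by (rule correlation_sum_moment(3)[where n=n and I="I n" and E="E n" and m="m n" and e="C2 * \<gamma> ^ n", OF decay I(1) Im E e])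
  have Wle: "(LINT \<omega>|\<Omega>. W n \<omega> ^ r) \<le> ((m n)\<^sup>2) ^ r * (C2 * \<gamma> ^ n)" for n
    unfolding W_def r_def by (rule correlation_sum_moment(4)[where n=n and I="I n" and E="E n" and m="m n" and e="C2 * \<gamma> ^ n", OF decay I(1) Im E e])
  \<comment> \<open>The factor \<open>(m n)\<^sup>2\<close> is the product of the coefficient bounds
    of the two observables, and \<open>\<beta> ^ n\<close> the decay to be gained.\<close>
  define X where "X n \<omega> = \<beta> ^ n * (m n)\<^sup>2 * W n \<omega>" for n \<omega>
  have Xpow: "X n \<omega> ^ r = (\<beta> ^ n * (m n)\<^sup>2) ^ r * W n \<omega> ^ r" for n \<omega>
    by (simp add: X_def power_mult_distrib)
  have X: "X n \<in> borel_measurable \<Omega>" "0 \<le> X n \<omega>" "integrable \<Omega> (\<lambda>\<omega>. X n \<omega> ^ r)" for n \<omega>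
  proof -
    show "X n \<in> borel_measurable \<Omega>" unfolding X_def by measurable
    show "0 \<le> X n \<omega>" unfolding X_def using W0[of n \<omega>] \<beta> by (intro mult_nonneg_nonneg) auto
    show "integrable \<Omega> (\<lambda>\<omega>. X n \<omega> ^ r)" unfolding Xpow using Wi[of n] by (intro integrable_mult_right)
  qed
  have Xle: "(LINT \<omega>|\<Omega>. X n \<omega> ^ r) \<le> (C ^ (4 * r) * C2) * \<kappa> ^ n" for n
  proof -
    have "(LINT \<omega>|\<Omega>. X n \<omega> ^ r) = (\<beta> ^ n * (m n)\<^sup>2) ^ r * (LINT \<omega>|\<Omega>. W n \<omega> ^ r)" unfolding Xpow by simp
    also have "\<dots> \<le> (b ^ n * (m n)\<^sup>2) ^ r * (((m n)\<^sup>2) ^ r * (C2 * \<gamma> ^ n))"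
    proof (rule mult_mono[OF power_mono Wle])
      show "\<beta> ^ n * (m n)\<^sup>2 \<le> b ^ n * (m n)\<^sup>2" using \<beta> by (intro mult_right_mono power_mono) auto
      show "0 \<le> (LINT \<omega>|\<Omega>. W n \<omega> ^ r)" using W0 by (intro integral_nonneg_AE) auto
    qed (use \<beta> b in auto)
    also have "\<dots> = C ^ (4 * r) * C2 * \<kappa> ^ n"
    proof -
      have e1: "b ^ n * (m n)\<^sup>2 = C\<^sup>2 * (b ^ 3) ^ n" and e2: "(m n)\<^sup>2 = C\<^sup>2 * (b\<^sup>2) ^ n"
        by (simp_all add: m_def power_mult_distrib power_mult[symmetric] power_add[symmetric] mult.commute mult.left_commute)
      have "(b ^ n * (m n)\<^sup>2) ^ r * (((m n)\<^sup>2) ^ r * (C2 * \<gamma> ^ n)) =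
        (C\<^sup>2 * (b ^ 3) ^ n) ^ r * ((C\<^sup>2 * (b\<^sup>2) ^ n) ^ r * (C2 * \<gamma> ^ n))"
        unfolding e1 unfolding e2 ..
      also have "\<dots> = (C\<^sup>2 * C\<^sup>2) ^ r * C2 * (((b ^ 3 * b\<^sup>2) ^ r) ^ n * \<gamma> ^ n)"
      proof -
        have pw: "(x ^ n) ^ r = (x ^ r) ^ n" for x :: real
          by (simp add: power_mult[symmetric] mult.commute)
        show ?thesis by (simp only: power_mult_distrib pw mult_ac)
      qed
      also have "(C\<^sup>2 * C\<^sup>2) ^ r = C ^ (4 * r)" by (simp add: power_add[symmetric] power_mult[symmetric])
      also have "(b ^ 3 * b\<^sup>2) ^ r = b ^ (5 * r)" by (simp add: power_add[symmetric] power_mult[symmetric])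
      finally show ?thesis by (simp add: \<kappa>_def power_mult_distrib)
    qed
    finally show ?thesis .
  qed
  have c0: "0 \<le> C ^ (4 * r) * C2" using C C2 by simp
  obtain D where Dm [measurable]: "D \<in> borel_measurable \<Omega>" and D1: "\<And>\<omega>. 1 \<le> D \<omega>"
    and Di: "integrable \<Omega> (\<lambda>\<omega>. D \<omega> powr q)" and Dom: "AE \<omega> in \<Omega>. \<forall>n. X n \<omega> \<le> D \<omega>"
    by (rule dominating_random_variable[OF X Xle \<kappa> c0 r(1) q r(2)]) (rule that)
  define c where "c = sqrt C"
  have c: "1 \<le> c" using C by (simp add: c_def)
  \<comment> \<open>The L2 norm of an observable in terms of \<open>N\<close>, read off from the
    approximation at time 0: the error contributes \<open>C\<close>, and at most \<open>C\<close>
    indicators with coefficients up to \<open>C * N \<phi>\<close> contribute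
    \<open>C\<^sup>2\<close>. The doublings come from the square of a sum.\<close>
  define L where "L = sqrt (2 * C + 2 * (C\<^sup>2)\<^sup>2)"
  have L: "0 \<le> L" "L\<^sup>2 = 2 * C + 2 * (C\<^sup>2)\<^sup>2" using C by (simp_all add: L_def)
  have L2: "(LINT x|\<pi>. (\<phi> x)\<^sup>2) \<le> (L * N \<phi>)\<^sup>2" if \<phi>: "\<phi> \<in> H" for \<phi>
  proof -
    obtain a where a: "\<And>i. i \<in> I 0 \<Longrightarrow> \<bar>a i\<bar> \<le> C * N \<phi>"
      and ai: "integrable \<pi> (\<lambda>x. (\<phi> x - (\<Sum>i\<in>I 0. a i * indicator (E 0 i) x))\<^sup>2)"
      and al: "(LINT x|\<pi>. (\<phi> x - (\<Sum>i\<in>I 0. a i * indicator (E 0 i) x))\<^sup>2) \<le> C * (N \<phi>)\<^sup>2"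
      using ap[OF \<phi>, of 0] by auto
    have g: "\<bar>\<Sum>i\<in>I 0. a i * indicator (E 0 i) x\<bar> \<le> C\<^sup>2 * N \<phi>" for x
    proof -
      have "\<bar>\<Sum>i\<in>I 0. a i * indicator (E 0 i) x\<bar> \<le> (\<Sum>i\<in>I 0. \<bar>a i * indicator (E 0 i) x\<bar>)" by (rule sum_abs)
      also have "\<dots> \<le> (\<Sum>i\<in>I 0. C * N \<phi>)"
        using a C N[of \<phi>] by (intro sum_mono) (auto simp: abs_mult indicator_def)
      also have "\<dots> = real (card (I 0)) * (C * N \<phi>)" by simp
      also have "\<dots> \<le> C * (C * N \<phi>)" using I(2)[of 0] C N[of \<phi>] by (intro mult_right_mono) auto
      finally show ?thesis by (simp add: power2_eq_square mult.assoc)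
    qed
    have pt: "(\<phi> x)\<^sup>2 \<le> 2 * (\<phi> x - (\<Sum>i\<in>I 0. a i * indicator (E 0 i) x))\<^sup>2 + 2 * (C\<^sup>2 * N \<phi>)\<^sup>2" for x
    proof -
      define y where "y = (\<Sum>i\<in>I 0. a i * indicator (E 0 i) x)"
      have "(\<phi> x)\<^sup>2 \<le> 2 * (\<phi> x - y)\<^sup>2 + 2 * y\<^sup>2"
        using zero_le_power2[of "\<phi> x - 2 * y"] by (simp add: power2_eq_square algebra_simps)
      moreover have "y\<^sup>2 \<le> (C\<^sup>2 * N \<phi>)\<^sup>2"
        using g[of x] unfolding y_def[symmetric] by (rule power2_le_iff_abs_le[THEN iffD2, rotated]) (use N in auto)
      ultimately show ?thesis unfolding y_def by linarith
    qed
    have "(LINT x|\<pi>. (\<phi> x)\<^sup>2) \<le> (LINT x|\<pi>. 2 * (\<phi> x - (\<Sum>i\<in>I 0. a i * indicator (E 0 i) x))\<^sup>2 + 2 * (C\<^sup>2 * N \<phi>)\<^sup>2)"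
      by (rule integral_mono[OF H2[OF \<phi>] _ pt]) (use ai in auto)
    also have "\<dots> = 2 * (LINT x|\<pi>. (\<phi> x - (\<Sum>i\<in>I 0. a i * indicator (E 0 i) x))\<^sup>2) + 2 * (C\<^sup>2 * N \<phi>)\<^sup>2"
      using ai \<pi>.prob_space by simp
    also have "\<dots> \<le> 2 * (C * (N \<phi>)\<^sup>2) + 2 * (C\<^sup>2 * N \<phi>)\<^sup>2" using al by simp
    also have "\<dots> = (L * N \<phi>)\<^sup>2" by (simp add: power_mult_distrib L(2) algebra_simps)
    finally show ?thesis .
  qed
  \<comment> \<open>The approximation errors add \<open>(2 * u + 2 * L) * u\<close>, where
    \<open>u\<close> is at most \<open>c\<close> and at most \<open>c / \<beta> ^ n\<close>; the
    resulting constant is absorbed into \<open>D\<close> because 1 \<le> D.\<close>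
  define c3 where "c3 = 1 + (2 * c + 2 * L) * c"
  have c3: "1 \<le> c3" using c L by (simp add: c3_def)
  have main: "AE \<omega> in \<Omega>. \<forall>n. \<bar>LINT x|\<pi>. \<phi> x * \<psi> (rds f n \<omega> x)\<bar> \<le> c3 * D \<omega> * exp (- \<alpha> * real n) * N \<phi> * N \<psi>"
    if \<phi>: "\<phi> \<in> H" and \<psi>: "\<psi> \<in> H" and mean: "(LINT x|\<pi>. \<phi> x) = 0" "(LINT x|\<pi>. \<psi> x) = 0" for \<phi> \<psi>
    \<comment> \<open>Both null sets are independent of the observables.\<close>
    using Dom rds_preserving
  proof (eventually_elim, intro allI)
    fix \<omega> n assume dom: "\<forall>n. X n \<omega> \<le> D \<omega>" and pres: "\<forall>n. distr \<pi> borel (rds f n \<omega>) = \<pi>"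
    obtain a where a: "\<And>i. i \<in> I n \<Longrightarrow> \<bar>a i\<bar> \<le> m n * N \<phi>"
      and ai: "integrable \<pi> (\<lambda>x. (\<phi> x - (\<Sum>i\<in>I n. a i * indicator (E n i) x))\<^sup>2)"
      and al: "(LINT x|\<pi>. (\<phi> x - (\<Sum>i\<in>I n. a i * indicator (E n i) x))\<^sup>2) \<le> C * \<theta> ^ n * (N \<phi>)\<^sup>2"
      using ap[OF \<phi>, of n] unfolding m_def by blast
    obtain a' where a': "\<And>i. i \<in> I n \<Longrightarrow> \<bar>a' i\<bar> \<le> m n * N \<psi>"
      and ai': "integrable \<pi> (\<lambda>x. (\<psi> x - (\<Sum>i\<in>I n. a' i * indicator (E n i) x))\<^sup>2)"
      and al': "(LINT x|\<pi>. (\<psi> x - (\<Sum>i\<in>I n. a' i * indicator (E n i) x))\<^sup>2) \<le> C * \<theta> ^ n * (N \<psi>)\<^sup>2"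
      using ap[OF \<psi>, of n] unfolding m_def by blast
    \<comment> \<open>The square root of \<open>C * \<theta> ^ n\<close>, so that
      \<open>u * N \<phi>\<close> bounds the L2 error of \<phi>, and likewise for \<psi>.\<close>
    define u where "u = c * sqrt \<theta> ^ n"
    have u0: "0 \<le> u" using c \<theta> by (simp add: u_def)
    have u2: "u\<^sup>2 = C * \<theta> ^ n"
      using C \<theta> by (simp add: u_def c_def power_mult_distrib power_mult[symmetric] mult.commute[of n 2]) (simp add: power_mult)
    have uc: "u \<le> c" using c \<theta> mult_left_mono[of "sqrt \<theta> ^ n" 1 c] power_le_one[of "sqrt \<theta>" n] by (simp add: u_def)
    have u\<beta>: "u \<le> c * (1 / \<beta> ^ n)"
    proof -
      have "sqrt \<theta> \<le> 1 / \<beta>" using \<beta> \<theta> by (simp add: field_simps)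
      then have "sqrt \<theta> ^ n \<le> (1 / \<beta>) ^ n" using \<theta> by (intro power_mono) auto
      then show ?thesis unfolding u_def using c by (intro mult_left_mono) (auto simp: power_one_over)
    qed
    have T: "rds f n \<omega> \<in> \<pi> \<rightarrow>\<^sub>M \<pi>" using rds_measurable1[of n \<omega>] by (simp cong: measurable_cong_sets)
    have presT: "distr \<pi> \<pi> (rds f n \<omega>) = \<pi>"
      using pres distr_cong[OF refl sets_\<pi> refl, of \<pi> "rds f n \<omega>"] by metis
    have meas: "\<phi> \<in> borel_measurable \<pi>" "\<psi> \<in> borel_measurable \<pi>"
      using Hm[OF \<phi>] Hm[OF \<psi>] by (simp_all cong: measurable_cong_sets)
    have split: "\<bar>LINT x|\<pi>. \<phi> x * \<psi> (rds f n \<omega> x)\<bar> \<le>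
      (m n * N \<phi>) * (m n * N \<psi>) * (\<Sum>(i, j)\<in>I n \<times> I n. \<bar>LINT x|\<pi>. indicator (E n i) x * (indicator (E n j) (rds f n \<omega> x) - measure \<pi> (E n j))\<bar>)
      + 2 * (u * N \<phi>) * (u * N \<psi>) + (L * N \<phi>) * (u * N \<psi>) + (u * N \<phi>) * (L * N \<psi>)"
    proof (rule \<pi>.abs_correlation_split[OF T presT meas H2[OF \<phi>] L2[OF \<phi>] _ H2[OF \<psi>] L2[OF \<psi>] _ mean I(1) _ a a' _ _ refl refl ai _ _ ai' _ _])
      show "0 \<le> L * N \<phi>" "0 \<le> L * N \<psi>" "0 \<le> m n * N \<phi>" "0 \<le> m n * N \<psi>" "0 \<le> u * N \<phi>" "0 \<le> u * N \<psi>"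
        using L N m[of n] u0 by (auto intro!: mult_nonneg_nonneg)
      show "(LINT x|\<pi>. (\<phi> x - (\<Sum>i\<in>I n. a i * indicator (E n i) x))\<^sup>2) \<le> (u * N \<phi>)\<^sup>2"
        "(LINT x|\<pi>. (\<psi> x - (\<Sum>i\<in>I n. a' i * indicator (E n i) x))\<^sup>2) \<le> (u * N \<psi>)\<^sup>2"
        using al al' by (simp_all add: power_mult_distrib u2)
    qed (use E in simp)
    have Wle: "(m n)\<^sup>2 * W n \<omega> \<le> D \<omega> * (1 / \<beta> ^ n)"
    proof -
      have "\<beta> ^ n * ((m n)\<^sup>2 * W n \<omega>) \<le> D \<omega>" using spec[OF dom, of n] by (simp add: X_def mult.assoc)
      then show ?thesis using \<beta> by (simp add: field_simps)
    qed
    have "\<bar>LINT x|\<pi>. \<phi> x * \<psi> (rds f n \<omega> x)\<bar> \<le> ((m n)\<^sup>2 * W n \<omega> + (2 * u + 2 * L) * u) * (N \<phi> * N \<psi>)"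
      using split unfolding W_def correlation_def by (simp add: power2_eq_square algebra_simps)
    also have "\<dots> \<le> (D \<omega> * (1 / \<beta> ^ n) + (2 * c + 2 * L) * (c * (1 / \<beta> ^ n))) * (N \<phi> * N \<psi>)"
    proof (rule mult_right_mono[OF add_mono[OF Wle mult_mono[OF _ u\<beta>]]])
      show "2 * u + 2 * L \<le> 2 * c + 2 * L" "0 \<le> 2 * c + 2 * L" using uc c L by linarith+
    qed (use u0 N in auto)
    also have "\<dots> \<le> (c3 * D \<omega> * (1 / \<beta> ^ n)) * (N \<phi> * N \<psi>)"
    proof (rule mult_right_mono)
      have "(2 * c + 2 * L) * c * 1 \<le> (2 * c + 2 * L) * c * D \<omega>"
        using c L D1[of \<omega>] by (intro mult_left_mono) auto
      then have "(D \<omega> + (2 * c + 2 * L) * c) * (1 / \<beta> ^ n) \<le> (c3 * D \<omega>) * (1 / \<beta> ^ n)"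
        using \<beta> by (intro mult_right_mono) (auto simp: c3_def algebra_simps)
      then show "D \<omega> * (1 / \<beta> ^ n) + (2 * c + 2 * L) * (c * (1 / \<beta> ^ n)) \<le> c3 * D \<omega> * (1 / \<beta> ^ n)"
        by (simp only: distrib_right mult.assoc)
    qed (use N in auto)
    finally show "\<bar>LINT x|\<pi>. \<phi> x * \<psi> (rds f n \<omega> x)\<bar> \<le> c3 * D \<omega> * exp (- \<alpha> * real n) * N \<phi> * N \<psi>"
      by (simp only: exp\<alpha> mult.assoc)
  qed
  show ?thesis
  proof (intro exI[of _ "\<lambda>\<omega>. c3 * D \<omega>"] exI[of _ \<alpha>] conjI ballI impI allI)
    show "(\<lambda>\<omega>. c3 * D \<omega>) \<in> borel_measurable \<Omega>" by measurable
    show "1 \<le> c3 * D \<omega>" for \<omega> using mult_mono[OF c3 D1[of \<omega>]] c3 by simp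
    have "\<bar>c3 * D \<omega>\<bar> powr q = c3 powr q * D \<omega> powr q" for \<omega>
      using c3 D1[of \<omega>] by (simp add: abs_mult powr_mult)
    then show "integrable \<Omega> (\<lambda>\<omega>. \<bar>c3 * D \<omega>\<bar> powr q)" using Di by simp
    show "\<alpha> > 0" by (rule \<alpha>)
  qed (rule main)
qed

end

text \<open>What remains is to place the smooth setting in the locale and to supply
  \<open>quenched_decay\<close> with the grid approximation, whose sets are indexed by a member of
  the partition of unity and a cell.\<close>

theorem theorem1p4:
  fixes A :: "('m::{second_countable_topology,t2_space}, real ^ 'n) chart set"
    and g :: "('m, real ^ 'n) metric"
    and vol \<pi> :: "'m measure"
    and PU :: "(('m, real ^ 'n) chart \<times> ('m \<Rightarrow> real)) set"
    and A\<^sub>0 :: "('w::{second_countable_topology,t2_space}, real ^ 'k) chart set"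
    and g\<^sub>0 :: "('w, real ^ 'k) metric"
    and vol\<^sub>0 P\<^sub>0 :: "'w measure"
    and f :: "'w \<Rightarrow> 'm \<Rightarrow> 'm"
    and C\<^sub>0 lyap p :: real
    and \<psi>\<^sub>0 :: "'m \<times> 'm \<Rightarrow> real"
  assumes M: "riemannian_manifold A g" "compact (UNIV :: 'm set)"
    and vol: "is_riemannian_volume A g vol" "\<pi> = uniform_measure vol UNIV"
    and PU: "chart_partition A PU"
    and P0: "prob_space P\<^sub>0" "sets P\<^sub>0 = sets borel"
    and R: "riemannian_manifold A\<^sub>0 g\<^sub>0" "complete_riemannian A\<^sub>0 g\<^sub>0"
      "is_riemannian_volume A\<^sub>0 g\<^sub>0 vol\<^sub>0" "absolutely_continuous vol\<^sub>0 P\<^sub>0"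
      "Ck_map 2 (prod_atlas A\<^sub>0 A) A (\<lambda>(\<omega>, x). f \<omega> x)"
    and B1: "C\<^sub>0 > 0"
      "AE \<omega> in P\<^sub>0. \<forall>x.
         tangent_onorm A g x (f \<omega> x) (tangent_map A (f \<omega>) x) \<le> C\<^sub>0 \<and>
         bij_betw (tangent_map A (f \<omega>) x) (tangent_space A x) (tangent_space A (f \<omega> x)) \<and>
         inverse (tangent_onorm A g (f \<omega> x) x
           (inv_into (tangent_space A x) (tangent_map A (f \<omega>) x))) \<ge> inverse C\<^sub>0"
    and B2: "\<exists>C::real. AE \<omega> in P\<^sub>0. C2_norm PU (f \<omega>) \<le> ennreal C"
    and U': "AE \<omega> in P\<^sub>0. distr \<pi> borel (f \<omega>) = \<pi>"
    and one_point: "uniformly_geometrically_ergodic borel (one_point_kernel P\<^sub>0 f) \<pi>"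
    and lyapunov: "AE (\<omega>, x) in noise P\<^sub>0 \<Otimes>\<^sub>M \<pi>.
         (\<lambda>n. 1 / real n * ln (tangent_onorm A g x (rds f n \<omega> x) (tangent_map A (rds f n \<omega>) x)))
           \<longlonglongrightarrow> lyap"
      "lyap > 0"
    and projective: "\<exists>\<nu>. uniformly_geometrically_ergodic
         (unit_tangent_borel A g) (projective_kernel A g P\<^sub>0 f) \<nu>"
    and p: "0 < p" "p < 1"
    and \<psi>\<^sub>0: "continuous_on off_diagonal \<psi>\<^sub>0" "\<forall>z\<in>off_diagonal. 0 < \<psi>\<^sub>0 z"
      "\<exists>K. \<forall>z\<in>off_diagonal. \<psi>\<^sub>0 z \<le> K"
      "\<exists>N. open N \<and> (\<forall>x. (x, x) \<in> N) \<and> (\<exists>k>0. \<forall>z\<in>N \<inter> off_diagonal. k \<le> \<psi>\<^sub>0 z)"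
    and two_point: "\<exists>\<mu>. geometrically_ergodic off_diagonal_borel
         (\<lambda>(x, y). riemannian_dist A g x y powr (- p) * \<psi>\<^sub>0 (x, y)) (two_point_kernel P\<^sub>0 f) \<mu>"
  shows "\<forall>q>0. \<forall>s>0. \<exists>D \<alpha>.
     D \<in> borel_measurable (noise P\<^sub>0) \<and> (\<forall>\<omega>. 1 \<le> D \<omega>) \<and>
     integrable (noise P\<^sub>0) (\<lambda>\<omega>. \<bar>D \<omega>\<bar> powr q) \<and> (\<alpha>::real) > 0 \<and>
     (\<forall>\<phi>\<in>sobolev_space PU \<pi> s. \<forall>\<psi>\<in>sobolev_space PU \<pi> s.
        (LINT x|\<pi>. \<phi> x) = 0 \<longrightarrow> (LINT x|\<pi>. \<psi> x) = 0 \<longrightarrow>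
        (AE \<omega> in noise P\<^sub>0. \<forall>n.
           \<bar>LINT x|\<pi>. \<phi> x * \<psi> (rds f n \<omega> x)\<bar>
             \<le> D \<omega> * exp (- \<alpha> * real n) * sobolev_norm PU s \<phi> * sobolev_norm PU s \<psi>))"
proof (intro allI impI)
  fix q s :: real assume q: "q > 0" and s: "s > 0"
  \<comment> \<open>Stationarity for the one-point kernel includes that \<pi> is a probability
    measure, which in turn makes the total volume positive and finite.\<close>
  have prob_\<pi>: "prob_space \<pi>"
  proof -
    have "stationary borel (one_point_kernel P\<^sub>0 f) \<pi>"
      by (rule geometrically_ergodicE[OF one_point[unfolded uniformly_geometrically_ergodic_def]])
    then show ?thesis by (simp add: stationary_def)
  qed
  have sets_\<pi>: "sets \<pi> = sets borel"
    using vol by (simp add: is_riemannian_volume_def)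
  have cover: "(\<Union>c\<in>A. fst c) = UNIV"
    using M(1) by (simp add: riemannian_manifold_def smooth_manifold_def)
  have singleton: "emeasure \<pi> {x} = 0" for x
  proof -
    obtain c where c: "c \<in> A" "x \<in> fst c" using cover by blast
    have "sets vol = sets borel" using vol(1) by (simp add: is_riemannian_volume_def)
    then have "emeasure \<pi> {x} = emeasure vol {x} / emeasure vol UNIV"
      unfolding vol(2) by (subst emeasure_uniform_measure) auto
    then show ?thesis by (simp add: emeasure_vol_singleton[OF M(1) vol(1) c])
  qed
  \<comment> \<open>Joint continuity yields joint Borel measurability; second countability of both
    spaces identifies the Borel sets of the product with the product of the Borel sets.\<close>
  have "continuous_on UNIV (\<lambda>(\<omega>, x). f \<omega> x)"
    using R(5) by (simp add: Ck_map_def)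
  then have "(\<lambda>(\<omega>, x). f \<omega> x) \<in> borel \<rightarrow>\<^sub>M borel"
    by (rule borel_measurable_continuous_onI)
  then have f_meas: "(\<lambda>(\<omega>, x). f \<omega> x) \<in> P\<^sub>0 \<Otimes>\<^sub>M borel \<rightarrow>\<^sub>M borel"
    unfolding borel_prod[symmetric]
    using measurable_cong_sets[OF sets_pair_measure_cong[OF P0(2) refl] refl] by blast
  interpret volume_preserving_rds P\<^sub>0 f \<pi>
    by (rule volume_preserving_rds.intro[OF P0(1) prob_\<pi> _ sets_\<pi> f_meas U' singleton])
      (use sets_eq_imp_space_eq[OF P0(2)] in simp)
  obtain \<mu> where \<mu>: "geometrically_ergodic off_diagonal_borel
      (\<lambda>(x, y). riemannian_dist A g x y powr (- p) * \<psi>\<^sub>0 (x, y)) (two_point_kernel P\<^sub>0 f) \<mu>"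
    using two_point ..
  show "\<exists>D \<alpha>. D \<in> borel_measurable (noise P\<^sub>0) \<and> (\<forall>\<omega>. 1 \<le> D \<omega>) \<and>
     integrable (noise P\<^sub>0) (\<lambda>\<omega>. \<bar>D \<omega>\<bar> powr q) \<and> (\<alpha>::real) > 0 \<and>
     (\<forall>\<phi>\<in>sobolev_space PU \<pi> s. \<forall>\<psi>\<in>sobolev_space PU \<pi> s.
        (LINT x|\<pi>. \<phi> x) = 0 \<longrightarrow> (LINT x|\<pi>. \<psi> x) = 0 \<longrightarrow>
        (AE \<omega> in noise P\<^sub>0. \<forall>n.
           \<bar>LINT x|\<pi>. \<phi> x * \<psi> (rds f n \<omega> x)\<bar>
             \<le> D \<omega> * exp (- \<alpha> * real n) * sobolev_norm PU s \<phi> * sobolev_norm PU s \<psi>))"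
  proof (rule quenched_decay[OF \<mu> q])
    fix \<phi> assume "\<phi> \<in> sobolev_space PU \<pi> s"
    then show "\<phi> \<in> borel_measurable borel" "integrable \<pi> (\<lambda>x. (\<phi> x)\<^sup>2)"
      by (simp_all add: sobolev_space_def)
  next
    fix \<phi> :: "'m \<Rightarrow> real"
    show "0 \<le> sobolev_norm PU s \<phi>"
      by (auto simp: sobolev_norm_def intro!: sum_nonneg integral_nonneg_AE)
  next
    fix b :: real assume b: "b > 1"
    obtain C \<theta> :: real and I :: "nat \<Rightarrow> ((('m, real ^ 'n) chart \<times> ('m \<Rightarrow> real)) \<times> (real ^ 'n \<Rightarrow> int)) set" and E
      where C: "C \<ge> 1" "0 < \<theta>" "\<theta> < 1" and I: "\<And>n. finite (I n)" "\<And>n. real (card (I n)) \<le> C * b ^ n"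
        "\<And>n i. i \<in> I n \<Longrightarrow> E n i \<in> sets borel"
        and a: "\<And>\<phi> n. \<phi> \<in> sobolev_space PU \<pi> s \<Longrightarrow> \<exists>a. (\<forall>i\<in>I n. \<bar>a i\<bar> \<le> C * b ^ n * sobolev_norm PU s \<phi>) \<and>
       integrable \<pi> (\<lambda>x. (\<phi> x - (\<Sum>i\<in>I n. a i * indicator (E n i) x))\<^sup>2) \<and>
       (LINT x|\<pi>. (\<phi> x - (\<Sum>i\<in>I n. a i * indicator (E n i) x))\<^sup>2) \<le> C * \<theta> ^ n * (sobolev_norm PU s \<phi>)\<^sup>2"
      by (rule sobolev_approximation[OF M vol prob_\<pi> PU s b]) (rule that)
    show "\<exists>C \<theta> (I :: nat \<Rightarrow> ((('m, real ^ 'n) chart \<times> ('m \<Rightarrow> real)) \<times> (real ^ 'n \<Rightarrow> int)) set) E.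
      1 \<le> C \<and> 0 < \<theta> \<and> \<theta> < 1 \<and>
      (\<forall>n. finite (I n) \<and> real (card (I n)) \<le> C * b ^ n \<and> (\<forall>i\<in>I n. E n i \<in> sets borel)) \<and>
      (\<forall>\<phi>\<in>sobolev_space PU \<pi> s. \<forall>n. \<exists>a. (\<forall>i\<in>I n. \<bar>a i\<bar> \<le> C * b ^ n * sobolev_norm PU s \<phi>) \<and>
         integrable \<pi> (\<lambda>x. (\<phi> x - (\<Sum>i\<in>I n. a i * indicator (E n i) x))\<^sup>2) \<and>
         (LINT x|\<pi>. (\<phi> x - (\<Sum>i\<in>I n. a i * indicator (E n i) x))\<^sup>2) \<le> C * \<theta> ^ n * (sobolev_norm PU s \<phi>)\<^sup>2)"
      by (intro exI[of _ C] exI[of _ \<theta>] exI[of _ I] exI[of _ E] conjI allI ballI C I a)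
  qed
qed

end
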